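(* Let $s\in(0,1)$, $N\ge6s$ and let $\Omega\subset\mathbb{R}^N$ be a smooth bounded domain. There exists $\hat\lambda_s\le\lambda_{1,s}$ such that for every $\lambda\in(0,\hat\lambda_s)$ and every least energy sign-changing solution $u_{s,\lambda}$, the extension $W_{s,\lambda}=E_su_{s,\lambda}$ has exactly two nodal regions. Moreover, for every $s_0\in(0,1)$ there exists $\hat\lambda(s_0)>0$, depending on $N$ and $s_0$ but not on $s$, such that the same conclusion holds for every $\lambda\in(0,\hat\lambda(s_0))$ and every $s\in[s_0,1)$ (with $N\ge6s$).
   Context: $2^*_s=\frac{2N}{N-2s}$, $C_{N,s}=\frac{2^{2s}\Gamma(\frac N2+s)}{\pi^{N/2}|\Gamma(-s)|}$, $(-\Delta)^su(x)=C_{N,s}\,\mathrm{P.V.}\int\frac{u(x)-u(y)}{|x-y|^{N+2s}}dy$. $X_0^s(\Omega)=\{u\in H^s(\mathbb{R}^N):u=0\text{ outside }\Omega\}$, $(u,v)_s=\frac{C_{N,s}}2\iint\frac{(u(x)-u(y))(v(x)-v(y))}{|x-y|^{N+2s}}$, $\|u\|_s^2=(u,u)_s$; $\lambda_{1,s}=\inf_{u\neq0}\|u\|_s^2/|u|_2^2$. A least energy sign-changing solution is a weak solution $u\in X_0^s(\Omega)$ of $(-\Delta)^su=\lambda u+|u|^{2^*_s-2}u$ in $\Omega$ (i.e. $(u,\varphi)_s=\int(\lambda u+|u|^{2^*_s-2}u)\varphi$ for all $\varphi\in X_0^s(\Omega)$) with $u\in\mathcal{M}=\{u:u^\pm\not\equiv0,\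 I'(u)[u^\pm]=0\}$ and $I(u)=\inf_{\mathcal{M}}I$, where $I(u)=\frac12(\|u\|_s^2-\lambda|u|_2^2)-\frac1{2^*_s}|u|_{2^*_s}^{2^*_s}$. The extension of $u$ is $E_su(x,y)=\int_{\mathbb{R}^N}P_{N,s}(x-\xi,y)u(\xi)d\xi$ for $(x,y)\in\mathbb{R}^{N+1}_+=\mathbb{R}^N\times(0,\infty)$, with $P_{N,s}(x,y)=p_{N,s}\frac{y^{2s}}{(y^2+|x|^2)^{(N+2s)/2}}$, $p_{N,s}=\frac{\Gamma(\frac{N+2s}2)}{\pi^{N/2}\Gamma(s)}$. Nodal regions of $W$ are the connected components of $\{(x,y)\in\mathbb{R}^{N+1}_+:W(x,y)\neq0\}$. *)

theory Defs
  imports "HOL-Analysis.Analysis"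
begin

fun Ck_on :: "nat \<Rightarrow> (real^'n) set \<Rightarrow> (real^'n \<Rightarrow> real) \<Rightarrow> bool" where
  "Ck_on 0 U f = continuous_on U f"
| "Ck_on (Suc k) U f = (f differentiable_on U \<and>
      (\<forall>i. Ck_on k U (\<lambda>x. frechet_derivative f (at x) (axis i 1))))"

definition Cinf_on :: "(real^'n) set \<Rightarrow> (real^'n \<Rightarrow> real) \<Rightarrow> bool" where
  "Cinf_on U f = (\<forall>k. Ck_on k U f)"

definition smooth_bounded_domain :: "(real^'n) set \<Rightarrow> bool" where
  "smooth_bounded_domain \<Omega> = (open \<Omega> \<and> connected \<Omega> \<and> bounded \<Omega> \<and> \<Omega> \<noteq> {} \<and>
     (\<forall>p\<in>frontier \<Omega>. \<exists>r>0. \<exists>\<phi>. Cinf_on (ball p r) \<phi> \<and>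
        (\<forall>x\<in>ball p r. frechet_derivative \<phi> (at x) \<noteq> (\<lambda>_. 0)) \<and>
        \<Omega> \<inter> ball p r = {x\<in>ball p r. \<phi> x < 0}))"

definition C_Ns :: "nat \<Rightarrow> real \<Rightarrow> real" where
  "C_Ns N s = 2 powr (2* s) * Gamma (real N / 2 + s) / (pi powr (real N / 2) * abs (Gamma (- s)))"

definition crit_exp :: "nat \<Rightarrow> real \<Rightarrow> real" where
  "crit_exp N s = 2 * real N / (real N - 2* s)"

definition zero_ae :: "(real^'n \<Rightarrow> real) \<Rightarrow> bool" where
  "zero_ae u = (AE x in lborel. u x = 0)"

definition gagliardo :: "real \<Rightarrow> (real^'n \<Rightarrow> real) \<Rightarrow> ennreal" where
  "gagliardo s u = (\<integral>\<^sup>+ x. \<integral>\<^sup>+ y. ennreal ((u x - u y)^2 / norm (x - y) powr (real CARD('n) + 2* s)) \<partial>lborel \<partial>lborel)"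

definition H_s :: "real \<Rightarrow> (real^'n \<Rightarrow> real) \<Rightarrow> bool" where
  "H_s s u = (u \<in> borel_measurable lborel \<and> (\<integral>\<^sup>+ x. ennreal ((u x)^2) \<partial>lborel) < \<infinity> \<and> gagliardo s u < \<infinity>)"

definition X0 :: "(real^'n) set \<Rightarrow> real \<Rightarrow> (real^'n \<Rightarrow> real) set" where
  "X0 \<Omega> s = {u. H_s s u \<and> (AE x in lborel. x \<notin> \<Omega> \<longrightarrow> u x = 0)}"

definition frac_inner :: "real \<Rightarrow> (real^'n \<Rightarrow> real) \<Rightarrow> (real^'n \<Rightarrow> real) \<Rightarrow> real" where
  "frac_inner s u v = C_Ns CARD('n) s / 2 *
     (\<integral>p. (u (fst p) - u (snd p)) * (v (fst p) - v (snd p)) /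
            norm (fst p - snd p) powr (real CARD('n) + 2* s) \<partial>(lborel \<Otimes>\<^sub>M lborel))"

definition Lp_pow :: "real \<Rightarrow> (real^'n \<Rightarrow> real) \<Rightarrow> real" where
  "Lp_pow p u = (\<integral>x. \<bar>u x\<bar> powr p \<partial>lborel)"

definition lambda1 :: "(real^'n) set \<Rightarrow> real \<Rightarrow> real" where
  "lambda1 \<Omega> s = (INF u \<in> {u \<in> X0 \<Omega> s. \<not> zero_ae u}. frac_inner s u u / Lp_pow 2 u)"

definition energy :: "real \<Rightarrow> real \<Rightarrow> (real^'n \<Rightarrow> real) \<Rightarrow> real" where
  "energy s lam u = 1/2 * (frac_inner s u u - lam * Lp_pow 2 u)
      - 1 / crit_exp CARD('n) s * Lp_pow (crit_exp CARD('n) s) u"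

definition denergy :: "real \<Rightarrow> real \<Rightarrow> (real^'n \<Rightarrow> real) \<Rightarrow> (real^'n \<Rightarrow> real) \<Rightarrow> real" where
  "denergy s lam u v = frac_inner s u v - lam * (\<integral>x. u x * v x \<partial>lborel)
      - (\<integral>x. \<bar>u x\<bar> powr (crit_exp CARD('n) s - 2) * u x * v x \<partial>lborel)"

definition pos_part :: "(real^'n \<Rightarrow> real) \<Rightarrow> real^'n \<Rightarrow> real" where
  "pos_part u = (\<lambda>x. max (u x) 0)"

definition neg_part :: "(real^'n \<Rightarrow> real) \<Rightarrow> real^'n \<Rightarrow> real" where
  "neg_part u = (\<lambda>x. min (u x) 0)"

definition nodal_nehari :: "(real^'n) set \<Rightarrow> real \<Rightarrow> real \<Rightarrow> (real^'n \<Rightarrow> real) set" where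
  "nodal_nehari \<Omega> s lam = {u \<in> X0 \<Omega> s. \<not> zero_ae (pos_part u) \<and> \<not> zero_ae (neg_part u) \<and>
      denergy s lam u (pos_part u) = 0 \<and> denergy s lam u (neg_part u) = 0}"

definition weak_solution :: "(real^'n) set \<Rightarrow> real \<Rightarrow> real \<Rightarrow> (real^'n \<Rightarrow> real) \<Rightarrow> bool" where
  "weak_solution \<Omega> s lam u = (u \<in> X0 \<Omega> s \<and> (\<forall>\<phi> \<in> X0 \<Omega> s.
      frac_inner s u \<phi> = (\<integral>x. (lam * u x + \<bar>u x\<bar> powr (crit_exp CARD('n) s - 2) * u x) * \<phi> x \<partial>lborel)))"

definition least_energy_nodal_solution :: "(real^'n) set \<Rightarrow> real \<Rightarrow> real \<Rightarrow> (real^'n \<Rightarrow> real) \<Rightarrow> bool" where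
  "least_energy_nodal_solution \<Omega> s lam u = (weak_solution \<Omega> s lam u \<and> u \<in> nodal_nehari \<Omega> s lam \<and>
      energy s lam u = (INF v \<in> nodal_nehari \<Omega> s lam. energy s lam v))"

definition poisson_const :: "nat \<Rightarrow> real \<Rightarrow> real" where
  "poisson_const N s = Gamma ((real N + 2* s) / 2) / (pi powr (real N / 2) * Gamma s)"

definition poisson_kernel :: "real \<Rightarrow> real^'n \<Rightarrow> real \<Rightarrow> real" where
  "poisson_kernel s x y = poisson_const CARD('n) s * y powr (2* s) /
      (y^2 + (norm x)^2) powr ((real CARD('n) + 2* s) / 2)"

definition extension :: "real \<Rightarrow> (real^'n \<Rightarrow> real) \<Rightarrow> (real^'n) \<times> real \<Rightarrow> real" where
  "extension s u = (\<lambda>(x, y). \<integral>\<xi>. poisson_kernel s (x - \<xi>) y * u \<xi> \<partial>lborel)"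

definition nodal_regions :: "((real^'n) \<times> real \<Rightarrow> real) \<Rightarrow> ((real^'n) \<times> real) set set" where
  "nodal_regions W = components {p. 0 < snd p \<and> W p \<noteq> 0}"

end

theory Submission
  imports Defs
begin

text \<open>Let \<open>W\<close> be the extension of \<open>u\<close> and \<open>D\<close> a component of \<open>{W > 0}\<close>. By a maximum principle
  \<open>W\<close> lies on \<open>D\<close> below the extension of the part \<open>u\<^sub>1\<close> of \<open>u\<^sup>+\<close> that is carried by \<open>D\<close>. Letting the
  height tend to 0 above a point of the support of \<open>u\<^sub>1\<close>, the nonlocal attraction of \<open>u\<^sub>1\<close> by the
  negative part of \<open>u\<close> dominates its repulsion by the rest of \<open>u\<^sup>+\<close>; hence testing the equation with
  \<open>u\<^sub>1\<close> controls the energy of \<open>u\<^sub>1\<close>, with no need for weighted Sobolev spaces. By the Sobolev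
  inequality every such piece carries at least the \<open>L\<^sup>p\<close> mass \<open>((1 - \<lambda> / \<lambda>\<^sub>1) S) powr (N / (2 s))\<close>, where \<open>S\<close>
  is the best constant. Three nodal regions would give three pieces, but two concentrated near
  minimisers of opposite sign show that the least energy corresponds to at most twice the mass
  \<open>S powr (N / (2 s))\<close>. Uniformity in \<open>s\<close> only needs a uniform lower bound on \<open>\<lambda>\<^sub>1\<close>.\<close>

section \<open>Kernel and change of variables\<close>

text \<open>The obstacle is that \<open>u\<close> is merely a function of finite energy. So boundary
  values are read off along vertical lines over points where the Gagliardo density is finite, and a
  piece of \<open>u\<close> cut out in this way may jump: that it has finite energy at all is part
  of what has to be proved. Truncated extensions have no second derivatives, which is why the
  degenerate elliptic operator appears in difference form. On the variational side neither the value
  of the Sobolev constant nor a minimiser enters. The same constant occurs in the bound for three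
  pieces and in the bound for the least energy, and it cancels. What is left is 3 (1 - \<lambda> /
  \<open>lambda1\<close>)^(N/(2s)) > 2, which holds as soon as \<lambda> is a small fraction of
  \<open>lambda1\<close>. The exponent N/(2s) is at most N/(2 s0), so this fraction can be fixed for
  all s in [s0, 1).\<close>

definition frac_kernel :: "real \<Rightarrow> real^'n \<Rightarrow> real" where
  "frac_kernel s z = 1 / norm z powr (real CARD('n) + 2 * s)"

lemma frac_kernel_nonneg [simp]: "0 \<le> frac_kernel s z"
  by (simp add: frac_kernel_def)

lemma frac_kernel_minus: "frac_kernel s (x - y) = frac_kernel s (y - x)"
  by (simp add: frac_kernel_def norm_minus_commute)

lemma frac_kernel_measurable [measurable]: "frac_kernel s \<in> borel_measurable borel"
  unfolding frac_kernel_def by measurable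

lemma frac_kernel_scaleR:
  assumes "0 < c"
  shows "frac_kernel s (c *\<^sub>R z) = c powr - (real CARD('n) + 2 * s) * frac_kernel s (z::real^'n)"
  unfolding frac_kernel_def using assms
  by (simp add: powr_mult powr_minus divide_simps flip: powr_add)

lemma nn_integral_translate:
  fixes f :: "'a::euclidean_space \<Rightarrow> ennreal"
  assumes [measurable]: "f \<in> borel_measurable borel"
  shows "(\<integral>\<^sup>+x. f (x + a) \<partial>lborel) = (\<integral>\<^sup>+x. f x \<partial>lborel)"
proof -
  have "(\<integral>\<^sup>+x. f x \<partial>lborel) = (\<integral>\<^sup>+x. f x \<partial>(distr lborel borel ((+) a)))"
    by (simp add: lborel_distr_plus)
  also have "\<dots> = (\<integral>\<^sup>+x. f (a + x) \<partial>lborel)"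
    by (subst nn_integral_distr) auto
  finally show ?thesis by (simp add: add.commute)
qed

lemma nn_integral_scale:
  fixes f :: "'a::euclidean_space \<Rightarrow> ennreal"
  assumes [measurable]: "f \<in> borel_measurable borel" and c: "0 < c"
  shows "(\<integral>\<^sup>+x. f x \<partial>lborel) = ennreal (c ^ DIM('a)) * (\<integral>\<^sup>+x. f (t + c *\<^sub>R x) \<partial>lborel)"
proof -
  have "(\<integral>\<^sup>+x. f x \<partial>lborel) = (\<integral>\<^sup>+x. f x \<partial>density (distr lborel borel (\<lambda>x. t + c *\<^sub>R x)) (\<lambda>_. ennreal (\<bar>c\<bar>^DIM('a))))"
    using lborel_affine[of c t] c by simp
  also have "\<dots> = ennreal (c ^ DIM('a)) * (\<integral>\<^sup>+x. f (t + c *\<^sub>R x) \<partial>lborel)"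
    using c by (simp add: nn_integral_density nn_integral_distr nn_integral_cmult)
  finally show ?thesis .
qed

lemma nn_integral_reflect:
  fixes f :: "'a::euclidean_space \<Rightarrow> ennreal"
  assumes [measurable]: "f \<in> borel_measurable borel"
  shows "(\<integral>\<^sup>+x. f (a - x) \<partial>lborel) = (\<integral>\<^sup>+x. f x \<partial>lborel)"
proof -
  have "(\<integral>\<^sup>+x. f x \<partial>lborel) = (\<integral>\<^sup>+x. f x \<partial>density (distr lborel borel (\<lambda>x. a + (-1) *\<^sub>R x)) (\<lambda>_. ennreal (\<bar>-1\<bar>^DIM('a))))"
    using lborel_affine[of "-1" a] by simp
  also have "\<dots> = (\<integral>\<^sup>+x. f (a - x) \<partial>lborel)"
    by (simp add: nn_integral_density nn_integral_distr)
  finally show ?thesis by simp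
qed

text \<open>Dilation by \<open>c\<close> carries each annulus to the next and multiplies its
  integral by \<open>c powr (DIM - a)\<close>, so the annuli form a geometric series. The ratio
  \<open>c\<close> is left free in order to serve both ends: \<open>c = 2\<close> exhausts a
  neighbourhood of infinity, \<open>c = 1/2\<close> a punctured ball.\<close>

lemma nn_integral_power_annuli_finite:
  fixes a r c :: real
  assumes c: "0 < c" and r: "0 < r" and ca: "c powr (real DIM('a) - a) < 1"
  shows "(\<integral>\<^sup>+(z::'a::euclidean_space). ennreal (norm z powr - a) *
           indicator (\<Union>k. {z. c ^ k * r \<le> norm z \<and> norm z < 2 * (c ^ k * r)}) z \<partial>lborel) < \<infinity>"
proof -
  define A where "A k = {z::'a. c ^ k * r \<le> norm z \<and> norm z < 2 * (c ^ k * r)}" for k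
  have [measurable]: "A k \<in> sets borel" for k
    unfolding A_def by measurable
  define I where "I k = (\<integral>\<^sup>+z. ennreal (norm z powr - a) * indicator (A k) z \<partial>lborel)" for k
  have I0: "I 0 < \<infinity>"
  proof -
    \<comment> \<open>The sum of the powers at both radii bounds the integrand for either sign of
      \<open>a\<close>.\<close>
    have "I 0 \<le> (\<integral>\<^sup>+z. ennreal (r powr -a + (2 * r) powr - a) * indicator (ball 0 (2 * r)) z \<partial>(lborel::'a measure))"
      unfolding I_def
    proof (intro nn_integral_mono)
      fix z :: 'a
      have "norm z powr - a \<le> r powr -a + (2 * r) powr - a" if "r \<le> norm z" "norm z < 2 * r"
      proof (cases "a \<ge> 0")
        case True
        then have "norm z powr - a \<le> r powr - a" using that r by (intro powr_mono2') auto
        then show ?thesis by (simp add: add_increasing2)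
      next
        case False
        then have "norm z powr - a \<le> (2 * r) powr - a" using that r by (intro powr_mono2) auto
        then show ?thesis by (simp add: add_increasing)
      qed
      then show "ennreal (norm z powr - a) * indicator (A 0) z \<le> ennreal (r powr -a + (2 * r) powr - a) * indicator (ball 0 (2 * r)) z"
        by (auto simp: A_def indicator_def simp del: ennreal_plus intro!: ennreal_leI)
    qed
    also have "\<dots> < \<infinity>"
      using emeasure_bounded_finite[OF bounded_ball, of "0::'a" "2*r"]
      by (simp add: nn_integral_cmult_indicator ennreal_mult_less_top)
    finally show ?thesis .
  qed
  have Ik: "I k = ennreal ((c powr (real DIM('a) - a)) ^ k) * I 0" for k
  proof -
    have ck: "0 < c ^ k" using c by simp
    have "I k = ennreal ((c ^ k) ^ DIM('a)) * (\<integral>\<^sup>+z. ennreal (norm ((c^k) *\<^sub>R z) powr - a) * indicator (A k) ((c^k) *\<^sub>R z) \<partial>(lborel::'a measure))"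
      unfolding I_def by (subst nn_integral_scale[where c = "c ^ k" and t = 0]) (use ck in auto)
    also have "(\<integral>\<^sup>+z. ennreal (norm ((c^k) *\<^sub>R z) powr - a) * indicator (A k) ((c^k) *\<^sub>R z) \<partial>(lborel::'a measure))
       = (\<integral>\<^sup>+z. ennreal ((c^k) powr - a) * (ennreal (norm z powr - a) * indicator (A 0) z) \<partial>lborel)"
    proof (intro nn_integral_cong)
      fix z :: 'a
      have "indicator (A k) ((c^k) *\<^sub>R z) = (indicator (A 0) z :: ennreal)"
        using c by (auto simp: A_def indicator_def)
      then show "ennreal (norm ((c^k) *\<^sub>R z) powr - a) * indicator (A k) ((c^k) *\<^sub>R z)
          = ennreal ((c^k) powr - a) * (ennreal (norm z powr - a) * indicator (A 0) z)"
        using c by (simp add: powr_mult ennreal_mult mult.assoc)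
    qed
    also have "\<dots> = ennreal ((c^k) powr - a) * I 0"
      unfolding I_def by (intro nn_integral_cmult) measurable
    finally have "I k = (ennreal ((c ^ k) ^ DIM('a)) * ennreal ((c^k) powr - a)) * I 0"
      by (simp add: mult.assoc)
    also have "ennreal ((c ^ k) ^ DIM('a)) * ennreal ((c^k) powr - a) = ennreal ((c powr (real DIM('a) - a)) ^ k)"
    proof -
      have "(c ^ k) ^ DIM('a) * (c^k) powr - a = (c powr (real DIM('a) - a)) ^ k"
        using c by (simp add: powr_realpow[symmetric] powr_powr powr_add[symmetric] algebra_simps)
      then show ?thesis by (simp add: ennreal_mult[symmetric] c less_imp_le)
    qed
    finally show ?thesis .
  qed
  have "(\<integral>\<^sup>+(z::'a). ennreal (norm z powr - a) * indicator (\<Union>k. A k) z \<partial>lborel)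
     \<le> (\<integral>\<^sup>+z. (\<Sum>k. ennreal (norm z powr - a) * indicator (A k) z) \<partial>lborel)"
  proof (intro nn_integral_mono)
    fix z :: 'a
    have "indicator (\<Union>k. A k) z \<le> (\<Sum>k. indicator (A k) z :: ennreal)"
    proof (cases "\<exists>k. z \<in> A k")
      case True
      then obtain k where "z \<in> A k" by auto
      then have "1 = (\<Sum>i\<in>{k}. indicator (A i) z :: ennreal)" by simp
      also have "\<dots> \<le> (\<Sum>k. indicator (A k) z :: ennreal)"
        by (intro sum_le_suminf) auto
      finally show ?thesis by (simp add: indicator_def)
    qed auto
    then show "ennreal (norm z powr - a) * indicator (\<Union>k. A k) z \<le> (\<Sum>k. ennreal (norm z powr - a) * indicator (A k) z)"
      by (simp add: mult_left_mono)
  qed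
  also have "\<dots> = (\<Sum>k. I k)"
    unfolding I_def by (intro nn_integral_suminf) measurable
  also have "\<dots> = (\<Sum>k. ennreal ((c powr (real DIM('a) - a)) ^ k) * I 0)"
    by (intro suminf_cong Ik)
  also have "\<dots> = (\<Sum>k. ennreal ((c powr (real DIM('a) - a)) ^ k)) * I 0"
    by (rule ennreal_suminf_multc)
  also have "(\<Sum>k. ennreal ((c powr (real DIM('a) - a)) ^ k)) = ennreal (\<Sum>k. (c powr (real DIM('a) - a)) ^ k)"
    using ca by (intro suminf_ennreal2 summable_geometric) auto
  also have "\<dots> * I 0 < \<infinity>" using I0 by (simp add: ennreal_mult_less_top)
  finally show ?thesis by (simp add: A_def)
qed

lemma frac_kernel_tail_finite:
  assumes s: "0 < s" and r: "0 < r"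
  shows "(\<integral>\<^sup>+(z::real^'n). ennreal (frac_kernel s z) * indicator {z. r \<le> norm z} z \<partial>lborel) < \<infinity>"
proof -
  have "{z::real^'n. r \<le> norm z} \<subseteq> (\<Union>k. {z. 2 ^ k * r \<le> norm z \<and> norm z < 2 * (2 ^ k * r)})"
  proof
    fix z :: "real^'n" assume "z \<in> {z. r \<le> norm z}"
    then have z: "r \<le> norm z" by simp
    obtain n :: nat where "norm z / r < 2 ^ n" using real_arch_pow[of 2 "norm z / r"] by auto
    then have ex: "norm z < 2 ^ n * r" using r by (simp add: field_simps)
    \<comment> \<open>Index of the first dyadic ball that contains \<open>z\<close>. By minimality
      \<open>z\<close> lies outside the previous ball, whose index \<open>k\<close> names the
      annulus.\<close>
    define m where "m = (LEAST n. norm z < 2 ^ n * r)"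
    have m: "norm z < 2 ^ m * r" unfolding m_def using ex by (rule LeastI)
    with z have "m \<noteq> 0" by (auto intro: Nat.gr0I)
    then obtain k where k: "m = Suc k" using not0_implies_Suc by blast
    have "\<not> norm z < 2 ^ k * r" using not_less_Least[of k "\<lambda>n. norm z < 2 ^ n * r"] k m_def by auto
    then have "2 ^ k * r \<le> norm z \<and> norm z < 2 * (2 ^ k * r)" using m k by simp
    then show "z \<in> (\<Union>k. {z. 2 ^ k * r \<le> norm z \<and> norm z < 2 * (2 ^ k * r)})"
      by (intro UN_I[of k] CollectI) simp_all
  qed
  then have "(\<integral>\<^sup>+(z::real^'n). ennreal (frac_kernel s z) * indicator {z. r \<le> norm z} z \<partial>lborel)
      \<le> (\<integral>\<^sup>+(z::real^'n). ennreal (norm z powr - (real CARD('n) + 2 * s)) *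
           indicator (\<Union>k. {z. 2 ^ k * r \<le> norm z \<and> norm z < 2 * (2 ^ k * r)}) z \<partial>lborel)"
    by (intro nn_integral_mono mult_mono) (auto simp: frac_kernel_def powr_minus_divide simp del: minus_add_distrib split: split_indicator)
  also have "\<dots> < \<infinity>"
    by (rule nn_integral_power_annuli_finite) (use s r in \<open>auto simp: powr_less_one\<close>)
  finally show ?thesis .
qed

text \<open>The factor |z|^2, supplied later by a Lipschitz function, lowers the exponent of the
  singularity to N + 2s - 2, which is below N because s < 1.\<close>

lemma frac_kernel_near_zero_finite:
  assumes s: "s < 1" and r: "0 < r"
  shows "(\<integral>\<^sup>+(z::real^'n). ennreal ((norm z)^2 * frac_kernel s z) * indicator {z. norm z < r} z \<partial>lborel) < \<infinity>"
proof -
  define U where "U = (\<Union>k. {z::real^'n. (1/2) ^ k * (r/2) \<le> norm z \<and> norm z < 2 * ((1/2) ^ k * (r/2))})"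
  have sub: "z \<in> U" if z: "norm z < r" "z \<noteq> 0" for z :: "real^'n"
  proof -
    obtain n :: nat where "r / norm z < 2 ^ n" using real_arch_pow[of 2 "r / norm z"] by auto
    then have ex: "(1/2) ^ n * (r/2) \<le> norm z" using r z by (simp add: field_simps power_divide)
    define m where "m = (LEAST n. (1/2) ^ n * (r/2) \<le> norm z)"
    have m: "(1/2) ^ m * (r/2) \<le> norm z" unfolding m_def using ex by (rule LeastI)
    have "norm z < 2 * ((1/2) ^ m * (r/2))"
    proof (cases m)
      case 0 then show ?thesis using z by simp
    next
      case (Suc k)
      have "\<not> (1/2) ^ k * (r/2) \<le> norm z" using not_less_Least[of k "\<lambda>n. (1/2) ^ n * (r/2) \<le> norm z"] Suc m_def by auto
      then show ?thesis using Suc by (simp add: mult.commute)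
    qed
    with m show ?thesis unfolding U_def by auto
  qed
  have "(\<integral>\<^sup>+(z::real^'n). ennreal ((norm z)^2 * frac_kernel s z) * indicator {z. norm z < r} z \<partial>lborel)
      \<le> (\<integral>\<^sup>+(z::real^'n). ennreal (norm z powr - (real CARD('n) + 2 * s - 2)) * indicator U z \<partial>lborel)"
  proof (intro nn_integral_mono)
    fix z :: "real^'n"
    show "ennreal ((norm z)^2 * frac_kernel s z) * indicator {z. norm z < r} z \<le> ennreal (norm z powr - (real CARD('n) + 2 * s - 2)) * indicator U z"
    proof (cases "z = 0 \<or> r \<le> norm z")
      case False
      then have "(norm z)^2 * frac_kernel s z = norm z powr - (real CARD('n) + 2 * s - 2)"
        by (simp add: frac_kernel_def powr_minus powr_diff powr_add divide_simps)
      then show ?thesis using sub False by (auto simp: indicator_def)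
    qed auto
  qed
  also have "\<dots> < \<infinity>" unfolding U_def
    by (rule nn_integral_power_annuli_finite) (use s r in \<open>auto simp: powr_def ln_div\<close>)
  finally show ?thesis .
qed

section \<open>The Gagliardo form\<close>

text \<open>At a pole \<open>Gamma\<close> has the default value 0, and \<open>C_Ns\<close>, which
  divides by |Gamma(-s)|, would degenerate to 0.\<close>

lemma uminus_notin_nonpos_Ints:
  fixes s :: real
  assumes "0 < s" "s < 1"
  shows "- s \<notin> \<int>\<^sub>\<le>\<^sub>0"
proof
  assume "- s \<in> \<int>\<^sub>\<le>\<^sub>0"
  then obtain n :: int where "- s = of_int n" "n \<le> 0" by (elim nonpos_Ints_cases)
  then have "real_of_int (- 1) < of_int n" "real_of_int n < of_int 0" using assms by simp_all
  then show False by (simp only: of_int_less_iff)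
qed

lemma C_Ns_pos:
  assumes "0 < s" "s < 1" "0 < N"
  shows "0 < C_Ns N s"
proof -
  have "Gamma (- s) \<noteq> 0" using uminus_notin_nonpos_Ints[OF assms(1,2)] by (simp add: Gamma_eq_zero_iff)
  moreover have "0 < Gamma (real N / 2 + s)" using assms by (intro Gamma_real_pos) auto
  ultimately show ?thesis by (simp add: C_Ns_def)
qed

lemma H_s_measurable: "H_s s u \<Longrightarrow> u \<in> borel_measurable borel"
  by (simp add: H_s_def)

text \<open>The seminorm is given as an iterated integral, the inner product as an integral over the
  product space; Tonelli reconciles the two.\<close>

lemma gagliardo_eq_pair:
  fixes u :: "real^'n \<Rightarrow> real"
  assumes [measurable]: "u \<in> borel_measurable borel"
  shows "gagliardo s u = (\<integral>\<^sup>+p. ennreal ((u (fst p) - u (snd p))^2 * frac_kernel s (fst p - snd p)) \<partial>(lborel \<Otimes>\<^sub>M lborel))"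
  unfolding gagliardo_def frac_kernel_def
  by (subst lborel.nn_integral_fst[symmetric]) auto

lemma gagliardo_eq_kernel:
  "gagliardo s u = (\<integral>\<^sup>+x. \<integral>\<^sup>+y. ennreal ((u x - u y)^2 * frac_kernel s (x - y)) \<partial>lborel \<partial>lborel)"
  by (simp add: gagliardo_def frac_kernel_def)

lemma frac_inner_eq_kernel:
  fixes u v :: "real^'n \<Rightarrow> real"
  shows "frac_inner s u v = C_Ns CARD('n) s / 2 *
    (\<integral>p. (u (fst p) - u (snd p)) * (v (fst p) - v (snd p)) * frac_kernel s (fst p - snd p) \<partial>(lborel \<Otimes>\<^sub>M lborel))"
  by (simp add: frac_inner_def frac_kernel_def)

text \<open>Bochner integrals of non-integrable functions are 0 by default, so every algebraic rule
  for \<open>frac_inner\<close> rests on this. The estimate |ab| \<le> a^2 + b^2 replaces the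
  Cauchy-Schwarz inequality.\<close>

lemma integrable_frac_inner:
  fixes u v :: "real^'n \<Rightarrow> real"
  assumes u: "H_s s u" and v: "H_s s v"
  shows "integrable (lborel \<Otimes>\<^sub>M lborel) (\<lambda>p. (u (fst p) - u (snd p)) * (v (fst p) - v (snd p)) * frac_kernel s (fst p - snd p))"
proof (rule integrableI_bounded)
  note [measurable] = H_s_measurable[OF u] H_s_measurable[OF v]
  show "(\<lambda>p. (u (fst p) - u (snd p)) * (v (fst p) - v (snd p)) * frac_kernel s (fst p - snd p)) \<in> borel_measurable (lborel \<Otimes>\<^sub>M lborel)"
    by measurable
  have "(\<integral>\<^sup>+p. ennreal (norm ((u (fst p) - u (snd p)) * (v (fst p) - v (snd p)) * frac_kernel s (fst p - snd p))) \<partial>(lborel \<Otimes>\<^sub>M lborel))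
     \<le> (\<integral>\<^sup>+p. (ennreal ((u (fst p) - u (snd p))^2 * frac_kernel s (fst p - snd p)) +
        ennreal ((v (fst p) - v (snd p))^2 * frac_kernel s (fst p - snd p))) \<partial>(lborel \<Otimes>\<^sub>M lborel))"
  proof (intro nn_integral_mono)
    fix p :: "(real^'n) \<times> (real^'n)"
    define a b k where "a = u (fst p) - u (snd p)" and "b = v (fst p) - v (snd p)" and "k = frac_kernel s (fst p - snd p)"
    have "2 * \<bar>a * b\<bar> \<le> a^2 + b^2"
      using sum_squares_bound[of "\<bar>a\<bar>" "\<bar>b\<bar>"] by (simp add: abs_mult)
    then have "\<bar>a * b\<bar> \<le> a^2 + b^2"
      using abs_ge_zero[of "a * b"] by linarith
    then have "\<bar>a * b * k\<bar> \<le> a^2 * k + b^2 * k"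
      using mult_right_mono[of "\<bar>a * b\<bar>" "a^2+b^2" k] by (simp add: abs_mult k_def distrib_right)
    then show "ennreal (norm ((u (fst p) - u (snd p)) * (v (fst p) - v (snd p)) * frac_kernel s (fst p - snd p)))
      \<le> ennreal ((u (fst p) - u (snd p))^2 * frac_kernel s (fst p - snd p)) +
        ennreal ((v (fst p) - v (snd p))^2 * frac_kernel s (fst p - snd p))"
      by (simp add: a_def b_def k_def ennreal_leI flip: ennreal_plus)
  qed
  also have "\<dots> = gagliardo s u + gagliardo s v"
    by (simp add: nn_integral_add gagliardo_eq_pair)
  also have "\<dots> < \<infinity>" using u v by (simp add: H_s_def)
  finally show "(\<integral>\<^sup>+p. ennreal (norm ((u (fst p) - u (snd p)) * (v (fst p) - v (snd p)) * frac_kernel s (fst p - snd p))) \<partial>(lborel \<Otimes>\<^sub>M lborel)) < \<infinity>" .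
qed

lemma frac_inner_self:
  fixes u :: "real^'n \<Rightarrow> real"
  assumes u: "u \<in> borel_measurable borel"
  shows "frac_inner s u u = C_Ns CARD('n) s / 2 * enn2real (gagliardo s u)"
proof -
  note [measurable] = u
  have "(\<integral>p. (u (fst p) - u (snd p))^2 * frac_kernel s (fst p - snd p) \<partial>(lborel \<Otimes>\<^sub>M lborel)) = enn2real (gagliardo s u)"
    by (subst integral_eq_nn_integral) (auto simp: gagliardo_eq_pair)
  then show ?thesis by (simp add: frac_inner_eq_kernel power2_eq_square)
qed

lemma frac_inner_commute: "frac_inner s u v = frac_inner s v u"
  by (simp add: frac_inner_eq_kernel mult.commute mult.left_commute)

lemma frac_inner_add_right:
  assumes u: "H_s s u" and v: "H_s s v" and w: "H_s s w"
  shows "frac_inner s u (\<lambda>x. v x + w x) = frac_inner s u v + frac_inner s u w"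
proof -
  have "(\<lambda>p. (u (fst p) - u (snd p)) * (v (fst p) + w (fst p) - (v (snd p) + w (snd p))) * frac_kernel s (fst p - snd p))
    = (\<lambda>p. (u (fst p) - u (snd p)) * (v (fst p) - v (snd p)) * frac_kernel s (fst p - snd p) +
           (u (fst p) - u (snd p)) * (w (fst p) - w (snd p)) * frac_kernel s (fst p - snd p))"
    by (auto simp: algebra_simps)
  then show ?thesis
    unfolding frac_inner_eq_kernel
    using integrable_frac_inner[OF u v] integrable_frac_inner[OF u w] by (simp add: distrib_left)
qed

lemma frac_inner_scale_right: "frac_inner s u (\<lambda>x. c * v x) = c * frac_inner s u v"
proof -
  have "(\<lambda>p. (u (fst p) - u (snd p)) * (c * v (fst p) - c * v (snd p)) * frac_kernel s (fst p - snd p))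
    = (\<lambda>p. c * ((u (fst p) - u (snd p)) * (v (fst p) - v (snd p)) * frac_kernel s (fst p - snd p)))"
    by (auto simp: algebra_simps)
  then show ?thesis
    unfolding frac_inner_eq_kernel by simp
qed

lemma frac_inner_scale_left: "frac_inner s (\<lambda>x. c * u x) v = c * frac_inner s u v"
  by (metis frac_inner_commute frac_inner_scale_right)

lemma frac_inner_add_left:
  assumes "H_s s u" "H_s s v" "H_s s w"
  shows "frac_inner s (\<lambda>x. v x + w x) u = frac_inner s v u + frac_inner s w u"
  using frac_inner_add_right[OF assms] by (simp add: frac_inner_commute)

text \<open>Serves all normal contractions of \<open>u\<close> at once: truncation, absolute value,
  positive and negative part.\<close>

lemma H_s_contraction:
  assumes u: "H_s s u" and f: "f \<in> borel_measurable borel"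
    and "\<And>x. \<bar>f x\<bar> \<le> \<bar>u x\<bar>" and "\<And>x y. \<bar>f x - f y\<bar> \<le> \<bar>u x - u y\<bar>"
  shows "H_s s f" "gagliardo s f \<le> gagliardo s u"
proof -
  show *: "gagliardo s f \<le> gagliardo s u"
    unfolding gagliardo_eq_kernel
    by (intro nn_integral_mono ennreal_leI mult_right_mono) (auto simp: assms(4) abs_le_square_iff[symmetric])
  have "(\<integral>\<^sup>+ x. ennreal ((f x)^2) \<partial>lborel) \<le> (\<integral>\<^sup>+ x. ennreal ((u x)^2) \<partial>lborel)"
    by (intro nn_integral_mono ennreal_leI) (auto simp: assms(3) abs_le_square_iff[symmetric])
  then show "H_s s f" using * u f by (auto simp: H_s_def elim: le_less_trans)
qed

lemma X0_contraction:
  assumes u: "u \<in> X0 \<Omega> s" and f: "f \<in> borel_measurable borel"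
    and "\<And>x. \<bar>f x\<bar> \<le> \<bar>u x\<bar>" and "\<And>x y. \<bar>f x - f y\<bar> \<le> \<bar>u x - u y\<bar>"
  shows "f \<in> X0 \<Omega> s"
proof -
  have "H_s s f" using H_s_contraction[of s u f] assms by (auto simp: X0_def)
  moreover have "AE x in lborel. x \<notin> \<Omega> \<longrightarrow> u x = 0" using u by (simp add: X0_def)
  then have "AE x in lborel. x \<notin> \<Omega> \<longrightarrow> f x = 0"
    by eventually_elim (use assms(3) in \<open>metis abs_le_zero_iff abs_zero\<close>)
  ultimately show ?thesis by (simp add: X0_def)
qed

section \<open>Linear structure of the energy space\<close>

lemma gagliardo_add_le:
  fixes u v :: "real^'n \<Rightarrow> real"
  assumes [measurable]: "u \<in> borel_measurable borel" "v \<in> borel_measurable borel"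
  shows "gagliardo s (\<lambda>x. u x + v x) \<le> 2 * gagliardo s u + 2 * gagliardo s v"
proof -
  have "gagliardo s (\<lambda>x. u x + v x) \<le> (\<integral>\<^sup>+p. (2 * ennreal ((u (fst p) - u (snd p))^2 * frac_kernel s (fst p - snd p)) +
        2 * ennreal ((v (fst p) - v (snd p))^2 * frac_kernel s (fst p - snd p))) \<partial>(lborel \<Otimes>\<^sub>M lborel))"
    unfolding gagliardo_eq_pair[OF borel_measurable_add[OF assms]]
  proof (intro nn_integral_mono)
    fix p :: "(real^'n) \<times> (real^'n)"
    define a b k where "a = u (fst p) - u (snd p)" and "b = v (fst p) - v (snd p)" and "k = frac_kernel s (fst p - snd p)"
    have "(a + b)^2 \<le> 2 * a^2 + 2 * b^2"
      using sum_squares_bound[of a b] by (simp add: power2_sum)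
    then have "(a + b)^2 * k \<le> 2 * (a^2 * k) + 2 * (b^2 * k)"
      using mult_right_mono[of "(a + b)^2" "2 * a^2 + 2 * b^2" k] by (simp add: k_def distrib_right)
    moreover have "u (fst p) + v (fst p) - (u (snd p) + v (snd p)) = a + b" by (simp add: a_def b_def)
    ultimately have "ennreal ((u (fst p) + v (fst p) - (u (snd p) + v (snd p)))^2 * k) \<le> ennreal (2 * (a^2 * k) + 2 * (b^2 * k))"
      by (simp add: ennreal_leI del: ennreal_plus)
    also have "\<dots> = 2 * ennreal (a^2 * k) + 2 * ennreal (b^2 * k)"
      by (simp add: ennreal_plus ennreal_mult k_def)
    finally show "ennreal ((u (fst p) + v (fst p) - (u (snd p) + v (snd p)))^2 * frac_kernel s (fst p - snd p))
      \<le> 2 * ennreal ((u (fst p) - u (snd p))^2 * frac_kernel s (fst p - snd p)) +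
        2 * ennreal ((v (fst p) - v (snd p))^2 * frac_kernel s (fst p - snd p))"
      by (simp add: a_def b_def k_def)
  qed
  also have "\<dots> = 2 * gagliardo s u + 2 * gagliardo s v"
    by (simp add: nn_integral_add nn_integral_cmult gagliardo_eq_pair)
  finally show ?thesis .
qed

lemma gagliardo_scale:
  fixes u :: "real^'n \<Rightarrow> real"
  assumes [measurable]: "u \<in> borel_measurable borel"
  shows "gagliardo s (\<lambda>x. c * u x) = ennreal (c^2) * gagliardo s u"
proof -
  have "gagliardo s (\<lambda>x. c * u x) = (\<integral>\<^sup>+p. ennreal (c^2) * ennreal ((u (fst p) - u (snd p))^2 * frac_kernel s (fst p - snd p)) \<partial>(lborel \<Otimes>\<^sub>M lborel))"
    unfolding gagliardo_eq_pair[OF borel_measurable_times[OF borel_measurable_const assms]]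
    by (simp add: ennreal_mult[symmetric] right_diff_distrib[symmetric] power_mult_distrib mult.assoc)
  then show ?thesis by (simp add: nn_integral_cmult gagliardo_eq_pair)
qed

lemma H_s_scale:
  assumes u: "H_s s u"
  shows "H_s s (\<lambda>x. c * u x)"
proof -
  note [measurable] = H_s_measurable[OF u]
  have "(\<integral>\<^sup>+ x. ennreal ((c * u x)^2) \<partial>lborel) = ennreal (c^2) * (\<integral>\<^sup>+ x. ennreal ((u x)^2) \<partial>lborel)"
    by (simp add: power_mult_distrib ennreal_mult nn_integral_cmult)
  then show ?thesis using u
    by (simp add: H_s_def gagliardo_scale ennreal_mult_less_top)
qed

lemma H_s_add:
  assumes u: "H_s s u" and v: "H_s s v"
  shows "H_s s (\<lambda>x. u x + v x)"
proof -
  note [measurable] = H_s_measurable[OF u] H_s_measurable[OF v]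
  have "(\<integral>\<^sup>+ x. ennreal ((u x + v x)^2) \<partial>lborel) \<le> (\<integral>\<^sup>+ x. (2 * ennreal ((u x)^2) + 2 * ennreal ((v x)^2)) \<partial>lborel)"
  proof (intro nn_integral_mono)
    fix x
    have "(u x + v x)^2 \<le> 2 * (u x)^2 + 2 * (v x)^2"
      using sum_squares_bound[of "u x" "v x"] by (simp add: power2_sum)
    then have "ennreal ((u x + v x)^2) \<le> ennreal (2 * (u x)^2 + 2 * (v x)^2)" by (rule ennreal_leI)
    then show "ennreal ((u x + v x)^2) \<le> 2 * ennreal ((u x)^2) + 2 * ennreal ((v x)^2)"
      by (simp add: ennreal_plus ennreal_mult)
  qed
  also have "\<dots> < \<infinity>" using u v
    by (simp add: nn_integral_add nn_integral_cmult H_s_def ennreal_mult_less_top)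
  finally have 1: "(\<integral>\<^sup>+ x. ennreal ((u x + v x)^2) \<partial>lborel) < \<infinity>" .
  have "gagliardo s (\<lambda>x. u x + v x) \<le> 2 * gagliardo s u + 2 * gagliardo s v"
    by (rule gagliardo_add_le) auto
  also have "\<dots> < \<infinity>" using u v by (simp add: H_s_def ennreal_mult_less_top)
  finally show ?thesis using 1 by (simp add: H_s_def)
qed

lemma X0_H_s: "u \<in> X0 \<Omega> s \<Longrightarrow> H_s s u"
  by (simp add: X0_def)

lemma X0_scale:
  assumes "u \<in> X0 \<Omega> s"
  shows "(\<lambda>x. c * u x) \<in> X0 \<Omega> s"
proof -
  have "AE x in lborel. x \<notin> \<Omega> \<longrightarrow> u x = 0" using assms by (simp add: X0_def)
  then have "AE x in lborel. x \<notin> \<Omega> \<longrightarrow> c * u x = 0" by eventually_elim simp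
  then show ?thesis using H_s_scale[OF X0_H_s[OF assms]] by (simp add: X0_def)
qed

lemma X0_add:
  assumes "u \<in> X0 \<Omega> s" "v \<in> X0 \<Omega> s"
  shows "(\<lambda>x. u x + v x) \<in> X0 \<Omega> s"
proof -
  have "AE x in lborel. x \<notin> \<Omega> \<longrightarrow> u x = 0" "AE x in lborel. x \<notin> \<Omega> \<longrightarrow> v x = 0"
    using assms by (simp_all add: X0_def)
  then have "AE x in lborel. x \<notin> \<Omega> \<longrightarrow> u x + v x = 0" by eventually_elim simp
  then show ?thesis using H_s_add[OF X0_H_s[OF assms(1)] X0_H_s[OF assms(2)]] by (simp add: X0_def)
qed

text \<open>Valued in \<open>ennreal\<close>, so that two interactions can be compared before either
  is known to be finite.\<close>

definition cross_energy :: "real \<Rightarrow> (real^'n \<Rightarrow> real) \<Rightarrow> (real^'n \<Rightarrow> real) \<Rightarrow> ennreal" where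
  "cross_energy s f g = (\<integral>\<^sup>+x. \<integral>\<^sup>+y. ennreal (f x * g y * frac_kernel s (x - y)) \<partial>lborel \<partial>lborel)"

lemma cross_energy_eq_pair:
  fixes f g :: "real^'n \<Rightarrow> real"
  assumes [measurable]: "f \<in> borel_measurable borel" "g \<in> borel_measurable borel"
  shows "cross_energy s f g = (\<integral>\<^sup>+p. ennreal (f (fst p) * g (snd p) * frac_kernel s (fst p - snd p)) \<partial>(lborel \<Otimes>\<^sub>M lborel))"
  unfolding cross_energy_def
  by (subst lborel.nn_integral_fst[symmetric]) auto

lemma cross_energy_commute:
  fixes f g :: "real^'n \<Rightarrow> real"
  assumes [measurable]: "f \<in> borel_measurable borel" "g \<in> borel_measurable borel"
  shows "cross_energy s f g = cross_energy s g f"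
proof -
  have "cross_energy s g f = (\<integral>\<^sup>+x. \<integral>\<^sup>+y. ennreal (f y * g x * frac_kernel s (y - x)) \<partial>lborel \<partial>lborel)"
    by (simp add: cross_energy_def mult.commute frac_kernel_minus)
  also have "\<dots> = cross_energy s f g"
    unfolding cross_energy_def
    by (rule lborel_pair.Fubini'[symmetric]) (auto simp: split_beta')
  finally show ?thesis by simp
qed

text \<open>The symmetrised integrand is what the product of differences (f x - f y)(g x - g y)
  produces off the diagonal; the kernel is even, so the interaction is counted twice.\<close>

lemma has_integral_cross_energy:
  fixes f g :: "real^'n \<Rightarrow> real"
  assumes [measurable]: "f \<in> borel_measurable borel" "g \<in> borel_measurable borel"
    and "\<And>x. 0 \<le> f x" "\<And>x. 0 \<le> g x" and fin: "cross_energy s f g < \<infinity>"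
  shows "has_bochner_integral (lborel \<Otimes>\<^sub>M lborel)
      (\<lambda>p. (f (fst p) * g (snd p) + f (snd p) * g (fst p)) * frac_kernel s (fst p - snd p)) (2 * enn2real (cross_energy s f g))"
proof -
  have 1: "has_bochner_integral (lborel \<Otimes>\<^sub>M lborel) (\<lambda>p. f (fst p) * g (snd p) * frac_kernel s (fst p - snd p)) (enn2real (cross_energy s f g))"
    if [measurable]: "f \<in> borel_measurable borel" "g \<in> borel_measurable borel"
      and "\<And>x. 0 \<le> f x" "\<And>x. 0 \<le> g x" and fin: "cross_energy s f g < \<infinity>" for f g :: "real^'n \<Rightarrow> real"
    by (intro has_bochner_integral_nn_integral)
       (use that in \<open>auto simp: cross_energy_eq_pair[symmetric] less_top\<close>)
  have c: "cross_energy s g f = cross_energy s f g" by (rule cross_energy_commute) auto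
  have "has_bochner_integral (lborel \<Otimes>\<^sub>M lborel) (\<lambda>p. f (fst p) * g (snd p) * frac_kernel s (fst p - snd p) +
      g (fst p) * f (snd p) * frac_kernel s (fst p - snd p)) (enn2real (cross_energy s f g) + enn2real (cross_energy s f g))"
    using 1[of f g] 1[of g f] assms c by (intro has_bochner_integral_add) auto
  then show ?thesis by (simp add: algebra_simps)
qed

text \<open>Products taken at one and the same point vanish, and what remains is minus the
  symmetrised interaction. The factor 2 of the symmetrisation cancels the 1/2 in front of the
  form.\<close>

lemma frac_inner_disjoint:
  fixes f g :: "real^'n \<Rightarrow> real"
  assumes f: "H_s s f" and g: "H_s s g" and nn: "\<And>x. 0 \<le> f x" "\<And>x. 0 \<le> g x" and d: "\<And>x. f x * g x = 0"
  shows "cross_energy s f g < \<infinity>" "frac_inner s f g = - C_Ns CARD('n) s * enn2real (cross_energy s f g)"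
proof -
  note [measurable] = H_s_measurable[OF f] H_s_measurable[OF g]
  have id: "(f x - f y) * (g x - g y) * k = - ((f x * g y + f y * g x) * k)" for x y k
  proof -
    have "(f x - f y) * (g x - g y) = f x * g x + f y * g y - (f x * g y + f y * g x)"
      by (simp add: algebra_simps)
    then have "(f x - f y) * (g x - g y) = - (f x * g y + f y * g x)" by (simp add: d)
    then show ?thesis by (simp only: mult_minus_left)
  qed
  have "cross_energy s f g \<le> (\<integral>\<^sup>+p. ennreal (norm ((f (fst p) - f (snd p)) * (g (fst p) - g (snd p)) * frac_kernel s (fst p - snd p))) \<partial>(lborel \<Otimes>\<^sub>M lborel))"
    unfolding cross_energy_eq_pair[OF H_s_measurable[OF f] H_s_measurable[OF g]] id
  proof (intro nn_integral_mono ennreal_leI)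
    fix p :: "(real^'n) \<times> (real^'n)"
    have "0 \<le> f (fst p) * g (snd p) * frac_kernel s (fst p - snd p)" "0 \<le> f (snd p) * g (fst p) * frac_kernel s (fst p - snd p)"
      using nn by auto
    then show "f (fst p) * g (snd p) * frac_kernel s (fst p - snd p) \<le> norm (- ((f (fst p) * g (snd p) + f (snd p) * g (fst p)) * frac_kernel s (fst p - snd p)))"
      unfolding distrib_right real_norm_def by linarith
  qed
  also have "\<dots> < \<infinity>" using integrable_frac_inner[OF f g] unfolding integrable_iff_bounded by simp
  finally show fin: "cross_energy s f g < \<infinity>" .
  show "frac_inner s f g = - C_Ns CARD('n) s * enn2real (cross_energy s f g)"
    unfolding frac_inner_eq_kernel id
    using has_bochner_integral_integral_eq[OF has_integral_cross_energy[OF _ _ nn fin]] by simp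
qed

text \<open>The last hypothesis says that the piece \<open>f\<close> is attracted by \<open>h\<close> at least as much as it is
  repelled by \<open>g\<close>. Finiteness of the energy of \<open>f\<close> is not automatic, as \<open>f\<close> need not vanish
  continuously.\<close>

lemma frac_inner_piece:
  fixes f g h :: "real^'n \<Rightarrow> real"
  assumes s: "0 < s" "s < 1" and u: "H_s s u" and ueq: "\<And>x. u x = f x + g x - h x"
    and [measurable]: "f \<in> borel_measurable borel" "g \<in> borel_measurable borel" "h \<in> borel_measurable borel"
    and nn: "\<And>x. 0 \<le> f x" "\<And>x. 0 \<le> g x" "\<And>x. 0 \<le> h x"
    and d: "\<And>x. f x * g x = 0" "\<And>x. f x * h x = 0" "\<And>x. g x * h x = 0"
    and le: "cross_energy s f g \<le> cross_energy s f h"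
  shows "H_s s f" "frac_inner s f f \<le> frac_inner s u f"
proof -
  note [measurable] = H_s_measurable[OF u]
  let ?k = "\<lambda>p::(real^'n)\<times>(real^'n). frac_kernel s (fst p - snd p)"
  \<comment> \<open>If \<open>f\<close> lives at x and \<open>h\<close> at y, then u x - u y = f x +
    h y. Parts of opposite sign therefore interact with finite energy. For \<open>g\<close> there is
    no such bound; finiteness reaches it only through \<open>le\<close>.\<close>
  have "cross_energy s f h \<le> gagliardo s u"
    unfolding cross_energy_eq_pair[OF assms(5,7)] gagliardo_eq_pair[OF H_s_measurable[OF u]]
  proof (intro nn_integral_mono ennreal_leI mult_right_mono)
    fix p :: "(real^'n)\<times>(real^'n)"
    obtain x y where p: "p = (x, y)" by (cases p)
    show "f (fst p) * h (snd p) \<le> (u (fst p) - u (snd p))^2"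
    proof (cases "f x = 0 \<or> h y = 0")
      case False
      then have "u x = f x" "u y = - h y" using d[of x] d[of y] ueq by auto
      moreover have "f x * h y \<le> (f x + h y)^2" 
        using nn[of x] nn[of y] by (simp add: power2_sum)
      ultimately show ?thesis by (simp add: p)
    qed (auto simp: p)
  qed auto
  then have fin_h: "cross_energy s f h < \<infinity>" using u by (auto simp: H_s_def elim: le_less_trans)
  then have fin_g: "cross_energy s f g < \<infinity>" using le by (auto elim: le_less_trans)
  note ig = has_integral_cross_energy[OF assms(5,6) nn(1,2) fin_g]
  note ih = has_integral_cross_energy[OF assms(5,7) nn(1,3) fin_h]
  have "gagliardo s f \<le> (\<integral>\<^sup>+p. (ennreal ((u (fst p) - u (snd p))^2 * ?k p) + 2 * ennreal ((f (fst p) * g (snd p) + f (snd p) * g (fst p)) * ?k p)) \<partial>(lborel \<Otimes>\<^sub>M lborel))"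
    unfolding gagliardo_eq_pair[OF assms(5)]
  proof (intro nn_integral_mono)
    fix p :: "(real^'n)\<times>(real^'n)"
    obtain x y where p: "p = (x, y)" by (cases p)
    have "(f x - f y)^2 \<le> (u x - u y)^2 + 2 * (f x * g y + f y * g x)"
    proof -
      have 1: "f x = 0 \<or> (g x = 0 \<and> h x = 0)" "f y = 0 \<or> (g y = 0 \<and> h y = 0)"
        using d[of x] d[of y] by auto
      \<comment> \<open>One point lies in the support of \<open>f\<close>, with value
        \<open>a\<close>, the other outside. Expanding the square shows that 2 a g makes up for what
        neighbours of the same sign take away from the energy of \<open>u\<close>.\<close>
      have sq: "a^2 \<le> (a - (g z - h z))^2 + 2 * (a * g z)" if "a \<ge> 0" for a z
      proof -
        have "(a - (g z - h z))^2 + 2 * (a * g z) = a^2 + 2 * (a * h z) + (g z - h z)^2"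
          by (simp add: power2_eq_square algebra_simps)
        then show ?thesis using that nn[of z] by simp
      qed
      show ?thesis
      proof (cases "f x = 0")
        case True
        have "(- f y)^2 \<le> (u x - u y)^2 + 2 * (f y * g x)"
        proof (cases "f y = 0")
          case False
          then have "u y = f y" "u x = g x - h x" using 1 True ueq by auto
          then show ?thesis using sq[of "f y" x] nn(1)[of y] by (simp add: power2_commute)
        qed auto
        then show ?thesis using True by simp
      next
        case False
        then have ux: "u x = f x" "g x = 0" using 1 ueq by auto
        show ?thesis
        proof (cases "f y = 0")
          case True
          then have "u y = g y - h y" using ueq by auto
          then show ?thesis using sq[of "f x" y] nn(1)[of x] ux True by simp
        next
          case False
          then have "u y = f y" "g y = 0" using 1 ueq by auto
          then show ?thesis using ux by simp
        qed
      qed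
    qed
    then have "(f x - f y)^2 * frac_kernel s (x - y) \<le> (u x - u y)^2 * frac_kernel s (x - y) + 2 * ((f x * g y + f y * g x) * frac_kernel s (x - y))"
      using mult_right_mono[of "(f x - f y)^2" "(u x - u y)^2 + 2 * (f x * g y + f y * g x)" "frac_kernel s (x - y)"]
      by (simp add: distrib_right mult.assoc)
    then have "ennreal ((f x - f y)^2 * frac_kernel s (x - y)) \<le> ennreal ((u x - u y)^2 * frac_kernel s (x - y) + 2 * ((f x * g y + f y * g x) * frac_kernel s (x - y)))"
      by (rule ennreal_leI)
    also have "\<dots> = ennreal ((u x - u y)^2 * frac_kernel s (x - y)) + 2 * ennreal ((f x * g y + f y * g x) * frac_kernel s (x - y))"
      using nn by (subst ennreal_plus) (auto simp: ennreal_mult)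
    finally show "ennreal ((f (fst p) - f (snd p))^2 * ?k p) \<le> ennreal ((u (fst p) - u (snd p))^2 * ?k p) + 2 * ennreal ((f (fst p) * g (snd p) + f (snd p) * g (fst p)) * ?k p)"
      by (simp add: p)
  qed
  also have "\<dots> = gagliardo s u + 2 * (\<integral>\<^sup>+p. ennreal ((f (fst p) * g (snd p) + f (snd p) * g (fst p)) * ?k p) \<partial>(lborel \<Otimes>\<^sub>M lborel))"
    by (simp add: nn_integral_add nn_integral_cmult gagliardo_eq_pair)
  also have "\<dots> < \<infinity>"
  proof -
    have "(\<integral>\<^sup>+p. ennreal (norm ((f (fst p) * g (snd p) + f (snd p) * g (fst p)) * ?k p)) \<partial>(lborel \<Otimes>\<^sub>M lborel)) < \<infinity>"
      using ig by (simp add: has_bochner_integral_iff integrable_iff_bounded)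
    moreover have "norm ((f (fst p) * g (snd p) + f (snd p) * g (fst p)) * ?k p) = (f (fst p) * g (snd p) + f (snd p) * g (fst p)) * ?k p" for p
      using nn by (simp add: abs_of_nonneg)
    ultimately show ?thesis using u by (simp add: H_s_def ennreal_mult_less_top)
  qed
  finally have gf: "gagliardo s f < \<infinity>" .
  have "(f x)^2 \<le> (u x)^2" for x
    using d[of x] ueq[of x] by (cases "f x = 0") auto
  then have "(\<integral>\<^sup>+ x. ennreal ((f x)^2) \<partial>lborel) \<le> (\<integral>\<^sup>+ x. ennreal ((u x)^2) \<partial>lborel)"
    by (intro nn_integral_mono ennreal_leI) auto
  then show f: "H_s s f" using gf u by (auto simp: H_s_def elim: le_less_trans)
  \<comment> \<open>The mixed form exceeds the form of \<open>f\<close> by the attraction towards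
    \<open>h\<close> minus the repulsion from \<open>g\<close>; integrated, this is the sign
    condition \<open>le\<close>.\<close>
  have id: "(u x - u y) * (f x - f y) * k - (f x - f y) * (f x - f y) * k
      = (f x * h y + f y * h x) * k - (f x * g y + f y * g x) * k" for x y k
  proof -
    have "(u x - u y) * (f x - f y) - (f x - f y) * (f x - f y) = (f x * g x - f x * h x) + (f y * g y - f y * h y) +
      (f x * h y + f y * h x) - (f x * g y + f y * g x)"
      unfolding ueq by (simp add: algebra_simps)
    then have "(u x - u y) * (f x - f y) - (f x - f y) * (f x - f y) = (f x * h y + f y * h x) - (f x * g y + f y * g x)"
      by (simp add: d)
    then show ?thesis by (metis left_diff_distrib)
  qed
  have "(\<integral>p. (u (fst p) - u (snd p)) * (f (fst p) - f (snd p)) * ?k p \<partial>(lborel \<Otimes>\<^sub>M lborel))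
     - (\<integral>p. (f (fst p) - f (snd p)) * (f (fst p) - f (snd p)) * ?k p \<partial>(lborel \<Otimes>\<^sub>M lborel))
     = (\<integral>p. (f (fst p) * h (snd p) + f (snd p) * h (fst p)) * ?k p \<partial>(lborel \<Otimes>\<^sub>M lborel))
      - (\<integral>p. (f (fst p) * g (snd p) + f (snd p) * g (fst p)) * ?k p \<partial>(lborel \<Otimes>\<^sub>M lborel))"
    unfolding Bochner_Integration.integral_diff[OF integrable_frac_inner[OF u f] integrable_frac_inner[OF f f], symmetric] id
    using ig ih by (intro Bochner_Integration.integral_diff) (auto simp: has_bochner_integral_iff)
  also have "\<dots> = 2 * enn2real (cross_energy s f h) - 2 * enn2real (cross_energy s f g)"
    using ig ih by (simp add: has_bochner_integral_iff)
  also have "\<dots> \<ge> 0" using le fin_h by (simp add: enn2real_mono)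
  finally show "frac_inner s f f \<le> frac_inner s u f"
    unfolding frac_inner_eq_kernel using C_Ns_pos[OF s, of "CARD('n)"] by (intro mult_left_mono) auto
qed

section \<open>Fractional Sobolev inequality\<close>

lemma emeasure_ball_unit:
  fixes x :: "'a::euclidean_space"
  assumes "0 \<le> r"
  shows "emeasure lborel (ball x r) = ennreal (measure lborel (ball (0::'a) 1) * r ^ DIM('a))"
proof -
  have "emeasure lborel (ball x r) = ennreal (measure lborel (ball x r))"
    using emeasure_bounded_finite[OF bounded_ball, of x r] by (intro emeasure_eq_ennreal_measure) auto
  then show ?thesis using content_ball_conv_unit_ball[OF assms, of x] by (simp add: mult.commute)
qed

lemma unit_ball_pos: "0 < measure lborel (ball (0::'a::euclidean_space) 1)"
  using content_ball_pos[of 1 "0::'a"] by simp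

text \<open>The value that the ball argument of \<open>sobolev_pointwise\<close> happens to produce;
  the type argument carries the dimension. It is not sharp: it only serves to show that
  \<open>best_constant\<close> is positive and that critical powers are integrable.\<close>

definition sobolev_const :: "'n::finite itself \<Rightarrow> real \<Rightarrow> real" where
  "sobolev_const _ s = 8 / measure lborel (ball (0::real^('n::finite)) 1) *
     (2 powr (crit_exp CARD('n) s + 1) / measure lborel (ball (0::real^'n) 1)) powr (2 * s / real CARD('n))"

lemma sobolev_const_pos: "0 < sobolev_const TYPE('n::finite) s"
  using unit_ball_pos[where 'a = "real^'n"] by (simp add: sobolev_const_def)

lemma crit_exp_props:
  assumes "0 < s" "2 * s < real N"
  shows "2 < crit_exp N s" "crit_exp N s = 2 + 2 * s * crit_exp N s / real N" "1 - 2 * s / real N = 2 / crit_exp N s"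
  using assms by (auto simp: crit_exp_def field_simps)

text \<open>By Chebyshev's inequality, \<open>\<bar>u\<bar>\<close> exceeds half of \<open>\<bar>u x\<bar>\<close> on at most half of a suitable ball
  around \<open>x\<close>; the rest of the ball bounds the Gagliardo density at \<open>x\<close> from below.\<close>

lemma sobolev_pointwise:
  fixes u :: "real^'n \<Rightarrow> real" and s :: real
  defines "p \<equiv> crit_exp CARD('n) s"
  assumes s: "0 < s" "2 * s < real CARD('n)" and [measurable]: "u \<in> borel_measurable borel"
    and Y: "0 < Y" "(\<integral>\<^sup>+y. ennreal (\<bar>u y\<bar> powr p) \<partial>lborel) = ennreal Y"
  shows "ennreal (\<bar>u x\<bar> powr p) \<le> ennreal (sobolev_const TYPE('n) s * Y powr (2 * s / real CARD('n))) *
     (\<integral>\<^sup>+y. ennreal ((u x - u y)^2 * frac_kernel s (x - y)) \<partial>lborel)"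
proof (cases "u x = 0")
  case False
  define N where "N = CARD('n)"
  have N: "0 < N" by (simp add: N_def)
  define t where "t = \<bar>u x\<bar>"
  have t: "0 < t" using False by (simp add: t_def)
  define w where "w = measure lborel (ball (0::real^'n) 1)"
  have w: "0 < w" unfolding w_def by (rule unit_ball_pos)
  \<comment> \<open>Chosen such that the ball of radius \<open>r\<close> has twice the measure that
    Chebyshev's inequality allows for the set where |u| exceeds t/2.\<close>
  define v where "v = 2 * Y * (2 / t) powr p / w"
  have v: "0 < v" using Y t w by (simp add: v_def)
  define r where "r = v powr (1 / real N)"
  have r: "0 < r" using v by (simp add: r_def)
  have rN: "w * r ^ N = 2 * Y * (2 / t) powr p"
  proof -
    have "r ^ N = v" using v N by (simp add: r_def powr_powr flip: powr_realpow)
    then show ?thesis using w by (simp add: v_def)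
  qed
  define A where "A = {y. t / 2 < \<bar>u y\<bar>}"
  have [measurable]: "A \<in> sets borel" unfolding A_def by measurable
  have "ennreal ((t / 2) powr p) * emeasure lborel A = (\<integral>\<^sup>+y. ennreal ((t / 2) powr p) * indicator A y \<partial>lborel)"
    by (simp add: nn_integral_cmult_indicator)
  also have "\<dots> \<le> (\<integral>\<^sup>+y. ennreal (\<bar>u y\<bar> powr p) \<partial>lborel)"
    using t crit_exp_props[OF s]
    by (intro nn_integral_mono) (auto simp: A_def p_def split: split_indicator intro!: ennreal_leI powr_mono2)
  finally have "ennreal ((2 / t) powr p) * (ennreal ((t / 2) powr p) * emeasure lborel A) \<le> ennreal ((2 / t) powr p) * ennreal Y"
    unfolding Y by (intro mult_left_mono) auto
  moreover have "ennreal ((2 / t) powr p) * ennreal ((t / 2) powr p) = 1"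
    using t by (simp add: ennreal_mult[symmetric] powr_mult[symmetric])
  ultimately have "emeasure lborel A \<le> ennreal ((2 / t) powr p) * ennreal Y"
    by (simp add: mult.assoc[symmetric])
  also have "\<dots> = ennreal (w * r ^ N / 2)"
    using Y by (simp add: rN ennreal_mult[symmetric] mult.commute)
  finally have A: "emeasure lborel A \<le> ennreal (w * r ^ N / 2)" .
  have "ennreal (w * r ^ N) = emeasure lborel (ball x r)"
    using r by (simp add: emeasure_ball_unit w_def N_def)
  also have "\<dots> \<le> emeasure lborel ((ball x r - A) \<union> A)"
    by (intro emeasure_mono) auto
  also have "\<dots> \<le> emeasure lborel (ball x r - A) + emeasure lborel A"
    by (intro emeasure_subadditive) auto
  also have "\<dots> \<le> emeasure lborel (ball x r - A) + ennreal (w * r ^ N / 2)"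
    using A by (intro add_mono) auto
  finally have "ennreal (w * r ^ N) - ennreal (w * r ^ N / 2) \<le> emeasure lborel (ball x r - A)"
    by (simp add: ennreal_minus_le_iff add.commute)
  moreover have "ennreal (w * r ^ N) - ennreal (w * r ^ N / 2) = ennreal (w * r ^ N / 2)"
    using w r by (subst ennreal_minus) auto
  ultimately have BA: "ennreal (w * r ^ N / 2) \<le> emeasure lborel (ball x r - A)" by simp
  let ?G = "\<integral>\<^sup>+y. ennreal ((u x - u y)^2 * frac_kernel s (x - y)) \<partial>lborel"
  define c where "c = (t / 2)^2 * (1 / r powr (real N + 2 * s))"
  have c: "0 < c" using t r by (simp add: c_def)
  have "ennreal c * ennreal (w * r ^ N / 2) \<le> ennreal c * emeasure lborel (ball x r - A)"
    using BA by (intro mult_left_mono) auto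
  also have "\<dots> = (\<integral>\<^sup>+y. ennreal c * indicator (ball x r - A) y \<partial>lborel)"
    by (simp add: nn_integral_cmult_indicator)
  also have "\<dots> \<le> ?G"
  proof (intro nn_integral_mono)
    fix y
    show "ennreal c * indicator (ball x r - A) y \<le> ennreal ((u x - u y)^2 * frac_kernel s (x - y))"
    proof (cases "y \<in> ball x r - A")
      case True
      then have y: "\<bar>u y\<bar> \<le> t / 2" "norm (x - y) < r" by (auto simp: A_def dist_norm)
      \<comment> \<open>Since x itself lies in \<open>A\<close>, the point y differs from x. On the
        diagonal the kernel has the default value 0 and the lower bound would fail.\<close>
      have "x \<in> A" using t by (simp add: A_def t_def)
      with True have "0 < norm (x - y)" by auto
      then have "1 / r powr (real N + 2 * s) \<le> frac_kernel s (x - y)"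
        unfolding frac_kernel_def N_def using y r s by (intro divide_left_mono powr_mono2 mult_pos_pos) auto
      moreover have "(t / 2)^2 \<le> (u x - u y)^2"
        using y t unfolding t_def by (intro abs_le_square_iff[THEN iffD1]) (auto simp: abs_if split: if_splits)
      ultimately have "c \<le> (u x - u y)^2 * frac_kernel s (x - y)"
        unfolding c_def by (intro mult_mono) auto
      then show ?thesis using True by (simp add: ennreal_leI)
    qed auto
  qed
  finally have G0: "ennreal c * ennreal (w * r ^ N / 2) \<le> ?G" .
  have "ennreal (c * (w * r ^ N / 2)) = ennreal c * ennreal (w * r ^ N / 2)"
    using c w r by (intro ennreal_mult) auto
  with G0 have G: "ennreal (c * (w * r ^ N / 2)) \<le> ?G" by (simp only:)
  define K where "K = sobolev_const TYPE('n) s * Y powr (2 * s / real N)"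
  have K: "0 < K" using sobolev_const_pos[where 'n = 'n] Y by (simp add: K_def)
  \<comment> \<open>Bookkeeping of powers: r^(2s) is proportional to Y^(2s/N) t^(2-p), because p *
    2s/N = p - 2. Hence t^2 / r^(2s) is a multiple of t^p / Y^(2s/N).\<close>
  have "t powr p = K * (c * (w * r ^ N / 2))"
  proof -
    have c': "c * (w * r ^ N / 2) = t^2 * w / 8 * (1 / r powr (2 * s))"
    proof -
      have "r powr (real N + 2 * s) = r ^ N * r powr (2 * s)" using r by (simp add: powr_add powr_realpow)
      then show ?thesis using r by (simp add: c_def power2_eq_square)
    qed
    have r2s: "r powr (2 * s) = v powr (2 * s / real N)"
      by (simp add: r_def powr_powr)
    have "v = (2 powr (p + 1) / w) * Y * t powr - p"
      using t by (simp add: v_def powr_divide powr_add powr_minus field_simps)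
    then have "v powr (2 * s / real N) = (2 powr (p + 1) / w) powr (2 * s / real N) * Y powr (2 * s / real N) * (t powr - p) powr (2 * s / real N)"
      using t w Y by (simp add: powr_mult powr_divide)
    also have "(t powr - p) powr (2 * s / real N) = t powr (2 - p)"
    proof -
      have "- p * (2 * s / real N) = 2 - p"
      proof -
        have "- p * (2 * s / real N) = - (2 * s * p / real N)" by simp
        moreover have "p = 2 + 2 * s * p / real N" using crit_exp_props(2)[OF s] by (simp only: p_def N_def)
        ultimately show ?thesis by linarith
      qed
      then show ?thesis by (simp only: powr_powr)
    qed
    finally have v': "v powr (2 * s / real N) = (2 powr (p + 1) / w) powr (2 * s / real N) * Y powr (2 * s / real N) * t powr (2 - p)" .
    define D where "D = (2 powr (p + 1) / w) powr (2 * s / real N) * Y powr (2 * s / real N)"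
    have "K = 8 / w * D"
      by (simp add: K_def sobolev_const_def w_def N_def p_def D_def)
    then have "K * (t^2 * w / 8) = D * t^2" using w by simp
    also have "\<dots> = D * (t powr (2 - p) * t powr (p - 2)) * t powr 2"
      using t by (simp flip: powr_add)
    also have "\<dots> = v powr (2 * s / real N) * (t powr (p - 2) * t powr 2)"
      unfolding v' D_def by (simp only: mult.assoc)
    also have "t powr (p - 2) * t powr 2 = t powr p"
      by (simp flip: powr_add)
    finally have "K * (t^2 * w / 8) = v powr (2 * s / real N) * t powr p" .
    moreover have "0 < v powr (2 * s / real N)" using v by simp
    ultimately show ?thesis unfolding c' r2s by (simp add: mult.assoc[symmetric])
  qed
  then have "ennreal (t powr p) = ennreal K * ennreal (c * (w * r ^ N / 2))"
    unfolding \<open>t powr p = K * (c * (w * r ^ N / 2))\<close> using K c w r by (intro ennreal_mult) auto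
  also have "\<dots> \<le> ennreal K * ?G" using G by (intro mult_left_mono) auto
  finally show ?thesis by (simp add: t_def K_def N_def)
qed auto

lemma powr_le_cancel_self:
  fixes Y a c :: real
  assumes "0 < Y" "Y \<le> c * Y powr a"
  shows "Y powr (1 - a) \<le> c"
  using assms by (simp add: powr_diff field_simps)

text \<open>Integrating the pointwise bound gives Y \<le> K Y^(2s/N) times the seminorm, where Y is
  the integral of |u|^p. Division by Y^(2s/N) requires Y to be finite beforehand, and this is what
  boundedness of \<open>u\<close> provides.\<close>

lemma sobolev_bounded:
  fixes u :: "real^'n \<Rightarrow> real" and s :: real
  defines "p \<equiv> crit_exp CARD('n) s"
  assumes s: "0 < s" "2 * s < real CARD('n)" and u: "H_s s u" and M: "\<And>x. \<bar>u x\<bar> \<le> M"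
  shows "(\<integral>\<^sup>+y. ennreal (\<bar>u y\<bar> powr p) \<partial>lborel) \<le> ennreal ((sobolev_const TYPE('n) s * enn2real (gagliardo s u)) powr (p / 2))"
proof -
  note [measurable] = H_s_measurable[OF u]
  note p = crit_exp_props[OF s, folded p_def]
  let ?Y = "\<integral>\<^sup>+y. ennreal (\<bar>u y\<bar> powr p) \<partial>lborel"
  have "?Y \<le> (\<integral>\<^sup>+y. ennreal (M powr (p - 2)) * ennreal ((u y)^2) \<partial>lborel)"
  proof (intro nn_integral_mono)
    fix y
    have "\<bar>u y\<bar> powr p = \<bar>u y\<bar> powr (p - 2) * (u y)^2"
    proof -
      have "\<bar>u y\<bar> powr (p - 2 + 2) = \<bar>u y\<bar> powr (p - 2) * \<bar>u y\<bar> powr 2" by (rule powr_add)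
      moreover have "\<bar>u y\<bar> powr 2 = (u y)^2" by simp
      ultimately show ?thesis by (simp only: diff_add_cancel)
    qed
    also have "\<dots> \<le> M powr (p - 2) * (u y)^2"
      using M[of y] p by (intro mult_right_mono powr_mono2) auto
    finally show "ennreal (\<bar>u y\<bar> powr p) \<le> ennreal (M powr (p - 2)) * ennreal ((u y)^2)"
      by (simp add: ennreal_leI flip: ennreal_mult)
  qed
  also have "\<dots> < \<infinity>" using u by (simp add: nn_integral_cmult H_s_def ennreal_mult_less_top)
  finally have fin: "?Y < \<infinity>" .
  define Y where "Y = enn2real ?Y"
  have Y: "?Y = ennreal Y" using fin by (simp add: Y_def less_top)
  define g where "g = enn2real (gagliardo s u)"
  have g: "gagliardo s u = ennreal g" using u by (simp add: g_def H_s_def less_top)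
  have g0: "0 \<le> g" by (simp add: g_def)
  have Y0: "0 \<le> Y" by (simp add: Y_def)
  have "Y \<le> (sobolev_const TYPE('n) s * g) powr (p / 2)"
  proof (cases "Y = 0")
    case False
    with Y0 have Y1: "0 < Y" by simp
    let ?K = "sobolev_const TYPE('n) s * Y powr (2 * s / real CARD('n))"
    have K: "0 < ?K" using sobolev_const_pos[where 'n='n] Y1 by simp
    have "?Y \<le> (\<integral>\<^sup>+x. ennreal ?K * (\<integral>\<^sup>+y. ennreal ((u x - u y)^2 * frac_kernel s (x - y)) \<partial>lborel) \<partial>lborel)"
      using sobolev_pointwise[OF s _ Y1 Y[unfolded p_def]] unfolding p_def by (intro nn_integral_mono) auto
    also have "\<dots> = ennreal ?K * gagliardo s u"
      unfolding gagliardo_eq_kernel by (intro nn_integral_cmult) auto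
    finally have "ennreal Y \<le> ennreal (?K * g)"
      unfolding Y g ennreal_mult[OF less_imp_le[OF K] g0] .
    then have "Y \<le> (sobolev_const TYPE('n) s * g) * Y powr (2 * s / real CARD('n))"
      using K g0 by (simp add: ennreal_le_iff mult_ac less_imp_le)
    then have "Y powr (2 / p) \<le> sobolev_const TYPE('n) s * g"
      using powr_le_cancel_self[OF Y1] by (simp add: p(3)[symmetric])
    then have "(Y powr (2 / p)) powr (p / 2) \<le> (sobolev_const TYPE('n) s * g) powr (p / 2)"
      using p by (intro powr_mono2) auto
    then show ?thesis using p Y1 by (simp add: powr_powr)
  qed simp
  then show ?thesis by (simp add: Y g_def[symmetric] ennreal_leI)
qed

text \<open>Boundedness is removed by truncating at height n: truncation does not increase the
  seminorm, and Fatou's lemma passes to the limit.\<close>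

lemma sobolev:
  fixes u :: "real^'n \<Rightarrow> real" and s :: real
  defines "p \<equiv> crit_exp CARD('n) s"
  assumes s: "0 < s" "s < 1" "2 * s < real CARD('n)" and u: "H_s s u"
  shows "integrable lborel (\<lambda>x. \<bar>u x\<bar> powr p)"
    and "C_Ns CARD('n) s / (2 * sobolev_const TYPE('n) s) * Lp_pow p u powr (2 / p) \<le> frac_inner s u u"
proof -
  note [measurable] = H_s_measurable[OF u]
  note p = crit_exp_props[OF s(1,3), folded p_def]
  define g where "g = enn2real (gagliardo s u)"
  let ?B = "(sobolev_const TYPE('n) s * g) powr (p / 2)"
  define v where "v n x = max (- real n) (min (u x) (real n))" for n x
  have vb: "v n \<in> borel_measurable borel" for n unfolding v_def by measurable
  have v: "H_s s (v n)" "gagliardo s (v n) \<le> gagliardo s u" for n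
    using H_s_contraction[OF u vb[of n]] by (auto simp: v_def)
  have vM: "\<bar>v n x\<bar> \<le> real n" for n x by (auto simp: v_def)
  have vlim: "(\<lambda>n. \<bar>v n x\<bar> powr p) \<longlonglongrightarrow> \<bar>u x\<bar> powr p" for x
  proof (rule tendsto_eventually)
    obtain n0 where "\<bar>u x\<bar> \<le> real n0" using real_arch_simple by blast
    then have "v n x = u x" if "n \<ge> n0" for n
      using that of_nat_mono[OF that, where 'a=real] unfolding v_def by linarith
    then show "\<forall>\<^sub>F n in sequentially. \<bar>v n x\<bar> powr p = \<bar>u x\<bar> powr p"
      unfolding eventually_sequentially by (intro exI[of _ n0]) simp
  qed
  have "(\<integral>\<^sup>+x. ennreal (\<bar>u x\<bar> powr p) \<partial>lborel) = (\<integral>\<^sup>+x. liminf (\<lambda>n. ennreal (\<bar>v n x\<bar> powr p)) \<partial>lborel)"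
    using vlim by (intro nn_integral_cong) (auto intro!: lim_imp_Liminf[symmetric] tendsto_ennrealI sequentially_bot)
  also have "\<dots> \<le> liminf (\<lambda>n. \<integral>\<^sup>+x. ennreal (\<bar>v n x\<bar> powr p) \<partial>lborel)"
    using H_s_measurable[OF v(1)] by (intro nn_integral_liminf) measurable
  also have "\<dots> \<le> ennreal ?B"
  proof (intro Liminf_le always_eventually allI sequentially_bot)
    fix n
    have "enn2real (gagliardo s (v n)) \<le> g"
      unfolding g_def using v[of n] u by (intro enn2real_mono) (auto simp: H_s_def)
    then have "(sobolev_const TYPE('n) s * enn2real (gagliardo s (v n))) powr (p / 2) \<le> ?B"
      using sobolev_const_pos[where 'n='n and s = s] p(1) by (intro powr_mono2 mult_left_mono) (auto intro!: mult_nonneg_nonneg)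
    then show "(\<integral>\<^sup>+x. ennreal (\<bar>v n x\<bar> powr p) \<partial>lborel) \<le> ennreal ?B"
      using sobolev_bounded[OF s(1,3) v(1) vM, folded p_def] by (meson ennreal_leI order_trans)
  qed
  finally have le: "(\<integral>\<^sup>+x. ennreal (\<bar>u x\<bar> powr p) \<partial>lborel) \<le> ennreal ?B" .
  also have "\<dots> < \<infinity>" by simp
  finally show "integrable lborel (\<lambda>x. \<bar>u x\<bar> powr p)"
    by (intro integrableI_bounded) auto
  have "Lp_pow p u = enn2real (\<integral>\<^sup>+x. ennreal (\<bar>u x\<bar> powr p) \<partial>lborel)"
    unfolding Lp_pow_def by (intro integral_eq_nn_integral) auto
  also have "\<dots> \<le> ?B" using le by (intro enn2real_leI) auto
  finally have "Lp_pow p u powr (2 / p) \<le> ?B powr (2 / p)"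
    using p by (intro powr_mono2) (auto simp: Lp_pow_def)
  also have "\<dots> = sobolev_const TYPE('n) s * g"
    using p sobolev_const_pos[where 'n='n and s = s] by (auto simp: powr_powr g_def abs_mult)
  finally have "C_Ns CARD('n) s / (2 * sobolev_const TYPE('n) s) * Lp_pow p u powr (2 / p)
     \<le> C_Ns CARD('n) s / (2 * sobolev_const TYPE('n) s) * (sobolev_const TYPE('n) s * g)"
    using C_Ns_pos[OF s(1,2), of "CARD('n)"] sobolev_const_pos[where 'n='n] by (intro mult_left_mono) (auto simp: less_imp_le)
  also have "\<dots> = frac_inner s u u"
    using sobolev_const_pos[where 'n='n, of s] by (simp add: frac_inner_self g_def)
  finally show "C_Ns CARD('n) s / (2 * sobolev_const TYPE('n) s) * Lp_pow p u powr (2 / p) \<le> frac_inner s u u" .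
qed

section \<open>Fractional Poincare inequality\<close>

text \<open>In the variable h = y - x the seminorm is a weighted integral of the L^2 modulus of
  continuity, the quantity that behaves well under halving of the shift.\<close>

lemma gagliardo_eq_shift:
  fixes u :: "real^'n \<Rightarrow> real"
  assumes [measurable]: "u \<in> borel_measurable borel"
  shows "gagliardo s u = (\<integral>\<^sup>+h. (\<integral>\<^sup>+x. ennreal ((u (x + h) - u x)^2) \<partial>lborel) * ennreal (frac_kernel s h) \<partial>lborel)"
proof -
  have "gagliardo s u = (\<integral>\<^sup>+x. \<integral>\<^sup>+y. ennreal ((u y - u x)^2 * frac_kernel s (y - x)) \<partial>lborel \<partial>lborel)"
    by (simp add: gagliardo_eq_kernel frac_kernel_minus power2_commute)
  also have "\<dots> = (\<integral>\<^sup>+x. \<integral>\<^sup>+h. ennreal ((u (h + x) - u x)^2 * frac_kernel s (h + x - x)) \<partial>lborel \<partial>lborel)"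
    by (intro nn_integral_cong nn_integral_translate[symmetric]) measurable
  also have "\<dots> = (\<integral>\<^sup>+h. \<integral>\<^sup>+x. ennreal ((u (h + x) - u x)^2 * frac_kernel s (h + x - x)) \<partial>lborel \<partial>lborel)"
    by (rule lborel_pair.Fubini'[symmetric]) measurable
  also have "\<dots> = (\<integral>\<^sup>+h. (\<integral>\<^sup>+x. ennreal ((u (x + h) - u x)^2) \<partial>lborel) * ennreal (frac_kernel s h) \<partial>lborel)"
    by (intro nn_integral_cong) (simp add: add.commute ennreal_mult nn_integral_multc)
  finally show ?thesis .
qed

text \<open>A shift by 2h is two shifts by h, so doubling multiplies the modulus by at most 4. This
  transports the lower bound known for long shifts to short ones.\<close>

lemma shift_energy_halving:
  fixes u :: "real^'n \<Rightarrow> real"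
  assumes [measurable]: "u \<in> borel_measurable borel"
  defines "f \<equiv> \<lambda>h. \<integral>\<^sup>+x. ennreal ((u (x + h) - u x)^2) \<partial>lborel"
  shows "f h \<le> 4 ^ k * f ((1 / 2) ^ k *\<^sub>R h)"
proof (induction k)
  case (Suc k)
  have double: "f (h + h) \<le> 4 * f h" for h
  proof -
    have "f (h + h) \<le> (\<integral>\<^sup>+x. (2 * ennreal ((u (x + h + h) - u (x + h))^2) + 2 * ennreal ((u (x + h) - u x)^2)) \<partial>lborel)"
      unfolding f_def
    proof (intro nn_integral_mono)
      fix x
      have "(u (x + h + h) - u x)^2 \<le> 2 * (u (x + h + h) - u (x + h))^2 + 2 * (u (x + h) - u x)^2"
        using sum_squares_bound[of "u (x + h + h) - u (x + h)" "u (x + h) - u x"]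
          power2_sum[of "u (x + h + h) - u (x + h)" "u (x + h) - u x"] by simp
      then have "ennreal ((u (x + h + h) - u x)^2) \<le> ennreal (2 * (u (x + h + h) - u (x + h))^2 + 2 * (u (x + h) - u x)^2)"
        by (rule ennreal_leI)
      then show "ennreal ((u (x + (h + h)) - u x)^2) \<le> 2 * ennreal ((u (x + h + h) - u (x + h))^2) + 2 * ennreal ((u (x + h) - u x)^2)"
        by (simp add: ennreal_mult add.assoc)
    qed
    also have "\<dots> = 2 * (\<integral>\<^sup>+x. ennreal ((u (x + h + h) - u (x + h))^2) \<partial>lborel) + 2 * f h"
      unfolding f_def by (simp add: nn_integral_add nn_integral_cmult)
    also have "(\<integral>\<^sup>+x. ennreal ((u (x + h + h) - u (x + h))^2) \<partial>lborel) = f h"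
      unfolding f_def by (rule nn_integral_translate) measurable
    also have "2 * f h + 2 * f h = 4 * f h" by (simp flip: distrib_right)
    finally show ?thesis .
  qed
  have eq: "(1 / 2) ^ Suc k *\<^sub>R h + (1 / 2) ^ Suc k *\<^sub>R h = (1 / 2) ^ k *\<^sub>R h"
    by (simp flip: scaleR_left_distrib)
  have "f h \<le> 4 ^ k * f ((1 / 2) ^ k *\<^sub>R h)" by (rule Suc)
  also have "\<dots> \<le> 4 ^ k * (4 * f ((1 / 2) ^ Suc k *\<^sub>R h))"
    using double[of "(1 / 2) ^ Suc k *\<^sub>R h"] unfolding eq by (intro mult_left_mono) auto
  finally show ?case by (simp add: mult.assoc mult.commute mult.left_commute)
qed simp

text \<open>A shift longer than the diameter moves \<Omega> off itself, so that one of the two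
  values in the difference vanishes.\<close>

lemma shift_energy_far:
  fixes u :: "real^'n \<Rightarrow> real"
  assumes [measurable]: "u \<in> borel_measurable borel" and \<Omega>[measurable]: "\<Omega> \<in> sets borel"
    and zero: "AE x in lborel. x \<notin> \<Omega> \<longrightarrow> u x = 0"
    and far: "\<And>x. x \<in> \<Omega> \<Longrightarrow> x + h \<notin> \<Omega>"
  shows "(\<integral>\<^sup>+x. ennreal ((u x)^2) \<partial>lborel) \<le> 2 * (\<integral>\<^sup>+x. ennreal ((u (x + h) - u x)^2) \<partial>lborel)"
proof -
  \<comment> \<open>Null function that absorbs the points outside \<Omega> where \<open>u\<close>
    fails to vanish; with it the estimate holds at every x, not just almost everywhere.\<close>
  define z where "z x = 2 * ennreal ((u x)^2) * indicator (- \<Omega>) x" for x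
  have [measurable]: "z \<in> borel_measurable borel" unfolding z_def by measurable
  have z: "(\<integral>\<^sup>+x. z x \<partial>lborel) = 0"
    using zero by (subst nn_integral_0_iff_AE) (auto simp: z_def split: split_indicator elim: eventually_mono)
  have "(\<integral>\<^sup>+x. ennreal ((u x)^2) \<partial>lborel) \<le> (\<integral>\<^sup>+x. (2 * ennreal ((u (x + h) - u x)^2) + (z (x + h) + z x)) \<partial>lborel)"
  proof (intro nn_integral_mono)
    fix x
    show "ennreal ((u x)^2) \<le> 2 * ennreal ((u (x + h) - u x)^2) + (z (x + h) + z x)"
    proof (cases "x \<in> \<Omega>")
      case True
      have "(u x)^2 \<le> 2 * (u (x + h) - u x)^2 + 2 * (u (x + h))^2"
        using sum_squares_bound[of "u x - u (x + h)" "u (x + h)"] power2_sum[of "u x - u (x + h)" "u (x + h)"]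
        by (simp add: power2_commute[of "u (x + h)" "u x"])
      then have "ennreal ((u x)^2) \<le> ennreal (2 * (u (x + h) - u x)^2 + 2 * (u (x + h))^2)"
        by (rule ennreal_leI)
      then show ?thesis using far[OF True] True by (simp add: z_def ennreal_mult)
    next
      case False
      have "ennreal ((u x)^2) \<le> 2 * ennreal ((u x)^2)"
        using mult_right_mono[of 1 2 "ennreal ((u x)^2)"] by simp
      also have "\<dots> = z x" using False by (simp add: z_def)
      finally show ?thesis by (simp add: add_increasing)
    qed
  qed
  also have "\<dots> = 2 * (\<integral>\<^sup>+x. ennreal ((u (x + h) - u x)^2) \<partial>lborel) + ((\<integral>\<^sup>+x. z (x + h) \<partial>lborel) + (\<integral>\<^sup>+x. z x \<partial>lborel))"
    by (simp add: nn_integral_add nn_integral_cmult)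
  also have "(\<integral>\<^sup>+x. z (x + h) \<partial>lborel) = (\<integral>\<^sup>+x. z x \<partial>lborel)"
    by (rule nn_integral_translate) measurable
  finally show ?thesis by (simp add: z)
qed

text \<open>Each of the first \<open>1 / (1 - s)\<close> dyadic annuli contributes an amount bounded below, which
  compensates the factor \<open>1 - s\<close> in the normalising constant as \<open>s\<close> tends to 1.\<close>

lemma gagliardo_lower_bound:
  fixes u :: "real^'n \<Rightarrow> real"
  assumes s: "0 < s" "s < 1" and R: "1 \<le> R" and u[measurable]: "u \<in> borel_measurable borel"
    and \<Omega>[measurable]: "\<Omega> \<in> sets borel" and zero: "AE x in lborel. x \<notin> \<Omega> \<longrightarrow> u x = 0"
    and diam: "\<And>x y. x \<in> \<Omega> \<Longrightarrow> y \<in> \<Omega> \<Longrightarrow> norm (x - y) < R"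
  shows "ennreal (measure lborel (ball (0::real^'n) 1) / (16 * (2 * R) ^ (CARD('n) + 2)) / (1 - s)) *
     (\<integral>\<^sup>+x. ennreal ((u x)^2) \<partial>lborel) \<le> gagliardo s u"
proof -
  define N where "N = CARD('n)"
  have N: "0 < N" by (simp add: N_def)
  define w where "w = measure lborel (ball (0::real^'n) 1)"
  have w: "0 < w" unfolding w_def by (rule unit_ball_pos)
  define f where "f h = (\<integral>\<^sup>+x. ennreal ((u (x + h) - u x)^2) \<partial>lborel)" for h
  have [measurable]: "f \<in> borel_measurable borel" unfolding f_def by measurable
  define U where "U = (\<integral>\<^sup>+x. ennreal ((u x)^2) \<partial>lborel)"
  define A where "A k = {h::real^'n. (1/2)^k * R \<le> norm h \<and> norm h < 2 * ((1/2)^k * R)}" for k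
  have [measurable]: "A k \<in> sets borel" for k unfolding A_def by measurable
  define I where "I k = (\<integral>\<^sup>+h. f h * ennreal (frac_kernel s h) * indicator (A k) h \<partial>lborel)" for k
  define \<kappa> where "\<kappa> = 1 / (2 * R) powr (real N + 2 * s)"
  have k0: "0 < \<kappa>" using R by (simp add: \<kappa>_def)
  \<comment> \<open>Lower bound for \<kappa> without s, from 2s < 2 and 2R \<ge> 1.\<close>
  define b where "b = 1 / (2 * R) ^ (N + 2)"
  have b0: "0 < b" using R by (simp add: b_def)
  have bk: "b \<le> \<kappa>"
  proof -
    have "(2 * R) powr (real N + 2 * s) \<le> (2 * R) powr (real (N + 2))"
      using R s by (intro powr_mono) auto
    also have "\<dots> = (2 * R) ^ (N + 2)" using R by (subst powr_realpow) auto
    finally show ?thesis unfolding b_def \<kappa>_def using R by (intro divide_left_mono) auto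
  qed
  have far: "U \<le> 2 * f h" if "R \<le> norm h" for h
    unfolding U_def f_def
  proof (rule shift_energy_far[OF u \<Omega> zero])
    fix x assume "x \<in> \<Omega>"
    then show "x + h \<notin> \<Omega>" using diam[of "x + h" x] that by auto
  qed
  have A0: "ennreal w \<le> emeasure lborel (A 0)"
  proof -
    have *: "emeasure lborel (ball (0::real^'n) (2 * R)) = emeasure lborel (A 0) + emeasure lborel (ball (0::real^'n) R)"
    proof -
      have eq: "ball (0::real^'n) (2 * R) = A 0 \<union> ball 0 R" using R by (auto simp: A_def)
      show ?thesis unfolding eq by (intro plus_emeasure[symmetric]) (auto simp: A_def)
    qed
    have "ennreal (w * (2 * R) ^ N) - ennreal (w * R ^ N) \<le> emeasure lborel (A 0)"
      using * R by (simp add: emeasure_ball_unit w_def N_def ennreal_minus_le_iff add.commute)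
    moreover have "w \<le> w * (2 * R) ^ N - w * R ^ N"
    proof -
      have "1 \<le> R ^ N" using R by (rule one_le_power)
      moreover have "2 * R ^ N \<le> 2 ^ N * R ^ N" using R N self_le_power[of "2::real" N] by (intro mult_right_mono) auto
      ultimately have "1 \<le> (2 * R) ^ N - R ^ N" unfolding power_mult_distrib by linarith
      then show ?thesis using mult_left_mono[of 1 "(2 * R) ^ N - R ^ N" w] w by (simp add: right_diff_distrib)
    qed
    then have "ennreal w \<le> ennreal (w * (2 * R) ^ N) - ennreal (w * R ^ N)"
      using w R by (subst ennreal_minus) (auto intro: ennreal_leI)
    ultimately show ?thesis by (rule order_trans[rotated])
  qed
  \<comment> \<open>Rescaling the k-th annulus to the 0-th gains c^(-2s) = 4^(sk) from the kernel
    and loses 4^k from the halving. As long as k (1 - s) \<le> 1, the quotient is at least 1/4. With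
    the 1/2 from \<open>far\<close> this makes 1/8.\<close>
  have I: "ennreal (w * b / 8) * U \<le> I k" if k: "real k * (1 - s) \<le> 1" for k
  proof -
    have "ennreal (4 ^ k) = (4::ennreal) ^ k" by (simp add: ennreal_power[symmetric])
    then have top: "(4::ennreal) ^ k < top" by (metis ennreal_less_top)
    define c where "c = (1/2::real) ^ k"
    have c: "0 < c" by (simp add: c_def)
    have "(\<integral>\<^sup>+h. ennreal b * (U / 2 / 4 ^ k) * indicator (A 0) h \<partial>lborel) \<le> 
          (\<integral>\<^sup>+h. f (c *\<^sub>R h) * ennreal (frac_kernel s h) * indicator (A 0) h \<partial>lborel)"
    proof (intro nn_integral_mono)
      fix h
      show "ennreal b * (U / 2 / 4 ^ k) * indicator (A 0) h \<le> f (c *\<^sub>R h) * ennreal (frac_kernel s h) * indicator (A 0) h"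
      proof (cases "h \<in> A 0")
        case True
        then have h: "R \<le> norm h" "norm h < 2 * R" by (auto simp: A_def)
        have h0: "0 < norm h" using h R by linarith
        have "\<kappa> \<le> frac_kernel s h"
          unfolding \<kappa>_def frac_kernel_def N_def using h h0 s R
          by (intro divide_left_mono powr_mono2 mult_pos_pos) auto
        then have "ennreal b \<le> ennreal (frac_kernel s h)" using bk by (intro ennreal_leI) auto
        moreover have "U / 2 / 4 ^ k \<le> f (c *\<^sub>R h)"
        proof -
          have "U \<le> 2 * f h" using far h by simp
          also have "\<dots> \<le> 2 * (4 ^ k * f (c *\<^sub>R h))"
            using shift_energy_halving[OF u, of h k] unfolding f_def c_def by (intro mult_left_mono) auto
          finally have le: "U \<le> (2 * 4 ^ k) * f (c *\<^sub>R h)" by (simp add: mult.assoc)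
          have "0 < ennreal (2 * 4 ^ k)" by simp
          also have "ennreal (2 * 4 ^ k) = 2 * 4 ^ k" by (simp add: ennreal_mult ennreal_power[symmetric])
          finally have "(0::ennreal) < 2 * 4 ^ k" .
          from this le have "U / (2 * 4 ^ k) \<le> f (c *\<^sub>R h)" by (rule divide_le_posI_ennreal)
          moreover have "U / 2 / 4 ^ k = U / (2 * 4 ^ k)"
            by (simp add: divide_ennreal_def ennreal_inverse_mult mult.assoc top)
          ultimately show ?thesis by simp
        qed
        ultimately have "ennreal b * (U / 2 / 4 ^ k) \<le> ennreal (frac_kernel s h) * f (c *\<^sub>R h)"
          by (intro mult_mono) auto
        then show ?thesis using True by (simp add: mult.commute)
      qed simp
    qed
    also have "(\<integral>\<^sup>+h. ennreal b * (U / 2 / 4 ^ k) * indicator (A 0) h \<partial>lborel) = ennreal b * (U / 2 / 4 ^ k) * emeasure lborel (A 0)"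
      by (intro nn_integral_cmult_indicator) measurable
    finally have 1: "ennreal b * (U / 2 / 4 ^ k) * ennreal w \<le> (\<integral>\<^sup>+h. f (c *\<^sub>R h) * ennreal (frac_kernel s h) * indicator (A 0) h \<partial>lborel)"
      using A0 by (meson mult_left_mono order_trans zero_le)
    have "I k = ennreal (c ^ N) * (\<integral>\<^sup>+h. f (c *\<^sub>R h) * ennreal (frac_kernel s (c *\<^sub>R h)) * indicator (A k) (c *\<^sub>R h) \<partial>lborel)"
      unfolding I_def by (subst nn_integral_scale[where c = c and t = 0]) (use c in \<open>auto simp: N_def\<close>)
    also have "(\<integral>\<^sup>+h. f (c *\<^sub>R h) * ennreal (frac_kernel s (c *\<^sub>R h)) * indicator (A k) (c *\<^sub>R h) \<partial>lborel)
        = (\<integral>\<^sup>+h. ennreal (c powr - (real N + 2 * s)) * (f (c *\<^sub>R h) * ennreal (frac_kernel s h) * indicator (A 0) h) \<partial>lborel)"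
    proof (intro nn_integral_cong)
      fix h
      have "indicator (A k) (c *\<^sub>R h) = (indicator (A 0) h :: ennreal)"
        using c by (auto simp: A_def c_def split: split_indicator)
      moreover have "ennreal (frac_kernel s (c *\<^sub>R h)) = ennreal (c powr - (real N + 2 * s)) * ennreal (frac_kernel s h)"
        unfolding frac_kernel_scaleR[OF c] N_def by (intro ennreal_mult) auto
      ultimately show "f (c *\<^sub>R h) * ennreal (frac_kernel s (c *\<^sub>R h)) * indicator (A k) (c *\<^sub>R h)
          = ennreal (c powr - (real N + 2 * s)) * (f (c *\<^sub>R h) * ennreal (frac_kernel s h) * indicator (A 0) h)"
        by (simp only: mult_ac)
    qed
    also have "\<dots> = ennreal (c powr - (real N + 2 * s)) * (\<integral>\<^sup>+h. f (c *\<^sub>R h) * ennreal (frac_kernel s h) * indicator (A 0) h \<partial>lborel)"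
      by (intro nn_integral_cmult) measurable
    finally have 2: "I k = ennreal (c ^ N) * (ennreal (c powr - (real N + 2 * s)) * (\<integral>\<^sup>+h. f (c *\<^sub>R h) * ennreal (frac_kernel s h) * indicator (A 0) h \<partial>lborel))" .
    have cc: "c ^ N * c powr - (real N + 2 * s) = c powr (- 2 * s)"
      using c by (simp add: powr_realpow[symmetric] powr_add[symmetric])
    have "ennreal (c powr (- 2 * s)) * (ennreal b * (U / 2 / 4 ^ k) * ennreal w) \<le> I k"
    proof -
      have "ennreal (c powr (- 2 * s)) = ennreal (c ^ N) * ennreal (c powr - (real N + 2 * s))"
        unfolding cc[symmetric] using c by (intro ennreal_mult) auto
      then show ?thesis unfolding 2 mult.assoc[of "ennreal (c ^ N)", symmetric]
        using 1 by (simp only:) (rule mult_left_mono, auto)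
    qed
    moreover have "ennreal (w * b / 8) * U \<le> ennreal (c powr (- 2 * s)) * (ennreal b * (U / 2 / 4 ^ k) * ennreal w)"
    proof -
      have "(1/4::real) \<le> c powr (- 2 * s) / 4 ^ k"
      proof -
        have c4: "c powr (- 2 * s) = 4 powr (s * real k)"
        proof -
          have "c = 2 powr (- real k)"
            by (simp add: c_def powr_minus powr_realpow power_one_over inverse_eq_divide)
          then have "c powr (- 2 * s) = 2 powr (2 * (s * real k))" by (simp add: powr_powr mult_ac)
          also have "\<dots> = (2 powr 2) powr (s * real k)" by (simp only: powr_powr)
          finally show ?thesis by simp
        qed
        have "(1/4::real) = 4 powr (- 1)" by (simp add: powr_minus)
        also have "\<dots> \<le> 4 powr (s * real k - real k)" using k by (intro powr_mono) (auto simp: algebra_simps)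
        also have "\<dots> = c powr (- 2 * s) / 4 ^ k" unfolding c4 by (simp add: powr_diff powr_realpow)
        finally show ?thesis .
      qed
      then have le: "w * b / 8 \<le> c powr (- 2 * s) * b * w / (2 * 4 ^ k)"
        using mult_right_mono[of "1/4" "c powr (- 2 * s) / 4 ^ k" "w * b / 2"] w b0 by (simp add: mult_ac)
      have "ennreal (c powr (- 2 * s)) * (ennreal b * (U / 2 / 4 ^ k) * ennreal w) = ennreal (c powr (- 2 * s) * b * w / (2 * 4 ^ k)) * U"
      proof -
        have "ennreal (c powr (- 2 * s) * b * w / (2 * 4 ^ k)) = ennreal (c powr (- 2 * s)) * ennreal b * ennreal w / ennreal (2 * 4 ^ k)"
          using b0 w by (simp add: divide_ennreal[symmetric] ennreal_mult)
        also have "ennreal (2 * 4 ^ k) = 2 * 4 ^ k" by (simp add: ennreal_mult ennreal_power[symmetric])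
        finally show ?thesis
          by (simp add: divide_ennreal_def ennreal_inverse_mult mult_ac top)
      qed
      then show ?thesis using le by (auto intro!: mult_right_mono ennreal_leI)
    qed
    ultimately show ?thesis by (rule order_trans[rotated])
  qed
  \<comment> \<open>The indices 0, ..., n are admissible, and there are n + 1 > 1 / (1 - s) of
    them.\<close>
  define n where "n = nat \<lfloor>1 / (1 - s)\<rfloor>"
  have n: "real n \<le> 1 / (1 - s)" "1 / (1 - s) < real n + 1"
    unfolding n_def using s by (auto simp: of_nat_nat)
  have "ennreal (w * b / 16 / (1 - s)) * U \<le> ennreal (real (Suc n)) * (ennreal (w * b / 8) * U)"
  proof -
    have "w * b / 16 / (1 - s) \<le> real (Suc n) * (w * b / 8)"
    proof -
      have "(w * b / 16) * (1 / (1 - s)) \<le> (w * b / 16) * (real n + 1)"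
        using n w b0 by (intro mult_left_mono) auto
      also have "\<dots> \<le> (w * b / 8) * (real n + 1)" using w b0 by (intro mult_right_mono) auto
      finally show ?thesis by (simp add: mult.commute add.commute)
    qed
    then have "ennreal (w * b / 16 / (1 - s)) \<le> ennreal (real (Suc n) * (w * b / 8))" by (rule ennreal_leI)
    also have "\<dots> = ennreal (real (Suc n)) * ennreal (w * b / 8)"
      using w b0 by (intro ennreal_mult) auto
    finally show ?thesis unfolding mult.assoc[symmetric] by (intro mult_right_mono) auto
  qed
  also have "\<dots> = (\<Sum>k\<le>n. ennreal (w * b / 8) * U)"
    by (simp add: ennreal_of_nat_eq_real_of_nat flip: ennreal_plus)
  also have "\<dots> \<le> (\<Sum>k\<le>n. I k)"
  proof (intro sum_mono I)
    fix k assume "k \<in> {..n}"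
    then have "real k \<le> 1 / (1 - s)" using n by (auto intro: order_trans[rotated])
    then show "real k * (1 - s) \<le> 1" using s by (simp add: field_simps)
  qed
  also have "\<dots> = (\<integral>\<^sup>+h. (\<Sum>k\<le>n. f h * ennreal (frac_kernel s h) * indicator (A k) h) \<partial>lborel)"
    unfolding I_def by (intro nn_integral_sum[symmetric]) measurable
  also have "\<dots> \<le> (\<integral>\<^sup>+h. f h * ennreal (frac_kernel s h) \<partial>lborel)"
  proof (intro nn_integral_mono)
    fix h
    have disj: "j = k" if "h \<in> A j" "h \<in> A k" for j k
    proof (rule ccontr)
      have aux: False if "i < j" "h \<in> A i" "h \<in> A j" for i j
      proof -
        have "(1/2::real) ^ j \<le> (1/2) ^ Suc i" using that(1) by (intro power_decreasing) auto
        then have "2 * ((1/2) ^ j * R) \<le> (1/2) ^ i * R" using R mult_right_mono[of "(1/2::real) ^ j" "(1/2) ^ Suc i" "2 * R"] by simp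
        with that show False by (auto simp: A_def)
      qed
      assume "j \<noteq> k"
      then show False using aux[of j k] aux[of k j] that by linarith
    qed
    have "(\<Sum>k\<le>n. indicator (A k) h :: ennreal) \<le> 1"
    proof (cases "\<exists>k\<le>n. h \<in> A k")
      case True
      then obtain k where k: "k \<le> n" "h \<in> A k" by auto
      have "(\<Sum>j\<le>n. indicator (A j) h :: ennreal) = (\<Sum>j\<in>{k}. indicator (A j) h)"
        using k disj by (intro sum.mono_neutral_right) (auto simp: indicator_def)
      then show ?thesis using k by simp
    next
      case False
      then have "(\<Sum>j\<le>n. indicator (A j) h :: ennreal) = 0" by (intro sum.neutral) auto
      then show ?thesis by simp
    qed
    then have "f h * ennreal (frac_kernel s h) * (\<Sum>k\<le>n. indicator (A k) h) \<le> f h * ennreal (frac_kernel s h) * 1"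
      by (intro mult_left_mono) auto
    then show "(\<Sum>k\<le>n. f h * ennreal (frac_kernel s h) * indicator (A k) h) \<le> f h * ennreal (frac_kernel s h)"
      by (simp add: sum_distrib_left)
  qed
  also have "\<dots> = gagliardo s u" by (simp add: gagliardo_eq_shift f_def)
  finally show ?thesis by (simp add: w_def b_def U_def N_def mult_ac)
qed


text \<open>By the functional equation s (1 - s) |Gamma(-s)| = Gamma(2 - s). So \<open>C_Ns\<close>
  divided by s (1 - s) involves only values of Gamma on the compact intervals [N/2, N/2 + 1] and
  [1, 2], where continuity gives bounds independent of s.\<close>

lemma C_Ns_lower_bound:
  assumes N: "0 < N"
  shows "\<exists>c>0. \<forall>s. 0 < s \<and> s < 1 \<longrightarrow> c * s * (1 - s) \<le> C_Ns N s"
proof -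
  have cont: "continuous_on {a..b} (Gamma :: real \<Rightarrow> real)" if "0 < a" for a b
    using that by (intro continuous_on_Gamma) (auto elim!: nonpos_Ints_cases)
  obtain x where x: "x \<in> {real N / 2..real N / 2 + 1}" "\<And>y. y \<in> {real N / 2..real N / 2 + 1} \<Longrightarrow> Gamma x \<le> Gamma y"
    using continuous_attains_inf[OF _ _ cont[of "real N / 2" "real N / 2 + 1"]] N by auto
  obtain z where z: "z \<in> {1..2::real}" "\<And>y. y \<in> {1..2} \<Longrightarrow> Gamma y \<le> Gamma z"
    using continuous_attains_sup[OF _ _ cont[of 1 2]] by auto
  have Gx: "0 < Gamma x" using x N by (intro Gamma_real_pos) auto
  have Gz: "0 < Gamma z" using z by (intro Gamma_real_pos) auto
  define c where "c = Gamma x / (pi powr (real N / 2) * Gamma z)"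
  have "c * s * (1 - s) \<le> C_Ns N s" if s: "0 < s" "s < 1" for s
  proof -
    have nz: "- s \<notin> \<int>\<^sub>\<le>\<^sub>0" "1 - s \<notin> \<int>\<^sub>\<le>\<^sub>0"
      using uminus_notin_nonpos_Ints[OF s] s by (auto elim!: nonpos_Ints_cases)
    have "Gamma (1 - s) = - s * Gamma (- s)"
      using Gamma_plus1[OF nz(1)] by (simp add: add.commute)
    moreover have "Gamma (2 - s) = (1 - s) * Gamma (1 - s)"
      using Gamma_plus1[OF nz(2)] by (simp add: algebra_simps)
    moreover have "0 < Gamma (1 - s)" using s by (intro Gamma_real_pos) auto
    ultimately have G: "s * (1 - s) * \<bar>Gamma (- s)\<bar> = Gamma (2 - s)" "0 < \<bar>Gamma (- s)\<bar>"
      using s by (auto simp: abs_if mult_less_0_iff zero_less_mult_iff mult_ac split: if_splits)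
    have "c * s * (1 - s) * (pi powr (real N / 2) * \<bar>Gamma (- s)\<bar>) = Gamma x / Gamma z * Gamma (2 - s)"
      by (simp add: c_def G(1)[symmetric])
    also have "\<dots> \<le> Gamma x"
      using z(2)[of "2 - s"] s Gx Gz by (simp add: divide_simps)
    also have "\<dots> \<le> 1 * Gamma (real N / 2 + s)" using x(2) s by simp
    also have "\<dots> \<le> 2 powr (2 * s) * Gamma (real N / 2 + s)"
      using s Gx x(2)[of "real N / 2 + s"] by (intro mult_right_mono) (auto simp: ge_one_powr_ge_zero)
    finally show ?thesis unfolding C_Ns_def using G(2) by (simp add: pos_le_divide_eq)
  qed
  moreover have "0 < c" using Gx Gz by (simp add: c_def)
  ultimately show ?thesis by blast
qed

lemma Lp_pow_2:
  fixes u :: "real^'n \<Rightarrow> real"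
  assumes "H_s s u"
  shows "ennreal (Lp_pow 2 u) = (\<integral>\<^sup>+x. ennreal ((u x)^2) \<partial>lborel)" "integrable lborel (\<lambda>x. (u x)^2)"
    "Lp_pow 2 u = (\<integral>x. (u x)^2 \<partial>lborel)"
proof -
  note [measurable] = H_s_measurable[OF assms]
  show i: "integrable lborel (\<lambda>x. (u x)^2)"
    using assms by (intro integrableI_bounded) (auto simp: H_s_def)
  show e: "Lp_pow 2 u = (\<integral>x. (u x)^2 \<partial>lborel)" by (simp add: Lp_pow_def)
  show "ennreal (Lp_pow 2 u) = (\<integral>\<^sup>+x. ennreal ((u x)^2) \<partial>lborel)"
    unfolding e by (rule nn_integral_eq_integral[symmetric, OF i]) auto
qed

text \<open>The factor 1 / (1 - s) of \<open>gagliardo_lower_bound\<close> cancels the 1 - s in the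
  normalising constant. The remaining factor s is bounded below by s0.\<close>

lemma poincare_uniform:
  fixes \<Omega> :: "(real^'n) set"
  assumes \<Omega>: "open \<Omega>" "bounded \<Omega>" and s0: "0 < s0"
  shows "\<exists>c>0. \<forall>s u. s0 \<le> s \<and> s < 1 \<and> u \<in> X0 \<Omega> s \<longrightarrow> c * Lp_pow 2 u \<le> frac_inner s u u"
proof -
  obtain c where c: "0 < c" "\<And>s. 0 < s \<and> s < 1 \<Longrightarrow> c * s * (1 - s) \<le> C_Ns CARD('n) s"
    using C_Ns_lower_bound[of "CARD('n)"] by auto
  obtain B where B: "0 < B" "\<And>x. x \<in> \<Omega> \<Longrightarrow> norm x \<le> B" using \<Omega>(2) bounded_pos[of \<Omega>] by auto
  define R where "R = 2 * B + 1"
  have diam: "norm (x - y) < R" if "x \<in> \<Omega>" "y \<in> \<Omega>" for x y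
    using B(2)[OF that(1)] B(2)[OF that(2)] norm_triangle_ineq4[of x y] by (simp add: R_def)
  define w where "w = measure lborel (ball (0::real^'n) 1) / (16 * (2 * R) ^ (CARD('n) + 2))"
  have w: "0 < w" using unit_ball_pos[where 'a="real^'n"] B by (simp add: w_def R_def)
  have "c * s0 * w / 2 * Lp_pow 2 u \<le> frac_inner s u u" if s: "s0 \<le> s" "s < 1" and u: "u \<in> X0 \<Omega> s" for s u
  proof -
    have H: "H_s s u" using u by (rule X0_H_s)
    have L: "0 \<le> Lp_pow 2 u" by (simp add: Lp_pow_def)
    have "ennreal (w / (1 - s)) * (\<integral>\<^sup>+x. ennreal ((u x)^2) \<partial>lborel) \<le> gagliardo s u"
      unfolding w_def using u s s0 B \<Omega> diam
      by (intro gagliardo_lower_bound[of s R u \<Omega>]) (auto simp: R_def X0_def H_s_def)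
    then have "ennreal (w / (1 - s) * Lp_pow 2 u) \<le> gagliardo s u"
      unfolding Lp_pow_2(1)[OF H, symmetric] using s w L by (subst ennreal_mult) auto
    then have g: "w / (1 - s) * Lp_pow 2 u \<le> enn2real (gagliardo s u)"
      using enn2real_mono[of "ennreal (w / (1 - s) * Lp_pow 2 u)" "gagliardo s u"] H s w L by (simp add: H_s_def)
    have "c * s0 * w / 2 * Lp_pow 2 u \<le> c * s * w / 2 * Lp_pow 2 u"
      using s c(1) w L by (intro mult_right_mono divide_right_mono mult_left_mono) auto
    also have "\<dots> = c * s * (1 - s) / 2 * (w / (1 - s) * Lp_pow 2 u)"
    proof -
      have gen: "c * s * w / 2 * L = c * s * q / 2 * (w / q * L)" if "q \<noteq> 0" for q L using that by simp
      show ?thesis by (rule gen) (use s in simp)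
    qed
    also have "\<dots> \<le> C_Ns CARD('n) s / 2 * enn2real (gagliardo s u)"
      using c(2)[of s] g s s0 w L C_Ns_pos[of s "CARD('n)"] by (intro mult_mono) auto
    also have "\<dots> = frac_inner s u u" using H_s_measurable[OF H] by (simp add: frac_inner_self)
    finally show ?thesis .
  qed
  moreover have "0 < c * s0 * w / 2" using c w s0 by simp
  ultimately show ?thesis by blast
qed

text \<open>Guards the infima \<open>lambda1\<close> and \<open>best_constant\<close> against being
  taken over the empty set. The witness is a tent function: it is Lipschitz and bounded, so its
  squared increments are at most min(|h|^2, r^2), and the kernel integrates this near the origin as
  well as at infinity.\<close>

lemma X0_nontrivial:
  fixes \<Omega> :: "(real^'n) set"
  assumes \<Omega>: "open \<Omega>" "\<Omega> \<noteq> {}" and s: "0 < s" "s < 1"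
  shows "\<exists>u\<in>X0 \<Omega> s. \<not> zero_ae u"
proof -
  obtain a where "a \<in> \<Omega>" using \<Omega> by auto
  then obtain r where r: "0 < r" "ball a r \<subseteq> \<Omega>" using \<Omega> open_contains_ball_eq by blast
  define u where "u x = max 0 (r - norm (x - a))" for x
  have [measurable]: "u \<in> borel_measurable borel" unfolding u_def by measurable
  have supp: "u x = 0" if "x \<notin> ball a r" for x
    using that by (auto simp: u_def dist_norm norm_minus_commute)
  have bd: "0 \<le> u x" "u x \<le> r" for x using r by (auto simp: u_def)
  have lip: "\<bar>u x - u y\<bar> \<le> norm (x - y)" for x y
    using norm_triangle_ineq3[of "x - a" "y - a"] by (auto simp: u_def)
  define b where "b = emeasure lborel (ball a r)"
  have b: "b < \<infinity>" unfolding b_def by (intro emeasure_bounded_finite) auto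
  have "(\<integral>\<^sup>+x. ennreal ((u x)^2) \<partial>lborel) \<le> (\<integral>\<^sup>+x. ennreal (r^2) * indicator (ball a r) x \<partial>lborel)"
    using bd supp by (intro nn_integral_mono) (auto simp: power_mono split: split_indicator intro!: ennreal_leI)
  also have "\<dots> < \<infinity>" using b by (simp add: nn_integral_cmult_indicator b_def ennreal_mult_less_top)
  finally have u2: "(\<integral>\<^sup>+x. ennreal ((u x)^2) \<partial>lborel) < \<infinity>" .
  define m where "m h = min ((norm h)^2) (r^2)" for h :: "real^'n"
  have [measurable]: "m \<in> borel_measurable borel" unfolding m_def by measurable
  have "gagliardo s u \<le> (\<integral>\<^sup>+h. 2 * b * ennreal (m h * frac_kernel s h) \<partial>lborel)"
    unfolding gagliardo_eq_shift[OF \<open>u \<in> borel_measurable borel\<close>]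
  proof (intro nn_integral_mono)
    fix h :: "real^'n"
    have mh: "(\<lambda>x. indicator (ball a r) (x + h) :: ennreal) \<in> borel_measurable lborel"
      unfolding measurable_lborel2
      by (intro measurable_compose[where f="\<lambda>x. x + h" and g="indicator (ball a r)" and N=borel]
          borel_measurable_indicator) auto
    have "(\<integral>\<^sup>+x. ennreal ((u (x + h) - u x)^2) \<partial>lborel)
        \<le> (\<integral>\<^sup>+x. ennreal (m h) * (indicator (ball a r) (x + h) + indicator (ball a r) x) \<partial>lborel)"
    proof (intro nn_integral_mono)
      fix x
      show "ennreal ((u (x + h) - u x)^2) \<le> ennreal (m h) * (indicator (ball a r) (x + h) + indicator (ball a r) x)"
      proof (cases "x \<in> ball a r \<or> x + h \<in> ball a r")
        case True
        have "\<bar>u (x + h) - u x\<bar> \<le> \<bar>norm h\<bar>" "\<bar>u (x + h) - u x\<bar> \<le> \<bar>r\<bar>"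
          using lip[of "x + h" x] bd[of x] bd[of "x + h"] r by auto
        then have "(u (x + h) - u x)^2 \<le> m h"
          unfolding abs_le_square_iff m_def by simp
        then have "ennreal ((u (x + h) - u x)^2) \<le> ennreal (m h) * 1" by (simp add: ennreal_leI)
        also have "\<dots> \<le> ennreal (m h) * (indicator (ball a r) (x + h) + indicator (ball a r) x)"
          using True by (intro mult_left_mono) (auto simp: indicator_def)
        finally show ?thesis .
      next
        case False
        then show ?thesis using supp[of x] supp[of "x + h"] by simp
      qed
    qed
    also have "\<dots> = ennreal (m h) * (\<integral>\<^sup>+x. indicator (ball a r) (x + h) + indicator (ball a r) x \<partial>lborel)"
      by (rule nn_integral_cmult[OF borel_measurable_add[OF mh borel_measurable_indicator]]) simp
    also have "(\<integral>\<^sup>+x. indicator (ball a r) (x + h) + indicator (ball a r) x \<partial>lborel) = (\<integral>\<^sup>+x. indicator (ball a r) (x + h) \<partial>lborel) + b"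
      unfolding b_def by (subst nn_integral_add[OF mh borel_measurable_indicator]) auto
    also have "(\<integral>\<^sup>+x. indicator (ball a r) (x + h) \<partial>lborel) = b"
      using nn_integral_translate[OF borel_measurable_indicator, of "ball a r" h] by (simp add: b_def)
    finally have "(\<integral>\<^sup>+x. ennreal ((u (x + h) - u x)^2) \<partial>lborel) * ennreal (frac_kernel s h) \<le> ennreal (m h) * (b + b) * ennreal (frac_kernel s h)"
      by (intro mult_right_mono) auto
    also have "\<dots> = 2 * b * ennreal (m h * frac_kernel s h)"
      by (subst ennreal_mult) (auto simp: m_def mult_ac mult_2_right)
    finally show "(\<integral>\<^sup>+x. ennreal ((u (x + h) - u x)^2) \<partial>lborel) * ennreal (frac_kernel s h) \<le> 2 * b * ennreal (m h * frac_kernel s h)" .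
  qed
  also have "\<dots> = 2 * b * (\<integral>\<^sup>+h. ennreal (m h * frac_kernel s h) \<partial>lborel)"
    by (intro nn_integral_cmult) measurable
  also have "(\<integral>\<^sup>+h. ennreal (m h * frac_kernel s h) \<partial>lborel) \<le>
      (\<integral>\<^sup>+h. (ennreal ((norm h)^2 * frac_kernel s h) * indicator {h. norm h < r} h +
          ennreal (r^2) * (ennreal (frac_kernel s h) * indicator {h. r \<le> norm h} h)) \<partial>(lborel :: (real^'n) measure))"
  proof (intro nn_integral_mono)
    fix h :: "real^'n"
    have "m h * frac_kernel s h \<le> (norm h)^2 * frac_kernel s h" "m h * frac_kernel s h \<le> r^2 * frac_kernel s h"
      by (intro mult_right_mono; simp add: m_def)+
    then show "ennreal (m h * frac_kernel s h) \<le> ennreal ((norm h)^2 * frac_kernel s h) * indicator {h. norm h < r} h +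
          ennreal (r^2) * (ennreal (frac_kernel s h) * indicator {h. r \<le> norm h} h)"
      by (auto simp: indicator_def ennreal_leI simp flip: ennreal_mult)
  qed
  also have "\<dots> = (\<integral>\<^sup>+h. ennreal ((norm h)^2 * frac_kernel s h) * indicator {h. norm h < r} h \<partial>(lborel :: (real^'n) measure)) +
      ennreal (r^2) * (\<integral>\<^sup>+h. ennreal (frac_kernel s h) * indicator {h. r \<le> norm h} h \<partial>(lborel :: (real^'n) measure))"
    by (subst nn_integral_add) (auto simp: nn_integral_cmult)
  finally have "gagliardo s u \<le> 2 * b * ((\<integral>\<^sup>+h. ennreal ((norm h)^2 * frac_kernel s h) * indicator {h. norm h < r} h \<partial>(lborel :: (real^'n) measure)) +
      ennreal (r^2) * (\<integral>\<^sup>+h. ennreal (frac_kernel s h) * indicator {h. r \<le> norm h} h \<partial>(lborel :: (real^'n) measure)))"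
    by (simp add: mult_left_mono)
  also have "\<dots> < \<infinity>"
    using b frac_kernel_near_zero_finite[OF s(2) r(1), where 'n='n] frac_kernel_tail_finite[OF s(1) r(1), where 'n='n]
    by (simp add: ennreal_mult_less_top)
  finally have "H_s s u" using u2 by (simp add: H_s_def)
  moreover have "AE x in lborel. x \<notin> \<Omega> \<longrightarrow> u x = 0" using supp r(2) by (intro AE_I2) (meson subsetD)
  ultimately have "u \<in> X0 \<Omega> s" by (simp add: X0_def)
  moreover have "\<not> zero_ae u"
  proof
    assume "zero_ae u"
    then have "AE x in lborel. x \<notin> ball a r"
      unfolding zero_ae_def by eventually_elim (auto simp: u_def dist_norm norm_minus_commute max_def split: if_splits)
    then have "emeasure lborel (ball a r) = 0"
      by (subst (asm) AE_iff_measurable[where N="ball a r"]) auto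
    moreover have "0 < emeasure lborel (ball a r)"
      using r unit_ball_pos[where 'a="real^'n"] by (simp add: emeasure_ball_unit)
    ultimately show False by simp
  qed
  ultimately show ?thesis by blast
qed

section \<open>The extension\<close>

text \<open>Poisson kernel without its normalising constant: neither signs nor nodal regions notice
  a positive factor.\<close>

definition ext_kernel :: "real \<Rightarrow> real^'n \<Rightarrow> real \<Rightarrow> real" where
  "ext_kernel s z y = y powr (2 * s) / (y^2 + (norm z)^2) powr ((real CARD('n) + 2 * s) / 2)"

definition ext :: "real \<Rightarrow> (real^'n \<Rightarrow> real) \<Rightarrow> real^'n \<Rightarrow> real \<Rightarrow> real" where
  "ext s f x y = (\<integral>\<xi>. ext_kernel s (x - \<xi>) y * f \<xi> \<partial>lborel)"

lemma extension_eq_ext: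
  fixes u :: "real^'n \<Rightarrow> real"
  shows "extension s u (x, y) = poisson_const CARD('n) s * ext s u x y"
  by (simp add: extension_def ext_def poisson_kernel_def ext_kernel_def mult.assoc
      flip: integral_mult_right_zero times_divide_eq_right)

lemma ext_kernel_nonneg [simp]: "0 \<le> ext_kernel s z y"
  by (simp add: ext_kernel_def)

lemma ext_kernel_pos: "0 < y \<Longrightarrow> 0 < ext_kernel s z y"
  by (auto simp: ext_kernel_def add_pos_nonneg intro!: divide_pos_pos)

lemma ext_kernel_measurable [measurable]: "(\<lambda>z. ext_kernel s z y) \<in> borel_measurable borel"
  unfolding ext_kernel_def by measurable

lemma sq_powr_half: "0 < y \<Longrightarrow> (y^2) powr (a / 2) = y powr a" for y :: real
  by (auto simp: powr_powr simp flip: powr_numeral)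

lemma ext_kernel_le_height:
  fixes z :: "real^'n"
  assumes "0 < s" "0 < y"
  shows "ext_kernel s z y \<le> y powr - real CARD('n)"
proof -
  have "ext_kernel s z y \<le> y powr (2 * s) / (y^2) powr ((real CARD('n) + 2 * s) / 2)"
    unfolding ext_kernel_def using assms by (intro divide_left_mono powr_mono2 mult_pos_pos) (auto simp: add_pos_nonneg)
  also have "(y^2) powr ((real CARD('n) + 2 * s) / 2) = y powr (real CARD('n) + 2 * s)"
    using assms by (intro sq_powr_half)
  also have "y powr (2 * s) / \<dots> = y powr - real CARD('n)"
    by (simp flip: powr_diff)
  finally show ?thesis .
qed

lemma norm_sq_powr_half:
  fixes z :: "real^'n"
  shows "((norm z)^2) powr (a / 2) = norm z powr a"
  by (cases "z = 0") (auto simp: powr_powr simp flip: powr_numeral)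

text \<open>Divided by y^(2s), this bound becomes an equality in the limit y to 0. That is how
  inequalities between extensions turn into inequalities between nonlocal interactions.\<close>

lemma ext_kernel_le_frac_kernel:
  fixes z :: "real^'n"
  assumes "0 < s" "z \<noteq> 0"
  shows "ext_kernel s z y \<le> y powr (2 * s) * frac_kernel s z"
proof -
  have "y powr (2 * s) / (y^2 + (norm z)^2) powr ((real CARD('n) + 2 * s) / 2) \<le> y powr (2 * s) / ((norm z)^2) powr ((real CARD('n) + 2 * s) / 2)"
    using assms by (intro divide_left_mono powr_mono2 mult_pos_pos) (auto simp: add_nonneg_pos)
  then show ?thesis unfolding ext_kernel_def frac_kernel_def by (simp add: norm_sq_powr_half)
qed

lemma ext_kernel_scale:
  fixes z :: "real^'n"
  assumes "0 < y"
  shows "ext_kernel s (y *\<^sub>R z) y = y powr - real CARD('n) * ext_kernel s z 1"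
proof -
  have "y^2 + (norm (y *\<^sub>R z))^2 = y^2 * (1 + (norm z)^2)"
    by (simp add: power_mult_distrib algebra_simps)
  then have "(y^2 + (norm (y *\<^sub>R z))^2) powr ((real CARD('n) + 2 * s) / 2) = (y^2) powr ((real CARD('n) + 2 * s) / 2) * (1 + (norm z)^2) powr ((real CARD('n) + 2 * s) / 2)"
    by (simp add: powr_mult)
  also have "(y^2) powr ((real CARD('n) + 2 * s) / 2) = y powr (real CARD('n) + 2 * s)"
    using assms by (intro sq_powr_half)
  finally have e: "(y^2 + (norm (y *\<^sub>R z))^2) powr ((real CARD('n) + 2 * s) / 2) = y powr (real CARD('n) + 2 * s) * (1 + (norm z)^2) powr ((real CARD('n) + 2 * s) / 2)" .
  have "y powr (2 * s) / y powr (real CARD('n) + 2 * s) = y powr - real CARD('n)"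
    by (simp flip: powr_diff)
  then show ?thesis unfolding ext_kernel_def e by (simp flip: divide_divide_eq_left)
qed

text \<open>The reciprocal of the Poisson constant; the proof only needs that it is positive, finite
  and the same at every height, the last by scaling.\<close>

definition kernel_mass :: "'n::finite itself \<Rightarrow> real \<Rightarrow> real" where
  "kernel_mass _ s = enn2real (\<integral>\<^sup>+(z::real^'n). ennreal (ext_kernel s z 1) \<partial>lborel)"

lemma kernel_mass:
  assumes s: "0 < s"
  shows "0 < kernel_mass TYPE('n::finite) s"
    and "0 < y \<Longrightarrow> (\<integral>\<^sup>+(z::real^'n). ennreal (ext_kernel s z y) \<partial>lborel) = ennreal (kernel_mass TYPE('n) s)"
proof -
  let ?I = "\<integral>\<^sup>+(z::real^'n). ennreal (ext_kernel s z 1) \<partial>lborel"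
  have "?I \<le> (\<integral>\<^sup>+(z::real^'n). (indicator (ball 0 1) z + ennreal (frac_kernel s z) * indicator {z. 1 \<le> norm z} z) \<partial>lborel)"
  proof (intro nn_integral_mono)
    fix z :: "real^'n"
    show "ennreal (ext_kernel s z 1) \<le> indicator (ball 0 1) z + ennreal (frac_kernel s z) * indicator {z. 1 \<le> norm z} z"
    proof (cases "norm z < 1")
      case True
      then show ?thesis using ext_kernel_le_height[OF s, of 1 z] by (auto simp: indicator_def)
    next
      case False
      then have "z \<noteq> 0" by auto
      then show ?thesis using ext_kernel_le_frac_kernel[OF s, of z 1] False by (auto simp: indicator_def intro!: ennreal_leI)
    qed
  qed
  also have "\<dots> = emeasure lborel (ball (0::real^'n) 1) + (\<integral>\<^sup>+(z::real^'n). ennreal (frac_kernel s z) * indicator {z. 1 \<le> norm z} z \<partial>lborel)"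
    by (subst nn_integral_add[OF borel_measurable_indicator]) auto
  also have "\<dots> < \<infinity>"
    using frac_kernel_tail_finite[OF s, of 1, where 'n='n] emeasure_bounded_finite[OF bounded_ball, of "0::real^'n" 1] by simp
  finally have fin: "?I < \<infinity>" .
  have "?I \<noteq> 0"
  proof
    assume "?I = 0"
    then have "AE z in (lborel :: (real^'n) measure). ennreal (ext_kernel s z 1) = 0"
      by (subst (asm) nn_integral_0_iff_AE) auto
    moreover have "ennreal (ext_kernel s z 1) \<noteq> 0" for z :: "real^'n" using ext_kernel_pos[of 1 s z] by simp
    ultimately have "AE z in (lborel :: (real^'n) measure). False" by simp
    then have "emeasure lborel (UNIV :: (real^'n) set) = 0" by (subst (asm) AE_iff_measurable[OF _ refl]) auto
    then show False by simp
  qed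
  then show "0 < kernel_mass TYPE('n) s" using fin by (simp add: kernel_mass_def enn2real_positive_iff zero_less_iff_neq_zero)
  assume y: "0 < y"
  have "(\<integral>\<^sup>+(z::real^'n). ennreal (ext_kernel s z y) \<partial>lborel) = ennreal (y ^ CARD('n)) * (\<integral>\<^sup>+(z::real^'n). ennreal (ext_kernel s (y *\<^sub>R z) y) \<partial>lborel)"
    by (subst nn_integral_scale[where c = y and t = 0]) (use y in auto)
  also have "\<dots> = ennreal (y ^ CARD('n)) * (ennreal (y powr - real CARD('n)) * ?I)"
    by (simp add: ext_kernel_scale[OF y] ennreal_mult nn_integral_cmult)
  also have "\<dots> = ?I"
    using y by (simp add: mult.assoc[symmetric] ennreal_mult[symmetric] powr_realpow[symmetric] powr_add[symmetric])
  finally show "(\<integral>\<^sup>+(z::real^'n). ennreal (ext_kernel s z y) \<partial>lborel) = ennreal (kernel_mass TYPE('n) s)"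
    using fin by (simp add: kernel_mass_def less_top)
qed

section \<open>Linearity, decay and continuity of the extension\<close>

lemma integrable_ext:
  fixes f :: "real^'n \<Rightarrow> real"
  assumes "0 < s" "0 < y" and f: "integrable lborel f"
  shows "integrable lborel (\<lambda>\<xi>. ext_kernel s (x - \<xi>) y * f \<xi>)"
proof (rule Bochner_Integration.integrable_bound[where f = "\<lambda>\<xi>. y powr - real CARD('n) * f \<xi>"])
  show "integrable lborel (\<lambda>\<xi>. y powr - real CARD('n) * f \<xi>)" using f by simp
  show "(\<lambda>\<xi>. ext_kernel s (x - \<xi>) y * f \<xi>) \<in> borel_measurable lborel" using f by measurable
  show "AE \<xi> in lborel. norm (ext_kernel s (x - \<xi>) y * f \<xi>) \<le> norm (y powr - real CARD('n) * f \<xi>)"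
    using ext_kernel_le_height[OF assms(1,2)] by (intro AE_I2) (auto simp: abs_mult intro!: mult_right_mono)
qed

lemma ext_diff:
  assumes "0 < s" "0 < y" "integrable lborel f" "integrable lborel g"
  shows "ext s (\<lambda>x. f x - g x) x y = ext s f x y - ext s g x y"
  unfolding ext_def right_diff_distrib
  by (rule Bochner_Integration.integral_diff[OF integrable_ext[OF assms(1,2,3)] integrable_ext[OF assms(1,2,4)]])

lemma ext_nonneg: "(\<And>x. 0 \<le> f x) \<Longrightarrow> 0 \<le> ext s f x y"
  unfolding ext_def by (intro integral_nonneg_AE) auto

lemma ext_uminus: "ext s (\<lambda>x. - f x) x y = - ext s f x y"
  by (simp add: ext_def)

lemma abs_ext_le_height:
  fixes f :: "real^'n \<Rightarrow> real"
  assumes "0 < s" "0 < y" and f: "integrable lborel f"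
  shows "\<bar>ext s f x y\<bar> \<le> y powr - real CARD('n) * (\<integral>\<xi>. \<bar>f \<xi>\<bar> \<partial>lborel)"
proof -
  have "\<bar>ext s f x y\<bar> \<le> (\<integral>\<xi>. \<bar>ext_kernel s (x - \<xi>) y * f \<xi>\<bar> \<partial>lborel)"
    unfolding ext_def using integral_norm_bound[of lborel "\<lambda>\<xi>. ext_kernel s (x - \<xi>) y * f \<xi>"] by simp
  also have "\<dots> \<le> (\<integral>\<xi>. y powr - real CARD('n) * \<bar>f \<xi>\<bar> \<partial>lborel)"
    using integrable_abs[OF integrable_ext[OF assms]] f ext_kernel_le_height[OF assms(1,2)]
    by (intro integral_mono) (auto simp: abs_mult intro!: mult_right_mono)
  finally show ?thesis by simp
qed

text \<open>Horizontal decay for data of bounded support. With the vertical decay of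
  \<open>abs_ext_le_height\<close> it confines superlevel sets at heights bounded away from 0 to a
  bounded region.\<close>

lemma abs_ext_le_far:
  fixes f :: "real^'n \<Rightarrow> real"
  assumes s: "0 < s" and y: "0 < y" and f: "integrable lborel f" and M: "AE \<xi> in lborel. M < norm \<xi> \<longrightarrow> f \<xi> = 0" and x: "M + r \<le> norm x" and r: "0 < r"
  shows "\<bar>ext s f x y\<bar> \<le> y powr (2 * s) * r powr - (real CARD('n) + 2 * s) * (\<integral>\<xi>. \<bar>f \<xi>\<bar> \<partial>lborel)"
proof -
  have "\<bar>ext s f x y\<bar> \<le> (\<integral>\<xi>. \<bar>ext_kernel s (x - \<xi>) y * f \<xi>\<bar> \<partial>lborel)"
    unfolding ext_def using integral_norm_bound[of lborel "\<lambda>\<xi>. ext_kernel s (x - \<xi>) y * f \<xi>"] by simp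
  also have "\<dots> \<le> (\<integral>\<xi>. y powr (2 * s) * r powr - (real CARD('n) + 2 * s) * \<bar>f \<xi>\<bar> \<partial>lborel)"
  proof (rule integral_mono_AE)
    show "integrable lborel (\<lambda>\<xi>. \<bar>ext_kernel s (x - \<xi>) y * f \<xi>\<bar>)" using integrable_ext[OF s y f] by (rule integrable_abs)
    show "integrable lborel (\<lambda>\<xi>. y powr (2 * s) * r powr - (real CARD('n) + 2 * s) * \<bar>f \<xi>\<bar>)" using f by simp
    show "AE \<xi> in lborel. \<bar>ext_kernel s (x - \<xi>) y * f \<xi>\<bar> \<le> y powr (2 * s) * r powr - (real CARD('n) + 2 * s) * \<bar>f \<xi>\<bar>"
      using M
    proof eventually_elim
      case (elim \<xi>)
      show ?case
      proof (cases "M < norm \<xi>")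
        case False
        then have d: "r \<le> norm (x - \<xi>)" using x norm_triangle_ineq2[of x \<xi>] by linarith
        then have 0: "0 < norm (x - \<xi>)" using r by linarith
        have "frac_kernel s (x - \<xi>) \<le> r powr - (real CARD('n) + 2 * s)"
          unfolding frac_kernel_def powr_minus_divide using d r 0 s by (intro divide_left_mono powr_mono2 mult_pos_pos) auto
        then have "y powr (2 * s) * frac_kernel s (x - \<xi>) \<le> y powr (2 * s) * r powr - (real CARD('n) + 2 * s)"
          by (intro mult_left_mono) auto
        then have "ext_kernel s (x - \<xi>) y \<le> y powr (2 * s) * r powr - (real CARD('n) + 2 * s)"
          using ext_kernel_le_frac_kernel[OF s, of "x - \<xi>" y] 0 by auto
        then show ?thesis by (auto simp: abs_mult intro!: mult_right_mono)
      qed (use elim in simp)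
    qed
  qed
  finally show ?thesis by simp
qed

lemma continuous_on_ext:
  fixes f :: "real^'n \<Rightarrow> real"
  assumes s: "0 < s" and f: "integrable lborel f"
  shows "continuous_on {p. 0 < snd p} (\<lambda>p. ext s f (fst p) (snd p))"
proof -
  \<comment> \<open>The dominating function a^(-N) |f| requires heights above some a > 0; continuity
    being local, all such half spaces together suffice.\<close>
  have *: "continuous_on {p. a < snd p} (\<lambda>p. ext s f (fst p) (snd p))" if a: "0 < a" for a
    unfolding continuous_on_sequentially comp_def
  proof (intro allI ballI impI, elim conjE)
    fix x :: "nat \<Rightarrow> (real^'n) \<times> real" and p
    assume p: "p \<in> {p. a < snd p}" and xn: "\<forall>n. x n \<in> {p. a < snd p}" and lim: "x \<longlonglongrightarrow> p"
    show "(\<lambda>n. ext s f (fst (x n)) (snd (x n))) \<longlonglongrightarrow> ext s f (fst p) (snd p)"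
      unfolding ext_def
    proof (rule integral_dominated_convergence[where w = "\<lambda>\<xi>. a powr - real CARD('n) * \<bar>f \<xi>\<bar>"])
      show "integrable lborel (\<lambda>\<xi>. a powr - real CARD('n) * \<bar>f \<xi>\<bar>)" using f by simp
      show "AE \<xi> in lborel. (\<lambda>i. ext_kernel s (fst (x i) - \<xi>) (snd (x i)) * f \<xi>) \<longlonglongrightarrow> ext_kernel s (fst p - \<xi>) (snd p) * f \<xi>"
      proof (intro AE_I2)
        fix \<xi>
        have "(snd p)^2 + (norm (fst p - \<xi>))^2 \<noteq> 0" using p a by (simp add: add_pos_nonneg less_imp_neq[symmetric])
        then show "(\<lambda>i. ext_kernel s (fst (x i) - \<xi>) (snd (x i)) * f \<xi>) \<longlonglongrightarrow> ext_kernel s (fst p - \<xi>) (snd p) * f \<xi>"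
          unfolding ext_kernel_def using p a
          by (intro tendsto_intros lim) auto
      qed
      show "AE \<xi> in lborel. norm (ext_kernel s (fst (x i) - \<xi>) (snd (x i)) * f \<xi>) \<le> a powr - real CARD('n) * \<bar>f \<xi>\<bar>" for i
      proof (intro AE_I2)
        fix \<xi>
        have y: "a < snd (x i)" using xn by auto
        have "ext_kernel s (fst (x i) - \<xi>) (snd (x i)) \<le> snd (x i) powr - real CARD('n)"
          by (rule ext_kernel_le_height[OF s order.strict_trans[OF a y]])
        also have "\<dots> \<le> a powr - real CARD('n)" using a y by (intro powr_mono2') auto
        finally show "norm (ext_kernel s (fst (x i) - \<xi>) (snd (x i)) * f \<xi>) \<le> a powr - real CARD('n) * \<bar>f \<xi>\<bar>"
          by (auto simp: abs_mult intro!: mult_right_mono)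
      qed
    qed (use f in measurable)
  qed
  have op: "open {p::(real^'n) \<times> real. a < snd p}" for a
    by (intro open_Collect_less continuous_intros)
  show ?thesis
    unfolding continuous_on_eq_continuous_at[OF op]
  proof
    fix p :: "(real^'n) \<times> real" assume p: "p \<in> {p. 0 < snd p}"
    then have "0 < snd p / 2" by simp
    from *[OF this] p show "isCont (\<lambda>p. ext s f (fst p) (snd p)) p"
      unfolding continuous_on_eq_continuous_at[OF op] by (elim ballE[of _ _ p]) auto
  qed
qed

text \<open>The kernel has the same mass at every height, so a constant can be moved under the
  integral. With the constant u x only differences of \<open>u\<close> remain, which the Gagliardo
  density controls.\<close>

lemma ext_minus_const:
  fixes u :: "real^'n \<Rightarrow> real"
  assumes s: "0 < s" and y: "0 < y" and u: "integrable lborel u"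
  shows "ext s u x y - kernel_mass TYPE('n) s * a = (\<integral>\<xi>. ext_kernel s (x - \<xi>) y * (u \<xi> - a) \<partial>lborel)"
    and "integrable lborel (\<lambda>\<xi>. ext_kernel s (x - \<xi>) y)"
proof -
  have "(\<integral>\<^sup>+\<xi>. ennreal (ext_kernel s (x - \<xi>) y) \<partial>lborel) = ennreal (kernel_mass TYPE('n) s)"
    using kernel_mass(2)[OF s y, where 'n='n] nn_integral_reflect[of "\<lambda>z. ennreal (ext_kernel s z y)" x] by simp
  then have i: "has_bochner_integral lborel (\<lambda>\<xi>. ext_kernel s (x - \<xi>) y) (kernel_mass TYPE('n) s)"
    using kernel_mass(1)[OF s, where 'n='n] by (intro has_bochner_integral_nn_integral) auto
  then show "integrable lborel (\<lambda>\<xi>. ext_kernel s (x - \<xi>) y)" by (simp add: has_bochner_integral_iff)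
  then show "ext s u x y - kernel_mass TYPE('n) s * a = (\<integral>\<xi>. ext_kernel s (x - \<xi>) y * (u \<xi> - a) \<partial>lborel)"
    using i integrable_ext[OF s y u, of x] by (simp add: has_bochner_integral_iff right_diff_distrib ext_def)
qed

text \<open>Finiteness of the Gagliardo density at \<open>x\<close> replaces Lebesgue differentiation.\<close>

lemma ext_tendsto_trace:
  fixes u :: "real^'n \<Rightarrow> real"
  assumes s: "0 < s" and u: "integrable lborel u"
    and G: "(\<integral>\<^sup>+y. ennreal ((u x - u y)^2 * frac_kernel s (x - y)) \<partial>lborel) < \<infinity>"
  shows "((\<lambda>y. ext s u x y) \<longlongrightarrow> kernel_mass TYPE('n) s * u x) (at_right 0)"
proof -
  note [measurable] = borel_measurable_integrable[OF u]
  define g where "g = enn2real (\<integral>\<^sup>+y. ennreal ((u x - u y)^2 * frac_kernel s (x - y)) \<partial>lborel)"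
  let ?c = "kernel_mass TYPE('n) s"
  have bound: "\<bar>ext s u x y - ?c * u x\<bar> \<le> (?c + g) * y powr s" if y: "0 < y" for y
  proof -
    let ?t = "y powr s"
    have t: "0 < ?t" using y by simp
    have "\<bar>ext s u x y - ?c * u x\<bar> \<le> (\<integral>\<xi>. \<bar>ext_kernel s (x - \<xi>) y * (u \<xi> - u x)\<bar> \<partial>lborel)"
      unfolding ext_minus_const(1)[OF s y u] using integral_norm_bound[of lborel "\<lambda>\<xi>. ext_kernel s (x - \<xi>) y * (u \<xi> - u x)"] by simp
    also have "\<dots> = enn2real (\<integral>\<^sup>+\<xi>. ennreal (ext_kernel s (x - \<xi>) y * \<bar>u \<xi> - u x\<bar>) \<partial>lborel)"
      by (subst integral_eq_nn_integral) (auto simp: abs_mult)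
    also have "\<dots> \<le> (?c + g) * ?t"
    proof (rule enn2real_leI)
      have "(\<integral>\<^sup>+\<xi>. ennreal (ext_kernel s (x - \<xi>) y * \<bar>u \<xi> - u x\<bar>) \<partial>lborel)
        \<le> (\<integral>\<^sup>+\<xi>. (ennreal ?t * ennreal (ext_kernel s (x - \<xi>) y) + ennreal ?t * ennreal ((u x - u \<xi>)^2 * frac_kernel s (x - \<xi>))) \<partial>lborel)"
      proof (intro nn_integral_mono)
        fix \<xi>
        have "ext_kernel s (x - \<xi>) y * \<bar>u \<xi> - u x\<bar> \<le> ?t * ext_kernel s (x - \<xi>) y + ?t * ((u x - u \<xi>)^2 * frac_kernel s (x - \<xi>))"
        \<comment> \<open>Threshold y^s. Differences d below it are paid for by the kernel mass.
          Those above it satisfy |d| y^s \<le> d^2 and are paid for by the Gagliardo density; since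
          the kernel bound carries y^(2s), one factor y^s is left over.\<close>
        proof (cases "\<bar>u \<xi> - u x\<bar> \<le> ?t")
          case True
          then have "ext_kernel s (x - \<xi>) y * \<bar>u \<xi> - u x\<bar> \<le> ext_kernel s (x - \<xi>) y * ?t"
            by (intro mult_left_mono) auto
          then show ?thesis by (simp add: add_increasing2 mult.commute)
        next
          case False
          then have ne: "x - \<xi> \<noteq> 0" using t by auto
          have tt: "y powr (2 * s) = ?t * ?t" by (simp flip: powr_add)
          have "\<bar>u \<xi> - u x\<bar> * ?t \<le> \<bar>u \<xi> - u x\<bar> * \<bar>u \<xi> - u x\<bar>" using False by (intro mult_left_mono) auto
          also have "\<dots> = (u x - u \<xi>)^2" by (simp add: power2_eq_square algebra_simps flip: abs_mult)
          finally have le: "\<bar>u \<xi> - u x\<bar> * ?t \<le> (u x - u \<xi>)^2" .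
          have "ext_kernel s (x - \<xi>) y * \<bar>u \<xi> - u x\<bar> \<le> (?t * ?t * frac_kernel s (x - \<xi>)) * \<bar>u \<xi> - u x\<bar>"
            using ext_kernel_le_frac_kernel[OF s ne, of y] unfolding tt by (intro mult_right_mono) auto
          also have "\<dots> = (?t * frac_kernel s (x - \<xi>)) * (\<bar>u \<xi> - u x\<bar> * ?t)" by (simp only: mult_ac)
          also have "\<dots> \<le> (?t * frac_kernel s (x - \<xi>)) * (u x - u \<xi>)^2"
            using le t by (intro mult_left_mono) auto
          finally show ?thesis using t by (simp add: add_increasing mult_ac)
        qed
        then have "ennreal (ext_kernel s (x - \<xi>) y * \<bar>u \<xi> - u x\<bar>) \<le> ennreal (?t * ext_kernel s (x - \<xi>) y + ?t * ((u x - u \<xi>)^2 * frac_kernel s (x - \<xi>)))"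
          by (rule ennreal_leI)
        also have "\<dots> = ennreal ?t * ennreal (ext_kernel s (x - \<xi>) y) + ennreal ?t * ennreal ((u x - u \<xi>)^2 * frac_kernel s (x - \<xi>))"
          using t by (subst ennreal_plus) (auto intro!: arg_cong2[where f="(+)"] ennreal_mult)
        finally show "ennreal (ext_kernel s (x - \<xi>) y * \<bar>u \<xi> - u x\<bar>) \<le> ennreal ?t * ennreal (ext_kernel s (x - \<xi>) y) + ennreal ?t * ennreal ((u x - u \<xi>)^2 * frac_kernel s (x - \<xi>))" .
      qed
      also have "\<dots> = ennreal ?t * (\<integral>\<^sup>+\<xi>. ennreal (ext_kernel s (x - \<xi>) y) \<partial>lborel) + ennreal ?t * (\<integral>\<^sup>+\<xi>. ennreal ((u x - u \<xi>)^2 * frac_kernel s (x - \<xi>)) \<partial>lborel)"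
        by (subst nn_integral_add) (auto intro!: arg_cong2[where f="(+)"] nn_integral_cmult)
      also have "(\<integral>\<^sup>+\<xi>. ennreal (ext_kernel s (x - \<xi>) y) \<partial>lborel) = ennreal ?c"
        using kernel_mass(2)[OF s y, where 'n='n] nn_integral_reflect[of "\<lambda>z. ennreal (ext_kernel s z y)" x] by simp
      also have "(\<integral>\<^sup>+\<xi>. ennreal ((u x - u \<xi>)^2 * frac_kernel s (x - \<xi>)) \<partial>lborel) = ennreal g"
        unfolding g_def using G by (simp add: less_top)
      also have "ennreal ?t * ennreal ?c + ennreal ?t * ennreal g = ennreal ((?c + g) * ?t)"
      proof -
        have nn: "0 \<le> g" "0 \<le> ?c" "0 \<le> ?t" using kernel_mass(1)[OF s, where 'n='n] by (auto simp: g_def)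
        have "ennreal ?t * ennreal ?c + ennreal ?t * ennreal g = ennreal (?t * ?c) + ennreal (?t * g)"
          using nn by (simp only: ennreal_mult)
        also have "\<dots> = ennreal (?t * ?c + ?t * g)" using nn by (intro ennreal_plus[symmetric]) auto
        finally show ?thesis by (simp add: algebra_simps)
      qed
      finally show "(\<integral>\<^sup>+\<xi>. ennreal (ext_kernel s (x - \<xi>) y * \<bar>u \<xi> - u x\<bar>) \<partial>lborel) \<le> ennreal ((?c + g) * ?t)" .
    qed (use t kernel_mass(1)[OF s, where 'n='n] in \<open>simp add: g_def\<close>)
    finally show ?thesis .
  qed
  have "((\<lambda>y. (?c + g) * y powr s) \<longlongrightarrow> (?c + g) * 0 powr s) (at_right 0)"
    using s by (intro tendsto_intros tendsto_powr' ) (auto simp: eventually_at_filter)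
  then have lim: "((\<lambda>y. (?c + g) * y powr s) \<longlongrightarrow> 0) (at_right 0)" by simp
  have "((\<lambda>y. ext s u x y - ?c * u x) \<longlongrightarrow> 0) (at_right 0)"
    by (rule Lim_null_comparison[OF _ lim]) (use bound in \<open>auto simp: eventually_at_filter\<close>)
  then show ?thesis by (rule LIM_zero_cancel)
qed

section \<open>Discretised degenerate operator\<close>

text \<open>Central differences for the Laplacian in x plus the second y-derivative plus (1 - 2s)/y
  times the first. This is the expanded form of div(y^(1-2s) grad W) divided by y^(1-2s), the
  operator that annihilates extensions. In difference form it also applies to truncations and passes
  under integrals.\<close>

definition disc_op :: "real \<Rightarrow> real \<Rightarrow> (real^'n \<Rightarrow> real \<Rightarrow> real) \<Rightarrow> real^'n \<Rightarrow> real \<Rightarrow> real" where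
  "disc_op s h F x y = (\<Sum>i\<in>UNIV. F (x + axis i h) y + F (x - axis i h) y - 2 * F x y) / h^2 +
     (F x (y + h) + F x (y - h) - 2 * F x y) / h^2 + (1 - 2 * s) / (2 * h * y) * (F x (y + h) - F x (y - h))"

text \<open>Third order Taylor remainders at both points. After division by h^2 an error of order h
  is left, which is all the maximum principle asks for.\<close>

lemma symmetric_differences_bound:
  fixes f0 f1 f2 f3 :: "real \<Rightarrow> real"
  assumes h: "0 < h"
    and d: "\<And>t. \<bar>t - r\<bar> \<le> h \<Longrightarrow> DERIV f0 t :> f1 t" "\<And>t. \<bar>t - r\<bar> \<le> h \<Longrightarrow> DERIV f1 t :> f2 t" "\<And>t. \<bar>t - r\<bar> \<le> h \<Longrightarrow> DERIV f2 t :> f3 t"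
    and B: "\<And>t. \<bar>t - r\<bar> \<le> h \<Longrightarrow> \<bar>f3 t\<bar> \<le> B"
  shows "\<bar>f0 (r + h) + f0 (r - h) - 2 * f0 r - h^2 * f2 r\<bar> \<le> B * h^3"
    and "\<bar>f0 (r + h) - f0 (r - h) - 2 * h * f1 r\<bar> \<le> B * h^3"
proof -
  define diff where "diff m = (if m = 0 then f0 else if m = 1 then f1 else if m = 2 then f2 else f3)" for m :: nat
  have D: "\<forall>m t. m < 3 \<and> r - h \<le> t \<and> t \<le> r + h \<longrightarrow> DERIV (diff m) t :> diff (Suc m) t"
  proof (intro allI impI, elim conjE)
    fix m t assume "m < (3::nat)" "r - h \<le> t" "t \<le> r + h"
    then have "\<bar>t - r\<bar> \<le> h" and "m = 0 \<or> m = 1 \<or> m = 2" by auto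
    then show "DERIV (diff m) t :> diff (Suc m) t" using d by (auto simp: diff_def)
  qed
  have T: "\<exists>t. \<bar>t - r\<bar> \<le> h \<and> f0 x = f0 r + f1 r * (x - r) + f2 r * (x - r)^2 / 2 + f3 t / 6 * (x - r)^3"
    if x: "r - h \<le> x" "x \<le> r + h" "x \<noteq> r" for x
  proof -
    obtain t where t: "if x < r then x < t \<and> t < r else r < t \<and> t < x"
      "f0 x = (\<Sum>m<3. diff m r / fact m * (x - r)^m) + diff 3 t / fact 3 * (x - r)^3"
      using Taylor[of 3 diff f0 "r - h" "r + h" r x] D x h by (auto simp: diff_def)
    moreover have "\<bar>t - r\<bar> \<le> h" using t(1) x by (auto split: if_splits)
    ultimately show ?thesis
      by (intro exI[of _ t]) (simp add: diff_def eval_nat_numeral fact_numeral)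
  qed
  obtain t1 where t1: "\<bar>t1 - r\<bar> \<le> h" "f0 (r + h) = f0 r + f1 r * h + f2 r * h^2 / 2 + f3 t1 / 6 * h^3"
    using T[of "r + h"] h by auto
  obtain t2 where t2: "\<bar>t2 - r\<bar> \<le> h" "f0 (r - h) = f0 r - f1 r * h + f2 r * h^2 / 2 - f3 t2 / 6 * h^3"
    using T[of "r - h"] h by auto
  have b: "\<bar>f3 t1 * h^3\<bar> \<le> B * h^3" "\<bar>f3 t2 * h^3\<bar> \<le> B * h^3"
    using B[OF t1(1)] B[OF t2(1)] h by (auto simp: abs_mult intro!: mult_right_mono)
  have sixth: "\<bar>(x - y) / 6\<bar> \<le> z" if "\<bar>x\<bar> \<le> z" "\<bar>y\<bar> \<le> z" for x y z :: real
  proof -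
    have "\<bar>x - y\<bar> \<le> z + z" using that by (intro order_trans[OF abs_triangle_ineq4] add_mono)
    moreover have "0 \<le> z" using that(1) by (rule order_trans[OF abs_ge_zero])
    moreover have "\<bar>(x - y) / 6\<bar> = \<bar>x - y\<bar> / 6" by simp
    ultimately show ?thesis by simp
  qed
  have e1: "f0 (r + h) + f0 (r - h) - 2 * f0 r - h^2 * f2 r = (f3 t1 * h^3 - f3 t2 * h^3) / 6"
    unfolding t1(2) t2(2) by (simp add: field_simps)
  have e2: "f0 (r + h) - f0 (r - h) - 2 * h * f1 r = (f3 t1 * h^3 + f3 t2 * h^3) / 6"
    unfolding t1(2) t2(2) by (simp add: field_simps)
  show "\<bar>f0 (r + h) + f0 (r - h) - 2 * f0 r - h^2 * f2 r\<bar> \<le> B * h^3"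
    unfolding e1 using b by (rule sixth)
  show "\<bar>f0 (r + h) - f0 (r - h) - 2 * h * f1 r\<bar> \<le> B * h^3"
    unfolding e2 using b(1) sixth[of "f3 t1 * h^3" "B * h^3" "- (f3 t2 * h^3)"] b(2) by simp
qed

text \<open>\<open>riesz1\<close>, \<open>riesz2\<close>, \<open>riesz3\<close> are the derivatives of \<open>riesz0\<close>. Third order bounds make \<open>disc_op\<close> of the
  kernel \<open>O(h)\<close> uniformly.\<close>

definition riesz0 :: "real \<Rightarrow> real \<Rightarrow> real \<Rightarrow> real" where
  "riesz0 k B r = (B + r^2) powr - k"

definition riesz1 :: "real \<Rightarrow> real \<Rightarrow> real \<Rightarrow> real" where
  "riesz1 k B r = - 2 * k * r * riesz0 (k + 1) B r"

definition riesz2 :: "real \<Rightarrow> real \<Rightarrow> real \<Rightarrow> real" where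
  "riesz2 k B r = - 2 * k * riesz0 (k + 1) B r + 4 * k * (k + 1) * r^2 * riesz0 (k + 2) B r"

definition riesz3 :: "real \<Rightarrow> real \<Rightarrow> real \<Rightarrow> real" where
  "riesz3 k B r = 12 * k * (k + 1) * r * riesz0 (k + 2) B r - 8 * k * (k + 1) * (k + 2) * r^3 * riesz0 (k + 3) B r"

lemma riesz_deriv:
  assumes "0 < B + r^2"
  shows "DERIV (riesz0 k B) r :> riesz1 k B r" "DERIV (riesz1 k B) r :> riesz2 k B r" "DERIV (riesz2 k B) r :> riesz3 k B r"
proof -
  have d0: "DERIV (riesz0 j B) r :> - 2 * j * r * riesz0 (j + 1) B r" for j
  proof -
    have "DERIV (\<lambda>r. (B + r^2) powr - j) r :> - j * (B + r^2) powr (- j - 1) * (2 * r)"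
      using assms by (auto intro!: derivative_eq_intros simp: powr_diff field_simps)
    then show ?thesis by (simp add: riesz0_def[abs_def] mult_ac)
  qed
  show "DERIV (riesz0 k B) r :> riesz1 k B r" unfolding riesz1_def by (rule d0)
  have "DERIV (\<lambda>r. - 2 * k * r * riesz0 (k + 1) B r) r :> - 2 * k * riesz0 (k + 1) B r + - 2 * k * r * (- 2 * (k + 1) * r * riesz0 (k + 1 + 1) B r)"
    by (rule derivative_eq_intros d0 refl)+ simp
  then show "DERIV (riesz1 k B) r :> riesz2 k B r"
    by (simp add: riesz1_def[abs_def] riesz2_def power2_eq_square algebra_simps)
  have "DERIV (\<lambda>r. - 2 * k * riesz0 (k + 1) B r + 4 * k * (k + 1) * r^2 * riesz0 (k + 2) B r) r :>
      - 2 * k * (- 2 * (k + 1) * r * riesz0 (k + 1 + 1) B r) + (4 * k * (k + 1) * (2 * r) * riesz0 (k + 2) B r + 4 * k * (k + 1) * r^2 * (- 2 * (k + 2) * r * riesz0 (k + 2 + 1) B r))"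
    by (rule derivative_eq_intros d0 refl)+ simp
  then show "DERIV (riesz2 k B) r :> riesz3 k B r"
    by (simp add: riesz2_def[abs_def] riesz3_def power2_eq_square power3_eq_cube algebra_simps)
qed

text \<open>With Q = B + r^2 one has |r| \<le> Q^(1/2), so every term |r|^j Q^(-l) is a nonpositive
  power of Q and hence at most m^(-(k+3)), because m \<le> Q and m \<le> 1. The cube (k + 2)^3
  dominates all polynomial coefficients. The point is uniformity in \<open>B\<close> and
  \<open>r\<close>.\<close>

lemma riesz_bounds:
  assumes k: "0 \<le> k" and B: "0 \<le> B" and m: "0 < m" "m \<le> 1" "m \<le> B + r^2"
  defines "M \<equiv> 12 * (k + 2)^3 * m powr - (k + 3)"
  shows "\<bar>riesz0 k B r\<bar> \<le> M" "\<bar>riesz1 k B r\<bar> \<le> M" "\<bar>riesz2 k B r\<bar> \<le> 2 * M" "\<bar>riesz3 k B r\<bar> \<le> 2 * M"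
proof -
  define Q where "Q = B + r^2"
  have Q: "0 < Q" "m \<le> Q" using m by (auto simp: Q_def)
  define E where "E = m powr - (k + 3)"
  have E: "0 < E" using m by (simp add: E_def)
  have rQ: "\<bar>r\<bar> \<le> Q powr (1/2)"
  proof -
    have "\<bar>r\<bar> = sqrt (r^2)" by simp
    also have "\<dots> \<le> sqrt Q" unfolding Q_def using B by (intro real_sqrt_le_mono) simp
    finally show ?thesis using Q by (simp add: powr_half_sqrt)
  qed
  have key: "\<bar>r\<bar> ^ j * riesz0 l B r \<le> E" if "real j / 2 \<le> l" "l - real j / 2 \<le> k + 3" for j l
  proof -
    have "\<bar>r\<bar> ^ j * riesz0 l B r \<le> (Q powr (1/2)) ^ j * Q powr - l"
      unfolding riesz0_def Q_def[symmetric] using rQ by (intro mult_right_mono power_mono) auto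
    also have "\<dots> = Q powr (real j / 2 - l)"
      using Q by (simp add: powr_realpow[symmetric] powr_powr powr_add[symmetric])
    also have "\<dots> \<le> m powr (real j / 2 - l)" using Q m that by (intro powr_mono2') auto
    also have "\<dots> \<le> E" unfolding E_def using m that by (intro powr_mono') auto
    finally show ?thesis .
  qed
  have nn: "0 \<le> riesz0 l B r" for l by (simp add: riesz0_def)
  define K where "K = (k + 2)^3"
  have K: "1 \<le> K" "k \<le> K" "k * (k + 1) \<le> K" "k * (k + 1) * (k + 2) \<le> K"
  proof -
    show "1 \<le> K" unfolding K_def using k by (intro one_le_power) auto
    have "k * 1 * 1 \<le> (k + 2) * (k + 2) * (k + 2)" using k by (intro mult_mono) auto
    then show "k \<le> K" by (simp add: K_def power3_eq_cube)
    have "k * (k + 1) * 1 \<le> (k + 2) * (k + 2) * (k + 2)" using k by (intro mult_mono) auto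
    then show "k * (k + 1) \<le> K" by (simp add: K_def power3_eq_cube)
    have "k * (k + 1) * (k + 2) \<le> (k + 2) * (k + 2) * (k + 2)" using k by (intro mult_mono) auto
    then show "k * (k + 1) * (k + 2) \<le> K" by (simp add: K_def power3_eq_cube)
  qed
  have M: "M = 12 * (K * E)" by (simp add: M_def K_def E_def)
  have KE: "0 \<le> K * E" using K E by simp
  have b: "c * (\<bar>r\<bar> ^ j * riesz0 l B r) \<le> K * E" if "0 \<le> c" "c \<le> K" "real j / 2 \<le> l" "l - real j / 2 \<le> k + 3" for c j l
    using that key[of j l] nn[of l] K by (intro mult_mono) auto
  show "\<bar>riesz0 k B r\<bar> \<le> M"
    using b[of 1 0 k] K k KE nn[of k] by (simp add: M)
  show "\<bar>riesz1 k B r\<bar> \<le> M"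
  proof -
    have "\<bar>riesz1 k B r\<bar> = 2 * (k * (\<bar>r\<bar> ^ 1 * riesz0 (k + 1) B r))"
      using k nn[of "k + 1"] by (simp add: riesz1_def abs_mult mult_ac)
    moreover have "k * (\<bar>r\<bar> ^ 1 * riesz0 (k + 1) B r) \<le> K * E" by (rule b) (use k K in auto)
    ultimately show ?thesis unfolding M using KE by linarith
  qed
  show "\<bar>riesz2 k B r\<bar> \<le> 2 * M"
  proof -
    have "\<bar>riesz2 k B r\<bar> \<le> 2 * (k * (\<bar>r\<bar> ^ 0 * riesz0 (k + 1) B r)) + 4 * (k * (k + 1) * (\<bar>r\<bar> ^ 2 * riesz0 (k + 2) B r))"
    proof -
      have "\<bar>k\<bar> = k" "\<bar>k + 1\<bar> = k + 1" using k by auto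
      then have "\<bar>- 2 * k * riesz0 (k + 1) B r\<bar> = 2 * (k * (\<bar>r\<bar> ^ 0 * riesz0 (k + 1) B r))"
        "\<bar>4 * k * (k + 1) * r^2 * riesz0 (k + 2) B r\<bar> = 4 * (k * (k + 1) * (\<bar>r\<bar> ^ 2 * riesz0 (k + 2) B r))"
        using nn[of "k + 1"] nn[of "k + 2"] by (simp_all only: abs_mult abs_numeral abs_neg_numeral abs_of_nonneg power_abs abs_power2 power_0 mult_1 mult.assoc)
      then show ?thesis unfolding riesz2_def by (metis abs_triangle_ineq)
    qed
    then show ?thesis using b[of k 0 "k + 1"] b[of "k * (k + 1)" 2 "k + 2"] K k KE by (simp add: M)
  qed
  show "\<bar>riesz3 k B r\<bar> \<le> 2 * M"
  proof -
    have "\<bar>riesz3 k B r\<bar> \<le> 12 * (k * (k + 1) * (\<bar>r\<bar> ^ 1 * riesz0 (k + 2) B r)) + 8 * (k * (k + 1) * (k + 2) * (\<bar>r\<bar> ^ 3 * riesz0 (k + 3) B r))"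
    proof -
      have "\<bar>k\<bar> = k" "\<bar>k + 1\<bar> = k + 1" "\<bar>k + 2\<bar> = k + 2" using k by auto
      then have "\<bar>12 * k * (k + 1) * r * riesz0 (k + 2) B r\<bar> = 12 * (k * (k + 1) * (\<bar>r\<bar> ^ 1 * riesz0 (k + 2) B r))"
        "\<bar>8 * k * (k + 1) * (k + 2) * r^3 * riesz0 (k + 3) B r\<bar> = 8 * (k * (k + 1) * (k + 2) * (\<bar>r\<bar> ^ 3 * riesz0 (k + 3) B r))"
        using nn[of "k + 2"] nn[of "k + 3"] by (simp_all only: abs_mult abs_numeral abs_of_nonneg power_abs power_one_right mult.assoc)
      then show ?thesis unfolding riesz3_def by (metis abs_triangle_ineq4)
    qed
    then show ?thesis using b[of "k * (k + 1)" 1 "k + 2"] b[of "k * (k + 1) * (k + 2)" 3 "k + 3"] K k KE by (simp add: M)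
  qed
qed

lemma powr_bounds:
  fixes r :: real
  assumes "0 < a" "a \<le> r" "r \<le> b"
  shows "r powr q \<le> a powr q + b powr q"
proof (cases "0 \<le> q")
  case True
  then have "r powr q \<le> b powr q" using assms by (intro powr_mono2) auto
  then show ?thesis by (simp add: add_increasing)
next
  case False
  then have "r powr q \<le> a powr q" using assms by (intro powr_mono2') auto
  then show ?thesis by (simp add: add_increasing2)
qed

text \<open>The kernel along a vertical line, \<open>B\<close> being the squared horizontal
  distance. The third derivative is quantified existentially because only its bound, uniform in
  \<open>B\<close>, is of interest.\<close>

lemma vertical_profile:
  fixes k a b q :: real
  assumes k: "0 \<le> k" and a: "0 < a"
  defines "d1 \<equiv> \<lambda>B r. q * r powr (q - 1) * riesz0 k B r + r powr q * riesz1 k B r"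
    and "d2 \<equiv> \<lambda>B r. q * (q - 1) * r powr (q - 2) * riesz0 k B r + 2 * q * r powr (q - 1) * riesz1 k B r + r powr q * riesz2 k B r"
  shows "\<exists>d3 C. \<forall>B r. 0 \<le> B \<and> a \<le> r \<and> r \<le> b \<longrightarrow>
     DERIV (\<lambda>r. r powr q * riesz0 k B r) r :> d1 B r \<and> DERIV (d1 B) r :> d2 B r \<and> DERIV (d2 B) r :> d3 B r \<and> \<bar>d3 B r\<bar> \<le> (C :: real)"
proof -
  define d3 where "d3 B r = q * (q - 1) * (q - 2) * r powr (q - 3) * riesz0 k B r + 3 * (q * (q - 1)) * r powr (q - 2) * riesz1 k B r
     + 3 * q * r powr (q - 1) * riesz2 k B r + r powr q * riesz3 k B r" for B r
  define m where "m = min 1 (a^2)"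
  define M where "M = 12 * (k + 2)^3 * m powr - (k + 3)"
  define R where "R j = a powr (q - j) + b powr (q - j)" for j
  define C where "C = \<bar>q * (q - 1) * (q - 2)\<bar> * R 3 * M + \<bar>3 * (q * (q - 1))\<bar> * R 2 * M + \<bar>3 * q\<bar> * R 1 * (2 * M) + 1 * R 0 * (2 * M)"
  have "DERIV (\<lambda>r. r powr q * riesz0 k B r) r :> d1 B r \<and> DERIV (d1 B) r :> d2 B r \<and> DERIV (d2 B) r :> d3 B r \<and> \<bar>d3 B r\<bar> \<le> C"
    if B: "0 \<le> B" and r: "a \<le> r" "r \<le> b" for B r
  proof -
    have r0: "0 < r" using a r by simp
    have "a^2 \<le> r^2" using a r by (intro power_mono) auto
    then have m: "0 < m" "m \<le> 1" "m \<le> B + r^2" using a B by (auto simp: m_def)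
    note D = riesz_deriv[of B r k]
    have Q: "0 < B + r^2" using m by simp
    note D = D[OF Q]
    have P: "DERIV (\<lambda>r. r powr j) r :> j * r powr (j - 1)" for j
      using r0 by (auto intro!: derivative_eq_intros)
    have "DERIV (\<lambda>r. r powr q * riesz0 k B r) r :> d1 B r"
      unfolding d1_def by (rule derivative_eq_intros P D refl)+ simp
    moreover have "DERIV (d1 B) r :> d2 B r"
      unfolding d1_def d2_def by (rule derivative_eq_intros P D refl)+ (simp add: algebra_simps)
    moreover have "DERIV (d2 B) r :> d3 B r"
      unfolding d2_def d3_def by (rule derivative_eq_intros P D refl)+ (simp add: algebra_simps)
    moreover have "\<bar>d3 B r\<bar> \<le> C"
    proof -
      note bd = riesz_bounds[OF k B m, folded M_def]
      have M0: "0 \<le> M" using bd(1) by linarith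
      have R: "r powr (q - j) \<le> R j" for j unfolding R_def using a r by (intro powr_bounds) auto
      have t: "\<bar>c * r powr (q - j) * g\<bar> \<le> \<bar>c\<bar> * R j * G" if "\<bar>g\<bar> \<le> G" for c j g G
        using R[of j] that by (auto simp: abs_mult R_def intro!: mult_mono)
      have "\<bar>d3 B r\<bar> \<le> \<bar>q * (q - 1) * (q - 2) * r powr (q - 3) * riesz0 k B r\<bar> + \<bar>3 * (q * (q - 1)) * r powr (q - 2) * riesz1 k B r\<bar>
         + \<bar>3 * q * r powr (q - 1) * riesz2 k B r\<bar> + \<bar>1 * r powr (q - 0) * riesz3 k B r\<bar>"
        unfolding d3_def by simp
      also have "\<dots> \<le> C" unfolding C_def
        using t[OF bd(1), of "q * (q - 1) * (q - 2)" 3] t[OF bd(2), of "3 * (q * (q - 1))" 2] t[OF bd(3), of "3 * q" 1] t[OF bd(4), of 1 0]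
        by (simp only: abs_one)
      finally show ?thesis .
    qed
    ultimately show ?thesis by blast
  qed
  then show ?thesis by blast
qed


lemma norm_add_axis_sq:
  fixes z :: "real^'n"
  shows "(norm (z + axis i h))^2 = (norm z)^2 - (z $ i)^2 + (z $ i + h)^2"
  unfolding power2_norm_eq_inner
  by (simp add: inner_add_left inner_add_right inner_axis inner_axis' power2_eq_square algebra_simps)

lemma axis_uminus: "axis i (- h) = - axis i (h :: real)"
  by (simp add: vec_eq_iff axis_def)

lemma sum_components_sq: "(\<Sum>i\<in>UNIV. (z $ i)^2) = (norm (z::real^'n))^2"
  unfolding power2_norm_eq_inner by (simp add: inner_vec_def power2_eq_square)

lemma ext_kernel_eq_riesz:
  fixes z :: "real^'n"
  assumes "B + r^2 = y^2 + (norm z)^2"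
  shows "ext_kernel s z y = y powr (2 * s) * riesz0 ((real CARD('n) + 2 * s) / 2) B r"
  unfolding ext_kernel_def riesz0_def assms by (simp add: powr_minus_divide)

text \<open>With all coordinates but one frozen, each difference is a difference of a one-variable
  function, which Taylor expansion replaces by derivatives. These sum to zero since the kernel
  solves the equation exactly. The constant must not depend on z, because z is integrated over
  later.\<close>

lemma disc_op_ext_kernel:
  assumes s: "0 < s" "s < 1" and ab: "0 < a" "a \<le> b"
  shows "\<exists>C\<ge>0. \<forall>h y. \<forall>z::real^'n. 0 < h \<and> h \<le> a / 2 \<and> a \<le> y \<and> y \<le> b \<longrightarrow> \<bar>disc_op s h (ext_kernel s) z y\<bar> \<le> C * h"
proof -
  define N where "N = real CARD('n)"
  define k where "k = (N + 2 * s) / 2"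
  have k: "0 \<le> k" using s by (simp add: k_def N_def)
  define m where "m = min 1 (a^2)"
  define M where "M = 2 * (12 * (k + 2)^3 * m powr - (k + 3))"
  define Yb where "Yb = a powr (2 * s) + b powr (2 * s)"
  define d1 where "d1 B r = 2 * s * r powr (2 * s - 1) * riesz0 k B r + r powr (2 * s) * riesz1 k B r" for B r
  define d2 where "d2 B r = 2 * s * (2 * s - 1) * r powr (2 * s - 2) * riesz0 k B r + 2 * (2 * s) * r powr (2 * s - 1) * riesz1 k B r + r powr (2 * s) * riesz2 k B r" for B r
  have a2: "0 < a / 2" using ab by simp
  from vertical_profile[OF k a2, where q="2 * s" and b="b + a / 2", folded d1_def d2_def]
  obtain d3 C2 where prof: "\<And>B r. 0 \<le> B \<Longrightarrow> a / 2 \<le> r \<Longrightarrow> r \<le> b + a / 2 \<Longrightarrow>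
     DERIV (\<lambda>r. r powr (2 * s) * riesz0 k B r) r :> d1 B r \<and> DERIV (d1 B) r :> d2 B r \<and> DERIV (d2 B) r :> d3 B r \<and> \<bar>d3 B r\<bar> \<le> C2"
    by blast
  have C2: "0 \<le> C2" using prof[of 0 a] ab abs_ge_zero[of "d3 0 a"] by auto
  have M0: "0 \<le> M" using k by (simp add: M_def)
  define C where "C = N * (Yb * M) + 2 * C2"
  have "\<bar>disc_op s h (ext_kernel s) z y\<bar> \<le> C * h"
    if h: "0 < h" "h \<le> a / 2" and y: "a \<le> y" "y \<le> b" for h y and z :: "real^'n"
  proof -
    have y0: "0 < y" using ab y by simp
    define Y where "Y = y powr (2 * s)"
    have Y: "0 < Y" "Y \<le> Yb" using y0 ab y powr_bounds[of a y b "2 * s"] by (auto simp: Y_def Yb_def)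
    define \<rho> where "\<rho> = y^2 + (norm z)^2"
    have \<rho>: "0 < \<rho>" using y0 by (simp add: \<rho>_def add_pos_nonneg)
    \<comment> \<open>The part of y^2 + |z|^2 that does not involve the i-th coordinate; it is at
      least a^2, which keeps the kernel away from its singularity.\<close>
    define Bi where "Bi i = \<rho> - (z $ i)^2" for i
    have zi: "(z $ i)^2 \<le> (norm z)^2" for i
      using component_le_norm_cart[of z i] abs_le_square_iff[of "z $ i" "norm z"] by simp
    have ay: "a^2 \<le> y^2" using ab y by (intro power_mono) auto
    have Bi: "a^2 \<le> Bi i" for i using zi[of i] ay by (simp add: Bi_def \<rho>_def)
    have Bi0: "0 \<le> Bi i" for i using Bi[of i] zero_le_power2[of a] by linarith
    have m: "0 < m" "m \<le> 1" "m \<le> Bi i + t^2" for i t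
    proof -
      have "m \<le> a^2" by (simp add: m_def)
      then show "m \<le> Bi i + t^2" using Bi[of i] zero_le_power2[of t] by linarith
    qed (use ab in \<open>auto simp: m_def\<close>)
    define S where "S i = ext_kernel s (z + axis i h) y + ext_kernel s (z - axis i h) y - 2 * ext_kernel s z y" for i
    have e: "ext_kernel s (z + axis i t) y = Y * riesz0 k (Bi i) (z $ i + t)" for i t
      unfolding Y_def k_def N_def by (rule ext_kernel_eq_riesz) (simp add: Bi_def \<rho>_def norm_add_axis_sq)
    have S: "S i = Y * (riesz0 k (Bi i) (z $ i + h) + riesz0 k (Bi i) (z $ i - h) - 2 * riesz0 k (Bi i) (z $ i))" for i
    proof -
      have "ext_kernel s (z - axis i h) y = Y * riesz0 k (Bi i) (z $ i - h)"
        using e[of i "- h"] by (simp add: axis_uminus)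
      moreover have "ext_kernel s z y = Y * riesz0 k (Bi i) (z $ i)"
        using e[of i 0] by (simp add: axis_def vec_eq_iff zero_vec_def[symmetric])
      ultimately show ?thesis unfolding S_def e by (simp add: algebra_simps)
    qed
    have Sx: "\<bar>S i / h^2 - Y * riesz2 k (Bi i) (z $ i)\<bar> \<le> Yb * M * h" for i
    proof -
      have Q: "0 < Bi i + t^2" for t using m(1) m(3)[of i t] by linarith
      have "\<bar>riesz0 k (Bi i) (z $ i + h) + riesz0 k (Bi i) (z $ i - h) - 2 * riesz0 k (Bi i) (z $ i) - h^2 * riesz2 k (Bi i) (z $ i)\<bar> \<le> M * h^3"
        using riesz_bounds(4)[OF k Bi0 m, folded M_def] riesz_deriv[OF Q] h
        by (intro symmetric_differences_bound(1)) (auto simp: M_def)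
      then have "Y * \<bar>riesz0 k (Bi i) (z $ i + h) + riesz0 k (Bi i) (z $ i - h) - 2 * riesz0 k (Bi i) (z $ i) - h^2 * riesz2 k (Bi i) (z $ i)\<bar> \<le> Yb * (M * h^3)"
        using Y M0 h by (intro mult_mono) auto
      moreover have "Y * \<bar>riesz0 k (Bi i) (z $ i + h) + riesz0 k (Bi i) (z $ i - h) - 2 * riesz0 k (Bi i) (z $ i) - h^2 * riesz2 k (Bi i) (z $ i)\<bar>
          = \<bar>S i / h^2 - Y * riesz2 k (Bi i) (z $ i)\<bar> * h^2"
      proof -
        have "(S i / h^2 - Y * riesz2 k (Bi i) (z $ i)) * h^2 = Y * (riesz0 k (Bi i) (z $ i + h) + riesz0 k (Bi i) (z $ i - h) - 2 * riesz0 k (Bi i) (z $ i) - h^2 * riesz2 k (Bi i) (z $ i))"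
        proof -
          have "(S i / h^2 - Y * riesz2 k (Bi i) (z $ i)) * h^2 = S i - Y * riesz2 k (Bi i) (z $ i) * h^2"
            using h by (simp add: left_diff_distrib)
          then show ?thesis unfolding S by (simp add: algebra_simps)
        qed
        then show ?thesis using Y by (metis abs_mult abs_of_pos abs_power2)
      qed
      ultimately have "\<bar>S i / h^2 - Y * riesz2 k (Bi i) (z $ i)\<bar> * h^2 \<le> (Yb * M * h) * h^2"
        by (simp add: power3_eq_cube power2_eq_square mult_ac)
      then show ?thesis using h by simp
    qed
    define B where "B = (norm z)^2"
    have ev: "ext_kernel s z t = t powr (2 * s) * riesz0 k B t" for t
      unfolding k_def N_def by (rule ext_kernel_eq_riesz) (simp add: B_def)
    have pr: "DERIV (\<lambda>r. r powr (2 * s) * riesz0 k B r) t :> d1 B t" "DERIV (d1 B) t :> d2 B t" "DERIV (d2 B) t :> d3 B t" "\<bar>d3 B t\<bar> \<le> C2"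
      if "\<bar>t - y\<bar> \<le> h" for t
      using prof[of B t] that h y by (auto simp: B_def abs_if split: if_splits)
    define T where "T = ext_kernel s z (y + h) + ext_kernel s z (y - h) - 2 * ext_kernel s z y"
    define U where "U = ext_kernel s z (y + h) - ext_kernel s z (y - h)"
    have T: "\<bar>T / h^2 - d2 B y\<bar> \<le> C2 * h"
    proof -
      have "\<bar>T - h^2 * d2 B y\<bar> \<le> C2 * h^3"
        unfolding T_def ev by (rule symmetric_differences_bound(1)[OF h(1) pr(1-4)])
      moreover have "\<bar>T - h^2 * d2 B y\<bar> = \<bar>T / h^2 - d2 B y\<bar> * h^2"
      proof -
        have "(T / h^2 - d2 B y) * h^2 = T - h^2 * d2 B y" using h by (simp add: left_diff_distrib)
        then show ?thesis by (metis abs_mult abs_power2)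
      qed
      ultimately have "\<bar>T / h^2 - d2 B y\<bar> * h^2 \<le> (C2 * h) * h^2"
        by (simp add: power3_eq_cube power2_eq_square mult_ac)
      then show ?thesis using h by simp
    qed
    have U: "\<bar>(1 - 2 * s) / (2 * h * y) * U - (1 - 2 * s) / y * d1 B y\<bar> \<le> C2 * h"
    proof -
      have "\<bar>U - 2 * h * d1 B y\<bar> \<le> C2 * h^3"
        unfolding U_def ev by (rule symmetric_differences_bound(2)[OF h(1) pr(1-4)])
      then have "\<bar>(1 - 2 * s) / (2 * h * y)\<bar> * \<bar>U - 2 * h * d1 B y\<bar> \<le> (1 / (2 * h * y)) * (C2 * h^3)"
        using s h y0 C2 by (intro mult_mono) (auto simp: divide_simps)
      also have "\<dots> = C2 * h * (h / (2 * y))"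
        using h by (simp add: power3_eq_cube)
      also have "\<dots> \<le> C2 * h * 1" using h y ab C2 by (intro mult_left_mono) (auto simp: divide_simps)
      finally have "\<bar>(1 - 2 * s) / (2 * h * y) * (U - 2 * h * d1 B y)\<bar> \<le> C2 * h"
        by (simp only: abs_mult mult_1_right)
      moreover have "(1 - 2 * s) / (2 * h * y) * (U - 2 * h * d1 B y) = (1 - 2 * s) / (2 * h * y) * U - (1 - 2 * s) / y * d1 B y"
        using h y0 by (simp add: right_diff_distrib)
      ultimately show ?thesis by (simp only:)
    qed
    \<comment> \<open>The differential equation for the kernel. After \<rho> R(2) = R(1) everything
      is a multiple of 2k - N - 2s, which vanishes by the choice of \<open>k\<close>.\<close>
    have harm: "(\<Sum>i\<in>UNIV. Y * riesz2 k (Bi i) (z $ i)) + d2 B y + (1 - 2 * s) / y * d1 B y = 0"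
    proof -
      define R where "R j = \<rho> powr - (k + j)" for j
      have rz: "riesz0 (k + j) (Bi i) (z $ i) = R j" "riesz0 (k + j) B y = R j" for i j
        by (simp_all add: riesz0_def R_def Bi_def B_def \<rho>_def add.commute)
      have rz0: "riesz0 k B y = R 0" using rz(2)[of 0] by simp
      have R1: "R 1 = \<rho> * R 2"
      proof -
        have "\<rho> powr (1 + - (k + 2)) = \<rho> powr 1 * \<rho> powr - (k + 2)" by (rule powr_add)
        moreover have "1 + - (k + 2) = - (k + 1)" by simp
        ultimately show ?thesis using \<rho> by (simp only: R_def powr_one)
      qed
      have p1: "y powr (2 * s - 1) = Y / y" using y0 by (simp add: powr_diff Y_def)
      have p2: "y powr (2 * s - 2) = Y / y^2" using y0 by (simp add: powr_diff Y_def)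
      have "(\<Sum>i\<in>UNIV. Y * riesz2 k (Bi i) (z $ i)) = (\<Sum>i\<in>UNIV. - 2 * k * Y * R 1 + 4 * k * (k + 1) * Y * R 2 * (z $ i)^2)"
        unfolding riesz2_def rz by (simp add: algebra_simps)
      also have "\<dots> = - 2 * k * Y * R 1 * N + 4 * k * (k + 1) * Y * R 2 * (norm z)^2"
        unfolding sum.distrib sum_distrib_left[symmetric] sum_components_sq by (simp add: N_def)
      finally have X: "(\<Sum>i\<in>UNIV. Y * riesz2 k (Bi i) (z $ i)) = - 2 * k * Y * R 1 * N + 4 * k * (k + 1) * Y * R 2 * (\<rho> - y^2)"
        by (simp add: \<rho>_def)
      have D1: "d1 B y = 2 * s * (Y / y) * R 0 + Y * (- 2 * k * y * R 1)"
        unfolding d1_def riesz1_def rz rz0 p1 Y_def[symmetric] by simp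
      have D2: "d2 B y = 2 * s * (2 * s - 1) * (Y / y^2) * R 0 + 4 * s * (Y / y) * (- 2 * k * y * R 1) + Y * (- 2 * k * R 1 + 4 * k * (k + 1) * y^2 * R 2)"
        unfolding d2_def riesz1_def riesz2_def rz rz0 p1 p2 Y_def[symmetric] by simp
      have 1: "(1 - 2 * s) / y * d1 B y = (1 - 2 * s) * 2 * s * (Y / y^2) * R 0 - (1 - 2 * s) * 2 * k * Y * R 1"
        unfolding D1 using y0 by (simp add: field_simps power2_eq_square)
      have 2: "d2 B y = - (1 - 2 * s) * 2 * s * (Y / y^2) * R 0 - 8 * s * k * Y * R 1 - 2 * k * Y * R 1 + 4 * k * (k + 1) * Y * y^2 * R 2"
        unfolding D2 using y0 by (simp add: field_simps power2_eq_square)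
      have "(\<Sum>i\<in>UNIV. Y * riesz2 k (Bi i) (z $ i)) + d2 B y + (1 - 2 * s) / y * d1 B y
         = 2 * k * Y * (2 * (k + 1) * (\<rho> * R 2) - (N + 2 * s + 2) * R 1)"
        unfolding X 1 2 by (simp add: algebra_simps)
      also have "\<dots> = 2 * k * Y * R 1 * (2 * k - N - 2 * s)"
        unfolding R1[symmetric] by (simp add: algebra_simps)
      also have "\<dots> = 0" by (simp add: k_def field_simps)
      finally show ?thesis .
    qed
    have "\<bar>(\<Sum>i\<in>UNIV. S i / h^2) - (\<Sum>i\<in>UNIV. Y * riesz2 k (Bi i) (z $ i))\<bar> \<le> (\<Sum>i\<in>(UNIV::'n set). Yb * M * h)"
      unfolding sum_subtractf[symmetric] using Sx by (intro order_trans[OF sum_abs] sum_mono) auto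
    also have "\<dots> = N * (Yb * M) * h" by (simp add: N_def)
    finally have X: "\<bar>(\<Sum>i\<in>UNIV. S i / h^2) - (\<Sum>i\<in>UNIV. Y * riesz2 k (Bi i) (z $ i))\<bar> \<le> N * (Yb * M) * h" .
    have "disc_op s h (ext_kernel s) z y = (\<Sum>i\<in>UNIV. S i / h^2) + T / h^2 + (1 - 2 * s) / (2 * h * y) * U"
      by (simp add: disc_op_def S_def T_def U_def sum_divide_distrib)
    also have "\<bar>\<dots>\<bar> \<le> N * (Yb * M) * h + C2 * h + C2 * h"
    proof -
      have "\<bar>A + B + E\<bar> \<le> p + q + r" if "\<bar>A - a\<bar> \<le> p" "\<bar>B - b\<bar> \<le> q" "\<bar>E - e\<bar> \<le> r" "a + b + e = 0"
        for A B E a b e p q r :: real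
      proof -
        have "A + B + E = (A - a) + (B - b) + (E - e)" using that(4) by simp
        then show ?thesis using that(1-3) by (metis abs_triangle_ineq add_mono order_trans)
      qed
      from this[OF X T U harm] show ?thesis .
    qed
    finally show ?thesis by (simp add: C_def distrib_right)
  qed
  moreover have "0 \<le> C" using C2 M0 by (simp add: C_def N_def Yb_def)
  ultimately show ?thesis by blast
qed

text \<open>A difference operator is a finite combination of values, so it passes under the integral
  sign without any differentiability of the extension.\<close>

lemma disc_op_ext:
  fixes f :: "real^'n \<Rightarrow> real"
  assumes s: "0 < s" "s < 1" and ab: "0 < a" "a \<le> b" and f: "integrable lborel f"
  shows "\<exists>C\<ge>0. \<forall>h y x. 0 < h \<and> h \<le> a / 2 \<and> a \<le> y \<and> y \<le> b \<longrightarrow> \<bar>disc_op s h (ext s f) x y\<bar> \<le> C * h"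
proof -
  obtain C where C: "0 \<le> C" "\<And>h y z. 0 < h \<Longrightarrow> h \<le> a / 2 \<Longrightarrow> a \<le> y \<Longrightarrow> y \<le> b \<Longrightarrow> \<bar>disc_op s h (ext_kernel s) (z::real^'n) y\<bar> \<le> C * h"
    using disc_op_ext_kernel[OF s ab] by blast
  define L where "L = (\<integral>\<xi>. \<bar>f \<xi>\<bar> \<partial>lborel)"
  have "\<bar>disc_op s h (ext s f) x y\<bar> \<le> C * L * h" if h: "0 < h" "h \<le> a / 2" and y: "a \<le> y" "y \<le> b" for h y x
  proof -
    have pos: "0 < y" "0 < y + h" "0 < y - h" using h y ab by auto
    note i = integrable_ext[OF s(1) pos(1) f] integrable_ext[OF s(1) pos(2) f] integrable_ext[OF s(1) pos(3) f]
    have sh: "x + axis j h - \<xi> = x - \<xi> + axis j h" "x - axis j h - \<xi> = x - \<xi> - axis j h" for j \<xi> by simp_all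
    have "has_bochner_integral lborel (\<lambda>\<xi>. (\<Sum>j\<in>UNIV. ext_kernel s (x + axis j h - \<xi>) y * f \<xi> + ext_kernel s (x - axis j h - \<xi>) y * f \<xi> - 2 * (ext_kernel s (x - \<xi>) y * f \<xi>)) / h^2 +
       (ext_kernel s (x - \<xi>) (y + h) * f \<xi> + ext_kernel s (x - \<xi>) (y - h) * f \<xi> - 2 * (ext_kernel s (x - \<xi>) y * f \<xi>)) / h^2 +
       (1 - 2 * s) / (2 * h * y) * (ext_kernel s (x - \<xi>) (y + h) * f \<xi> - ext_kernel s (x - \<xi>) (y - h) * f \<xi>)) (disc_op s h (ext s f) x y)"
      unfolding disc_op_def ext_def
      by (intro has_bochner_integral_add has_bochner_integral_diff has_bochner_integral_divide_zero has_bochner_integral_sum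
          has_bochner_integral_mult_right has_bochner_integral_integrable i)
    moreover have "(\<lambda>\<xi>. (\<Sum>j\<in>UNIV. ext_kernel s (x + axis j h - \<xi>) y * f \<xi> + ext_kernel s (x - axis j h - \<xi>) y * f \<xi> - 2 * (ext_kernel s (x - \<xi>) y * f \<xi>)) / h^2 +
       (ext_kernel s (x - \<xi>) (y + h) * f \<xi> + ext_kernel s (x - \<xi>) (y - h) * f \<xi> - 2 * (ext_kernel s (x - \<xi>) y * f \<xi>)) / h^2 +
       (1 - 2 * s) / (2 * h * y) * (ext_kernel s (x - \<xi>) (y + h) * f \<xi> - ext_kernel s (x - \<xi>) (y - h) * f \<xi>))
       = (\<lambda>\<xi>. disc_op s h (ext_kernel s) (x - \<xi>) y * f \<xi>)"
      unfolding disc_op_def sh by (simp add: distrib_right left_diff_distrib sum_distrib_right mult.assoc)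
    ultimately have hb: "has_bochner_integral lborel (\<lambda>\<xi>. disc_op s h (ext_kernel s) (x - \<xi>) y * f \<xi>) (disc_op s h (ext s f) x y)"
      by simp
    then have "\<bar>disc_op s h (ext s f) x y\<bar> \<le> (\<integral>\<xi>. \<bar>disc_op s h (ext_kernel s) (x - \<xi>) y * f \<xi>\<bar> \<partial>lborel)"
      using integral_norm_bound[of lborel "\<lambda>\<xi>. disc_op s h (ext_kernel s) (x - \<xi>) y * f \<xi>"] by (simp add: has_bochner_integral_iff)
    also have "\<dots> \<le> (\<integral>\<xi>. (C * h) * \<bar>f \<xi>\<bar> \<partial>lborel)"
    proof (rule integral_mono)
      show "integrable lborel (\<lambda>\<xi>. \<bar>disc_op s h (ext_kernel s) (x - \<xi>) y * f \<xi>\<bar>)"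
        using hb by (intro integrable_abs) (simp add: has_bochner_integral_iff)
      show "\<bar>disc_op s h (ext_kernel s) (x - \<xi>) y * f \<xi>\<bar> \<le> (C * h) * \<bar>f \<xi>\<bar>" for \<xi>
        unfolding abs_mult using C(2)[OF h y] by (intro mult_right_mono) auto
    qed (use f in simp)
    finally show ?thesis by (simp add: L_def mult_ac)
  qed
  moreover have "0 \<le> C * L" using C(1) by (simp add: L_def)
  ultimately show ?thesis by blast
qed

section \<open>Maximum principle\<close>

lemma has_bochner_integral_translate:
  fixes f :: "'a::euclidean_space \<Rightarrow> real"
  assumes "has_bochner_integral lborel f I"
  shows "has_bochner_integral lborel (\<lambda>x. f (x + a)) I"
proof -
  have "has_bochner_integral (distr lborel borel ((+) a)) f I"
    using assms by (simp add: lborel_distr_plus)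
  moreover have "f \<in> borel_measurable borel" using borel_measurable_has_bochner_integral[OF assms] by simp
  moreover have "(+) a \<in> measurable lborel borel" by simp
  ultimately have "has_bochner_integral lborel (\<lambda>x. f (a + x)) I" by (simp only: has_bochner_integral_iff integrable_distr_eq integral_distr)
  then show ?thesis by (simp add: add.commute)
qed

text \<open>The slice integral \<open>m y\<close> of the truncation of \<open>V\<close> to \<open>D\<close> is a discrete subsolution of
  \<open>m'' + (1 - 2 s) / y m' = 0\<close>, because the differences in the horizontal directions integrate to zero.
  It vanishes for large \<open>y\<close>, so it is at most its value at the left end point.\<close>

lemma slice_integral_maximum_principle:
  fixes V :: "real^'n \<Rightarrow> real \<Rightarrow> real" and D :: "((real^'n) \<times> real) set"
  assumes s: "0 < s" "s < 1" and D: "open D" "D \<subseteq> {p. 0 < snd p}"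
    and V: "continuous_on {p. 0 < snd p} (\<lambda>p. V (fst p) (snd p))"
    and K: "\<And>a. 0 < a \<Longrightarrow> compact {p \<in> D. a \<le> snd p \<and> \<eta> \<le> V (fst p) (snd p)}"
    and disc: "\<And>a b. 0 < a \<Longrightarrow> a \<le> b \<Longrightarrow> \<exists>C\<ge>0. \<forall>h y x. 0 < h \<and> h \<le> a / 2 \<and> a \<le> y \<and> y \<le> b \<longrightarrow> \<bar>disc_op s h V x y\<bar> \<le> C * h"
  defines "q \<equiv> \<lambda>x y. if (x, y) \<in> D then max 0 (V x y - \<eta>) else 0"
  assumes a: "0 < a" "a < y0"
  shows "integrable lborel (\<lambda>x. q x a)" and "(\<integral>x. q x y0 \<partial>lborel) \<le> (\<integral>x. q x a \<partial>lborel)"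
proof -
  define m where "m y = (\<integral>x. q x y \<partial>lborel)" for y
  define Ka where "Ka = {p \<in> D. a \<le> snd p \<and> \<eta> \<le> V (fst p) (snd p)}"
  have Kc: "compact Ka" unfolding Ka_def by (rule K[OF a(1)])
  have KD: "Ka \<subseteq> D" by (auto simp: Ka_def)
  obtain R0 where R0: "\<And>p. p \<in> Ka \<Longrightarrow> norm p \<le> R0"
    using compact_imp_bounded[OF Kc] unfolding bounded_iff by blast
  define R where "R = max 1 R0"
  have R: "norm x \<le> R" "\<bar>y\<bar> \<le> R" if "(x, y) \<in> Ka" for x y
    using R0[OF that] norm_fst_le[of x y] norm_snd_le[of y x] by (auto simp: R_def)
  have q0: "0 \<le> q x y" for x y by (simp add: q_def)
  have qK: "(x, y) \<in> Ka" if "q x y \<noteq> 0" "a \<le> y" for x y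
    using that by (auto simp: q_def Ka_def max_def split: if_splits)
  have qmeas [measurable]: "(\<lambda>x. q x y) \<in> borel_measurable borel" if "0 < y" for y
  proof -
    define Dy where "Dy = {x. (x, y) \<in> D}"
    have "continuous_on UNIV (\<lambda>x::real^'n. (x, y))" by (intro continuous_intros)
    then have Dy: "open Dy" using continuous_open_preimage[of UNIV "\<lambda>x. (x, y)" D] D(1)
      by (simp add: Dy_def vimage_def)
    have "continuous_on UNIV (\<lambda>x. V (fst (x, y)) (snd (x, y)))"
      by (rule continuous_on_compose2[OF V]) (use that in \<open>auto intro!: continuous_intros\<close>)
    then have "continuous_on UNIV (\<lambda>x. V x y)" by simp
    then have [measurable]: "(\<lambda>x. V x y) \<in> borel_measurable borel" by (rule borel_measurable_continuous_onI)
    have "(\<lambda>x. q x y) = (\<lambda>x. indicator Dy x * max 0 (V x y - \<eta>))"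
      by (auto simp: q_def Dy_def indicator_def)
    then show ?thesis using Dy by simp
  qed
  have qbd: "\<exists>B. \<forall>x. q x y \<le> B" if y: "a \<le> y" for y
  proof -
    have "continuous_on Ka (\<lambda>p. V (fst p) (snd p))"
      using V D KD by (elim continuous_on_subset) auto
    then have "bounded ((\<lambda>p. V (fst p) (snd p)) ` Ka)"
      using Kc by (intro compact_imp_bounded compact_continuous_image)
    then obtain B where B: "\<And>p. p \<in> Ka \<Longrightarrow> \<bar>V (fst p) (snd p)\<bar> \<le> B"
      unfolding bounded_iff by auto
    have "q x y \<le> \<bar>B\<bar> + \<bar>\<eta>\<bar>" for x
    proof (cases "q x y = 0")
      case False
      then show ?thesis using B[OF qK[OF False y]] by (auto simp: q_def max_def split: if_splits)
    qed auto
    then show ?thesis by blast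
  qed
  have qint: "integrable lborel (\<lambda>x. q x y)" if y: "a \<le> y" for y
  proof -
    obtain B where B: "\<And>x. q x y \<le> B" using qbd[OF y] by blast
    have y0: "0 < y" using y a by simp
    have fin: "emeasure lborel (cball (0::real^'n) R) < \<infinity>" by (intro emeasure_bounded_finite) auto
    have "integrable lborel (\<lambda>x::real^'n. indicator (cball 0 R) x * B)"
      using fin by (intro integrable_mult_left integrable_real_indicator) auto
    then show ?thesis
    proof (rule Bochner_Integration.integrable_bound)
      show "(\<lambda>x. q x y) \<in> borel_measurable lborel" using qmeas[OF y0] by simp
      show "AE x in lborel. norm (q x y) \<le> norm (indicator (cball 0 R) x * B)"
      proof (intro AE_I2)
        fix x
        show "norm (q x y) \<le> norm (indicator (cball 0 R) x * B)"
        proof (cases "q x y = 0")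
          case False
          then have "x \<in> cball 0 R" using R(1)[OF qK[OF False y]] by simp
          then show ?thesis using B[of x] q0[of x y] by simp
        qed simp
      qed
    qed
  qed
  show "integrable lborel (\<lambda>x. q x a)" by (rule qint) simp
  have m0: "0 \<le> m y" for y unfolding m_def using q0 by (intro integral_nonneg_AE) auto
  have mR: "m y = 0" if "a \<le> y" "R < y" for y
  proof -
    have "q x y = 0" for x using R(2)[of x y] qK[of x y] that a by auto
    then show ?thesis by (simp add: m_def)
  qed
  have "m y0 \<le> m a"
  proof (rule ccontr)
    assume "\<not> m y0 \<le> m a"
    then have less: "m a < m y0" by simp
    then have my0: "0 < m y0" using m0[of a] by simp
    have y0R: "y0 \<le> R" using mR[of y0] my0 a by fastforce
    define b where "b = R + 1"
    have ab: "a \<le> b" "y0 \<le> b" using a y0R by (auto simp: b_def)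
    obtain C where C: "0 \<le> C" "\<And>h y x. 0 < h \<Longrightarrow> h \<le> a / 2 \<Longrightarrow> a \<le> y \<Longrightarrow> y \<le> b \<Longrightarrow> \<bar>disc_op s h V x y\<bar> \<le> C * h"
      using disc[OF a(1) ab(1)] by blast
    obtain e where e: "0 < e" "(\<Union>x\<in>Ka. cball x e) \<subseteq> D"
      using compact_subset_open_imp_cball_epsilon_subset[OF Kc D(1) KD] by blast
    \<comment> \<open>Strength of the perturbation \<delta> y^2, on which the operator equals 4 (1 -
      s) \<delta> > 0. It is so small that the perturbed slice integral at y0 still beats its values
      at both ends of the grid, which forces an interior maximum.\<close>
    define \<delta> where "\<delta> = m y0 / (2 * b^2)"
    have b0: "0 < b" using ab a by simp
    have \<delta>: "0 < \<delta>" "\<delta> * b^2 < m y0" using my0 b0 by (auto simp: \<delta>_def)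
    define \<mu> where "\<mu> = measure lborel (cball (0::real^'n) R)"
    have \<mu>: "0 \<le> \<mu>" by (simp add: \<mu>_def)
    \<comment> \<open>The four bounds have four uses: a/2 for the consistency estimate, e so that
      neighbouring grid points over \<open>Ka\<close> stay in \<open>D\<close>, 1 so that the grid
      ends below b, and the last one makes the total error C h \<mu> smaller than the gain 4 (1 - s)
      \<delta>.\<close>
    define h0 where "h0 = min (min (a / 2) e) (min 1 (2 * (1 - s) * \<delta> / (C * \<mu> + 1)))"
    have h0: "0 < h0" using a e s \<delta> C(1) \<mu> by (auto simp: h0_def intro!: divide_pos_pos mult_pos_pos add_nonneg_pos)
    obtain n :: nat where n: "(y0 - a) / h0 < real n" using reals_Archimedean2 by blast
    have n0: "0 < n" using n a h0 by (cases n) (auto simp: divide_less_0_iff field_simps)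
    \<comment> \<open>A divisor of y0 - a, so that y0 is itself a grid point.\<close>
    define h where "h = (y0 - a) / real n"
    have h: "0 < h" "h < h0" using a n n0 h0 by (auto simp: h_def field_simps)
    have hs: "h \<le> a / 2" "h \<le> e" "h \<le> 1" "h \<le> 2 * (1 - s) * \<delta> / (C * \<mu> + 1)" using h by (auto simp: h0_def)
    define f where "f j = m (a + real j * h) + \<delta> * (a + real j * h)^2" for j :: nat
    obtain J :: nat where J: "J = nat \<lfloor>(R - a) / h\<rfloor> + 1" by blast
    have Ra: "a < R" using y0R a by simp
    have "real (nat \<lfloor>(R - a) / h\<rfloor>) = of_int \<lfloor>(R - a) / h\<rfloor>" using Ra h by simp
    then have fl: "real (nat \<lfloor>(R - a) / h\<rfloor>) \<le> (R - a) / h" "(R - a) / h < real (nat \<lfloor>(R - a) / h\<rfloor>) + 1"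
      using floor_correct[of "(R - a) / h"] by (simp_all only: of_int_add of_int_1)
    have J1: "real J \<le> (R - a) / h + 1" "(R - a) / h < real J"
      unfolding J of_nat_add of_nat_1 by (rule add_right_mono[OF fl(1)], rule fl(2))
    have yJ: "R < a + real J * h" "a + real J * h \<le> b"
    proof -
      show "R < a + real J * h" using J1(2) h by (simp add: field_simps)
      have "real J * h \<le> ((R - a) / h + 1) * h" using J1(1) h by (intro mult_right_mono) auto
      also have "\<dots> = R - a + h" using h by (simp add: field_simps)
      finally show "a + real J * h \<le> b" using hs by (simp add: b_def)
    qed
    have yn: "a + real n * h = y0" using n0 by (simp add: h_def)
    have nJ: "n < J"
    proof -
      have "real n * h < real J * h" using yn yJ y0R by linarith
      then show ?thesis using h by simp
    qed
    have fn0: "f 0 < f n"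
    proof -
      have "a^2 \<le> y0^2" using a by (intro power_mono) auto
      then have "\<delta> * a^2 \<le> \<delta> * y0^2" using \<delta> by (intro mult_left_mono) auto
      then show ?thesis using less unfolding f_def yn by simp
    qed
    have fnJ: "f J < f n"
    proof -
      have "(a + real J * h)^2 \<le> b^2" using yJ a h by (intro power_mono) auto
      then have "\<delta> * (a + real J * h)^2 \<le> \<delta> * b^2" using \<delta> by (intro mult_left_mono) auto
      moreover have "m (a + real J * h) = 0" using yJ a h by (intro mR) auto
      moreover have "0 \<le> \<delta> * y0^2" using \<delta> by simp
      ultimately show ?thesis using \<delta>(2) unfolding f_def yn by linarith
    qed
    obtain i where i: "i \<le> J" "\<And>j. j \<le> J \<Longrightarrow> f j \<le> f i"
    proof -
      have fin: "finite (f ` {..J})" "f ` {..J} \<noteq> {}" by auto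
      obtain i where "i \<le> J" "f i = Max (f ` {..J})" using Max_in[OF fin] by (metis (no_types, lifting) atMost_iff image_iff)
      then show ?thesis using that[of i] Max_ge[OF fin(1)] by auto
    qed
    have i0: "i \<noteq> 0"
    proof
      assume "i = 0"
      then show False using i(2)[of n] fn0 nJ by simp
    qed
    have iJ: "i \<noteq> J"
    proof
      assume "i = J"
      then show False using i(2)[of n] fnJ nJ by simp
    qed
    then have iJ': "Suc i \<le> J" using i(1) by simp
    define y where "y = a + real i * h"
    have yp: "a + real (Suc i) * h = y + h" by (simp add: y_def algebra_simps)
    have ym: "a + real (i - 1) * h = y - h" using i0 by (simp add: y_def of_nat_diff Suc_leI algebra_simps)
    have ya: "a \<le> y - h" "a \<le> y" "y \<le> b"
    proof -
      show "a \<le> y - h" unfolding ym[symmetric] using h by simp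
      then show "a \<le> y" using h by simp
      have "real i * h \<le> real J * h" using i(1) h by (intro mult_right_mono) auto
      then show "y \<le> b" using yJ by (simp add: y_def)
    qed
    have ypos: "0 < y" using ya a by simp
    have fp: "m (y + h) + \<delta> * (y + h)^2 \<le> m y + \<delta> * y^2" using i(2)[OF iJ'] unfolding f_def yp y_def[symmetric] .
    have fm: "m (y - h) + \<delta> * (y - h)^2 \<le> m y + \<delta> * y^2"
      using i(2)[of "i - 1"] i(1) unfolding f_def ym y_def[symmetric] by simp
    define c where "c = (1 - 2 * s) / (2 * h * y)"
    \<comment> \<open>Monotonicity of the scheme: as h is at most a/2 and thus below 2y, the first
      order term leaves both weights 1/h^2 + c and 1/h^2 - c nonnegative.\<close>
    have c: "\<bar>c\<bar> \<le> 1 / h^2"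
    proof -
      have "\<bar>c\<bar> = \<bar>1 - 2 * s\<bar> / (2 * h * y)" unfolding c_def using h ypos by simp
      also have "\<dots> \<le> 1 / (2 * h * y)" using s h ypos by (intro divide_right_mono) auto
      also have "\<dots> \<le> 1 / h^2" using h hs ya a ypos by (intro divide_left_mono) (auto simp: power2_eq_square)
      finally show ?thesis .
    qed
    have wp: "0 \<le> 1 / h^2 + c" "0 \<le> 1 / h^2 - c" using c by (auto simp: abs_le_iff)
    define L where "L g = (g (y + h) + g (y - h) - 2 * g y) / h^2 + c * (g (y + h) - g (y - h))" for g :: "real \<Rightarrow> real"
    have L_alt: "L g = (1 / h^2 + c) * (g (y + h) - g y) + (1 / h^2 - c) * (g (y - h) - g y)" for g
      unfolding L_def by (simp add: divide_inverse algebra_simps)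
    have "(1 / h^2 + c) * ((m (y + h) + \<delta> * (y + h)^2) - (m y + \<delta> * y^2)) \<le> 0"
      using fp wp by (intro mult_nonneg_nonpos) auto
    moreover have "(1 / h^2 - c) * ((m (y - h) + \<delta> * (y - h)^2) - (m y + \<delta> * y^2)) \<le> 0"
      using fm wp by (intro mult_nonneg_nonpos) auto
    ultimately have Lf: "L (\<lambda>y. m y + \<delta> * y^2) \<le> 0" unfolding L_alt by linarith
    have Lsq: "L (\<lambda>y. y^2) = 4 * (1 - s)"
    proof -
      have 1: "(y + h)^2 + (y - h)^2 - 2 * y^2 = 2 * h^2" "(y + h)^2 - (y - h)^2 = 4 * (h * y)"
        by (simp_all add: power2_eq_square algebra_simps)
      have "L (\<lambda>y. y^2) = 2 * h^2 / h^2 + c * (4 * (h * y))" unfolding L_def 1 ..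
      also have "c * (4 * (h * y)) = 2 * (1 - 2 * s)" unfolding c_def using h ypos by simp
      finally show ?thesis using h by simp
    qed
    have Llin: "L (\<lambda>y. m y + \<delta> * y^2) = L m + \<delta> * L (\<lambda>y. y^2)"
    proof -
      have gen: "w * ((A + \<delta> * A') - (B + \<delta> * B')) = w * (A - B) + \<delta> * (w * (A' - B'))" for w A A' B B' :: real
        by (simp add: algebra_simps)
      show ?thesis unfolding L_alt gen by (simp only: distrib_left add_ac)
    qed
    have Lm: "- (C * h * \<mu>) \<le> L m"
    proof -
      have hb: "has_bochner_integral lborel (\<lambda>x. q x t) (m t)" if "a \<le> t" for t
        unfolding m_def using qint[OF that] by (rule has_bochner_integral_integrable)
      have hbt: "has_bochner_integral lborel (\<lambda>x. q (x + z) y) (m y)" for z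
        by (rule has_bochner_integral_translate[OF hb[OF ya(2)]])
      have hbm: "has_bochner_integral lborel (\<lambda>x. q (x - z) y) (m y)" for z
        using hbt[of "- z"] by simp
      have "a \<le> y + h" using ya h by simp
      then have "has_bochner_integral lborel (disc_op_x) ((\<Sum>i\<in>(UNIV::'n set). m y + m y - 2 * m y) / h^2 + (m (y + h) + m (y - h) - 2 * m y) / h^2 + c * (m (y + h) - m (y - h)))"
        if "disc_op_x = (\<lambda>x. disc_op s h q x y)" for disc_op_x
        unfolding that disc_op_def c_def[symmetric]
        by (intro has_bochner_integral_add has_bochner_integral_diff has_bochner_integral_divide_zero has_bochner_integral_sum
          has_bochner_integral_mult_right hb hbt hbm ya)
      then have hbL: "has_bochner_integral lborel (\<lambda>x. disc_op s h q x y) (L m)"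
        unfolding L_def by simp
      have "(\<integral>x. - (C * h) * indicator (cball (0::real^'n) R) x \<partial>lborel) \<le> (\<integral>x. disc_op s h q x y \<partial>lborel)"
      proof (rule integral_mono)
        have fin: "emeasure lborel (cball (0::real^'n) R) < \<infinity>" by (intro emeasure_bounded_finite) auto
        show "integrable lborel (\<lambda>x::real^'n. - (C * h) * indicator (cball 0 R) x)"
          using fin by (intro integrable_mult_right integrable_real_indicator) auto
        show "integrable lborel (\<lambda>x. disc_op s h q x y)" using hbL by (simp add: has_bochner_integral_iff)
        fix x :: "real^'n"
        have alt: "disc_op s h F x y = (\<Sum>i\<in>UNIV. F (x + axis i h) y + F (x - axis i h) y - 2 * F x y) / h^2 +
            ((1 / h^2 + c) * (F x (y + h) - F x y) + (1 / h^2 - c) * (F x (y - h) - F x y))" for F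
          unfolding disc_op_def c_def[symmetric] by (simp add: divide_inverse algebra_simps)
        show "- (C * h) * indicator (cball 0 R) x \<le> disc_op s h q x y"
        \<comment> \<open>Where \<open>q\<close> vanishes it is minimal, so its differences are
          nonnegative. Where it is positive, all neighbours lie in \<open>D\<close>, where q \<ge> V
          - \<eta>, with equality at the point itself; hence \<open>disc_op\<close> of
          \<open>q\<close> dominates that of \<open>V\<close>.\<close>
        proof (cases "q x y = 0")
          case True
          have "0 \<le> disc_op s h q x y"
            unfolding alt True using wp q0 by (auto intro!: add_nonneg_nonneg mult_nonneg_nonneg sum_nonneg divide_nonneg_nonneg)
          moreover have "- (C * h) * indicator (cball 0 R) x \<le> 0" using C(1) h by (simp add: indicator_def)
          ultimately show ?thesis by linarith
        next
          case False
          then have inK: "(x, y) \<in> Ka" using qK ya by simp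
          have near: "(x', y') \<in> D" if "dist (x, y) (x', y') \<le> h" for x' y'
          proof -
            have "(x', y') \<in> cball (x, y) e" using that hs by simp
            then show ?thesis using e(2) inK by blast
          qed
          have qV: "V x' y' - \<eta> \<le> q x' y'" if "dist (x, y) (x', y') \<le> h" for x' y'
            using near[OF that] by (simp add: q_def)
          have qxy: "q x y = V x y - \<eta>" using False KD inK by (auto simp: q_def max_def split: if_splits)
          have "disc_op s h V x y \<le> disc_op s h q x y"
          proof -
            have x1: "V (x + axis i h) y - \<eta> \<le> q (x + axis i h) y" "V (x - axis i h) y - \<eta> \<le> q (x - axis i h) y" for i
              using h by (intro qV; simp add: dist_Pair_Pair dist_norm norm_eq_sqrt_inner inner_axis_axis)+
            have "V (x + axis i h) y + V (x - axis i h) y - 2 * V x y \<le> q (x + axis i h) y + q (x - axis i h) y - 2 * q x y" for i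
              using x1[of i] qxy by linarith
            then have "(\<Sum>i\<in>UNIV. V (x + axis i h) y + V (x - axis i h) y - 2 * V x y) / h^2 \<le>
                (\<Sum>i\<in>UNIV. q (x + axis i h) y + q (x - axis i h) y - 2 * q x y) / h^2"
              by (intro divide_right_mono sum_mono) auto
            moreover have x2: "V x (y + h) - \<eta> \<le> q x (y + h)" "V x (y - h) - \<eta> \<le> q x (y - h)"
              using h by (intro qV; simp add: dist_Pair_Pair dist_norm)+
            have x3: "V x (y + h) - V x y \<le> q x (y + h) - q x y" "V x (y - h) - V x y \<le> q x (y - h) - q x y"
              using qxy x2 by linarith+
            have "(1 / h^2 + c) * (V x (y + h) - V x y) \<le> (1 / h^2 + c) * (q x (y + h) - q x y)"
              "(1 / h^2 - c) * (V x (y - h) - V x y) \<le> (1 / h^2 - c) * (q x (y - h) - q x y)"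
              by (rule mult_left_mono[OF x3(1) wp(1)], rule mult_left_mono[OF x3(2) wp(2)])
            ultimately show ?thesis unfolding alt by (intro add_mono)
          qed
          moreover have "- (C * h) \<le> disc_op s h V x y" using C(2)[OF h(1) hs(1) ya(2,3), of x] by (simp add: abs_le_iff)
          ultimately show ?thesis using R(1)[OF inK] by simp
        qed
      qed
      also have "(\<integral>x. disc_op s h q x y \<partial>lborel) = L m" using hbL by (simp add: has_bochner_integral_iff)
      finally show ?thesis by (simp add: \<mu>_def)
    qed
    have "h * (C * \<mu> + 1) \<le> 2 * (1 - s) * \<delta>"
      using hs(4) C(1) \<mu> by (simp add: pos_le_divide_eq add_nonneg_pos)
    then have "C * h * \<mu> \<le> 2 * (1 - s) * \<delta>" using h by (simp add: algebra_simps)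
    moreover have "0 < (1 - s) * \<delta>" using s \<delta> by simp
    ultimately have "0 < L m + \<delta> * L (\<lambda>y. y^2)"
      using Lm unfolding Lsq by (simp add: algebra_simps)
    then show False using Lf Llin by simp
  qed
  then show "(\<integral>x. q x y0 \<partial>lborel) \<le> (\<integral>x. q x a \<partial>lborel)" by (simp add: m_def)
qed

section \<open>Convergence to the trace\<close>

lemma ext_add:
  assumes "0 < s" "0 < y" "integrable lborel f" "integrable lborel g"
  shows "ext s (\<lambda>x. f x + g x) x y = ext s f x y + ext s g x y"
  unfolding ext_def distrib_left
  by (rule Bochner_Integration.integral_add[OF integrable_ext[OF assms(1,2,3)] integrable_ext[OF assms(1,2,4)]])

lemma ext_scale: "ext s (\<lambda>x. f x * c) x y = ext s f x y * c"
  by (simp add: ext_def flip: mult.assoc)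

lemma ext_measurable:
  fixes f :: "real^'n \<Rightarrow> real"
  assumes [measurable]: "f \<in> borel_measurable borel"
  shows "(\<lambda>x. ext s f x y) \<in> borel_measurable borel"
proof -
  have "(\<lambda>x. ext s f x y) \<in> borel_measurable lborel"
    unfolding ext_def by (rule lborel.borel_measurable_lebesgue_integral) measurable
  then show ?thesis by simp
qed

lemma integral_ext_nonneg:
  fixes f :: "real^'n \<Rightarrow> real"
  assumes s: "0 < s" and y: "0 < y" and f: "integrable lborel f" "\<And>x. 0 \<le> f x"
  shows "has_bochner_integral lborel (\<lambda>x. ext s f x y) (kernel_mass TYPE('n) s * (\<integral>x. f x \<partial>lborel))"
proof (rule has_bochner_integral_nn_integral)
  note [measurable] = borel_measurable_integrable[OF f(1)]
  show "(\<lambda>x. ext s f x y) \<in> borel_measurable lborel" using ext_measurable[of f s y] by simp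
  show "AE x in lborel. 0 \<le> ext s f x y" using f(2) by (simp add: ext_nonneg)
  show "0 \<le> kernel_mass TYPE('n) s * (\<integral>x. f x \<partial>lborel)"
    using kernel_mass(1)[OF s, where 'n='n] f(2) by (intro mult_nonneg_nonneg integral_nonneg_AE) auto
  have "(\<integral>\<^sup>+x. ennreal (ext s f x y) \<partial>lborel) = (\<integral>\<^sup>+x. \<integral>\<^sup>+\<xi>. ennreal (ext_kernel s (x - \<xi>) y * f \<xi>) \<partial>lborel \<partial>lborel)"
    unfolding ext_def using f by (intro nn_integral_cong nn_integral_eq_integral[symmetric] integrable_ext s y) auto
  also have "\<dots> = (\<integral>\<^sup>+\<xi>. \<integral>\<^sup>+x. ennreal (ext_kernel s (x - \<xi>) y * f \<xi>) \<partial>lborel \<partial>lborel)"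
    by (rule lborel_pair.Fubini'[symmetric]) measurable
  also have "\<dots> = (\<integral>\<^sup>+\<xi>. ennreal (kernel_mass TYPE('n) s) * ennreal (f \<xi>) \<partial>lborel)"
  proof (intro nn_integral_cong)
    fix \<xi>
    have "(\<integral>\<^sup>+x. ennreal (ext_kernel s (x - \<xi>) y * f \<xi>) \<partial>lborel) = (\<integral>\<^sup>+x. ennreal (ext_kernel s (x - \<xi>) y) * ennreal (f \<xi>) \<partial>lborel)"
      using f(2) by (simp add: ennreal_mult)
    also have "\<dots> = (\<integral>\<^sup>+x. ennreal (ext_kernel s (x - \<xi>) y) \<partial>lborel) * ennreal (f \<xi>)"
      by (intro nn_integral_multc) measurable
    also have "(\<integral>\<^sup>+x. ennreal (ext_kernel s (x - \<xi>) y) \<partial>lborel) = ennreal (kernel_mass TYPE('n) s)"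
      using nn_integral_translate[of "\<lambda>x. ennreal (ext_kernel s x y)" "- \<xi>"] kernel_mass(2)[OF s y, where 'n='n] by simp
    finally show "(\<integral>\<^sup>+x. ennreal (ext_kernel s (x - \<xi>) y * f \<xi>) \<partial>lborel) = ennreal (kernel_mass TYPE('n) s) * ennreal (f \<xi>)" .
  qed
  also have "\<dots> = ennreal (kernel_mass TYPE('n) s) * (\<integral>\<^sup>+\<xi>. ennreal (f \<xi>) \<partial>lborel)"
    by (intro nn_integral_cmult) measurable
  also have "(\<integral>\<^sup>+\<xi>. ennreal (f \<xi>) \<partial>lborel) = ennreal (\<integral>x. f x \<partial>lborel)"
    using f by (intro nn_integral_eq_integral) auto
  finally show "(\<integral>\<^sup>+x. ennreal (ext s f x y) \<partial>lborel) = ennreal (kernel_mass TYPE('n) s * (\<integral>x. f x \<partial>lborel))"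
    using kernel_mass(1)[OF s, where 'n='n] f(2) by (simp add: ennreal_mult integral_nonneg_AE)
qed

lemma integral_abs_ext_le:
  fixes f :: "real^'n \<Rightarrow> real"
  assumes s: "0 < s" and y: "0 < y" and f: "integrable lborel f"
  shows "integrable lborel (\<lambda>x. ext s f x y)"
    and "(\<integral>x. \<bar>ext s f x y\<bar> \<partial>lborel) \<le> kernel_mass TYPE('n) s * (\<integral>x. \<bar>f x\<bar> \<partial>lborel)"
proof -
  note [measurable] = borel_measurable_integrable[OF f]
  have hb: "has_bochner_integral lborel (\<lambda>x. ext s (\<lambda>x. \<bar>f x\<bar>) x y) (kernel_mass TYPE('n) s * (\<integral>x. \<bar>f x\<bar> \<partial>lborel))"
    by (rule integral_ext_nonneg[OF s y integrable_abs[OF f]]) simp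
  have le: "\<bar>ext s f x y\<bar> \<le> ext s (\<lambda>x. \<bar>f x\<bar>) x y" for x
    unfolding ext_def using integral_norm_bound[of lborel "\<lambda>\<xi>. ext_kernel s (x - \<xi>) y * f \<xi>"] by (simp add: abs_mult)
  show i: "integrable lborel (\<lambda>x. ext s f x y)"
  proof (rule Bochner_Integration.integrable_bound)
    show "integrable lborel (\<lambda>x. ext s (\<lambda>x. \<bar>f x\<bar>) x y)" using hb by (simp add: has_bochner_integral_iff)
    show "(\<lambda>x. ext s f x y) \<in> borel_measurable lborel" using ext_measurable[of f s y] by simp
    show "AE x in lborel. norm (ext s f x y) \<le> norm (ext s (\<lambda>x. \<bar>f x\<bar>) x y)"
      using le by (intro AE_I2) (auto intro: order_trans[OF _ abs_ge_self])
  qed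
  have "(\<integral>x. \<bar>ext s f x y\<bar> \<partial>lborel) \<le> (\<integral>x. ext s (\<lambda>x. \<bar>f x\<bar>) x y \<partial>lborel)"
    using i hb le by (intro integral_mono) (auto simp: has_bochner_integral_iff)
  then show "(\<integral>x. \<bar>ext s f x y\<bar> \<partial>lborel) \<le> kernel_mass TYPE('n) s * (\<integral>x. \<bar>f x\<bar> \<partial>lborel)"
    using hb by (simp add: has_bochner_integral_iff)
qed

text \<open>Convergence to the trace is measured in L^1 because the maximum principle compares
  integrals over slices.\<close>

definition ext_error :: "real \<Rightarrow> real \<Rightarrow> (real^'n \<Rightarrow> real) \<Rightarrow> real" where
  "ext_error s y f = (\<integral>x. \<bar>ext s f x y - kernel_mass TYPE('n) s * f x\<bar> \<partial>lborel)"

lemma integrable_ext_error: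
  fixes f :: "real^'n \<Rightarrow> real"
  assumes "0 < s" "0 < y" "integrable lborel f"
  shows "integrable lborel (\<lambda>x. \<bar>ext s f x y - kernel_mass TYPE('n) s * f x\<bar>)"
  using integral_abs_ext_le(1)[OF assms] assms(3) by (intro integrable_abs Bochner_Integration.integrable_diff) auto

lemma ext_error_add:
  fixes f g :: "real^'n \<Rightarrow> real"
  assumes "0 < s" "0 < y" "integrable lborel f" "integrable lborel g"
  shows "ext_error s y (\<lambda>x. f x + g x) \<le> ext_error s y f + ext_error s y g"
proof -
  let ?c = "kernel_mass TYPE('n) s"
  have "ext_error s y (\<lambda>x. f x + g x) \<le> (\<integral>x. (\<bar>ext s f x y - ?c * f x\<bar> + \<bar>ext s g x y - ?c * g x\<bar>) \<partial>lborel)"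
    unfolding ext_error_def
  proof (rule integral_mono)
    show "integrable lborel (\<lambda>x. \<bar>ext s (\<lambda>x. f x + g x) x y - ?c * (f x + g x)\<bar>)"
      using assms by (intro integrable_ext_error) auto
    show "integrable lborel (\<lambda>x. \<bar>ext s f x y - ?c * f x\<bar> + \<bar>ext s g x y - ?c * g x\<bar>)"
      using assms by (intro Bochner_Integration.integrable_add integrable_ext_error)
    fix x
    have "ext s (\<lambda>x. f x + g x) x y - ?c * (f x + g x) = (ext s f x y - ?c * f x) + (ext s g x y - ?c * g x)"
      unfolding ext_add[OF assms] by (simp add: algebra_simps)
    then show "\<bar>ext s (\<lambda>x. f x + g x) x y - ?c * (f x + g x)\<bar> \<le> \<bar>ext s f x y - ?c * f x\<bar> + \<bar>ext s g x y - ?c * g x\<bar>"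
      by (simp only: abs_triangle_ineq)
  qed
  also have "\<dots> = ext_error s y f + ext_error s y g"
    unfolding ext_error_def using assms by (intro Bochner_Integration.integral_add integrable_ext_error)
  finally show ?thesis .
qed

lemma ext_error_le:
  fixes f :: "real^'n \<Rightarrow> real"
  assumes "0 < s" "0 < y" "integrable lborel f"
  shows "ext_error s y f \<le> 2 * kernel_mass TYPE('n) s * (\<integral>x. \<bar>f x\<bar> \<partial>lborel)"
proof -
  let ?c = "kernel_mass TYPE('n) s"
  have c: "0 < ?c" using kernel_mass(1)[OF assms(1), where 'n='n] .
  have "ext_error s y f \<le> (\<integral>x. (\<bar>ext s f x y\<bar> + ?c * \<bar>f x\<bar>) \<partial>lborel)"
    unfolding ext_error_def
  proof (rule integral_mono)
    show "integrable lborel (\<lambda>x. \<bar>ext s f x y - ?c * f x\<bar>)" using assms by (rule integrable_ext_error)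
    show "integrable lborel (\<lambda>x. \<bar>ext s f x y\<bar> + ?c * \<bar>f x\<bar>)"
      using integral_abs_ext_le(1)[OF assms] assms(3) by simp
    show "\<bar>ext s f x y - ?c * f x\<bar> \<le> \<bar>ext s f x y\<bar> + ?c * \<bar>f x\<bar>" for x
      using abs_triangle_ineq4[of "ext s f x y" "?c * f x"] c by (simp add: abs_mult)
  qed
  also have "\<dots> = (\<integral>x. \<bar>ext s f x y\<bar> \<partial>lborel) + ?c * (\<integral>x. \<bar>f x\<bar> \<partial>lborel)"
    using integral_abs_ext_le(1)[OF assms] assms(3) by simp
  finally show ?thesis using integral_abs_ext_le(2)[OF assms] by simp
qed

text \<open>Scheffe's argument: the difference \<open>a n\<close> has integral 0, so its L^1 norm is
  twice that of its positive part, and the positive part is dominated by a multiple of the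
  indicator. At a point of the open set a whole ball lies inside, so only a kernel tail of order
  y^(2s) is missing.\<close>

lemma ext_error_indicator_open:
  fixes U :: "(real^'n) set"
  assumes s: "0 < s" and U: "open U" "emeasure lborel U < \<infinity>" and y: "\<And>n::nat. 0 < y n" "y \<longlonglongrightarrow> 0"
  shows "(\<lambda>n. ext_error s (y n) (indicator U)) \<longlonglongrightarrow> 0"
proof -
  let ?c = "kernel_mass TYPE('n) s"
  have c: "0 < ?c" using kernel_mass(1)[OF s, where 'n='n] .
  have iU: "integrable lborel (indicator U :: real^'n \<Rightarrow> real)" using U by (intro integrable_real_indicator) auto
  define a where "a n x = ?c * indicator U x - ext s (indicator U) x (y n)" for n and x :: "real^'n"
  have ia: "integrable lborel (a n)" for n
    unfolding a_def using integral_abs_ext_le(1)[OF s y(1) iU] iU by (intro Bochner_Integration.integrable_diff) auto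
  have a0: "(\<integral>x. a n x \<partial>lborel) = 0" for n
    using integral_ext_nonneg[OF s y(1)[of n] iU] integral_abs_ext_le(1)[OF s y(1) iU] iU
    unfolding a_def by (subst Bochner_Integration.integral_diff) (auto simp: has_bochner_integral_iff)
  have e: "ext_error s (y n) (indicator U) = 2 * (\<integral>x. max 0 (a n x) \<partial>lborel)" for n
  proof -
    have "ext_error s (y n) (indicator U) = (\<integral>x. (2 * max 0 (a n x) - a n x) \<partial>lborel)"
      unfolding ext_error_def a_def by (intro Bochner_Integration.integral_cong) (auto simp: max_def)
    also have "\<dots> = 2 * (\<integral>x. max 0 (a n x) \<partial>lborel) - (\<integral>x. a n x \<partial>lborel)"
      using ia by (subst Bochner_Integration.integral_diff) auto
    finally show ?thesis by (simp add: a0)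
  qed
  have "(\<lambda>n. \<integral>x. max 0 (a n x) \<partial>lborel) \<longlonglongrightarrow> (\<integral>x. 0 \<partial>(lborel :: (real^'n) measure))"
  proof (rule integral_dominated_convergence[where w = "\<lambda>x. ?c * indicator U x"])
    show "integrable lborel (\<lambda>x. ?c * indicator U x)" using iU by simp
    show "(\<lambda>x. max 0 (a n x)) \<in> borel_measurable lborel" for n using ia[of n] by measurable
    show "AE x in lborel. norm (max 0 (a n x)) \<le> ?c * indicator U x" for n
      using ext_nonneg[of "indicator U" s _ "y n"] c by (intro AE_I2) (auto simp: a_def max_def indicator_def)
    show "AE x in lborel. (\<lambda>n. max 0 (a n x)) \<longlonglongrightarrow> 0"
    proof (intro AE_I2)
      fix x :: "real^'n"
      show "(\<lambda>n. max 0 (a n x)) \<longlonglongrightarrow> 0"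
      proof (cases "x \<in> U")
        case False
        then have "max 0 (a n x) = 0" for n using ext_nonneg[of "indicator U" s x "y n"] by (simp add: a_def)
        then show ?thesis by simp
      next
        case True
        then obtain r where r: "0 < r" "ball x r \<subseteq> U" using U(1) open_contains_ball_eq by blast
        define T where "T = enn2real (\<integral>\<^sup>+z. ennreal (frac_kernel s z) * indicator {z. r \<le> norm z} z \<partial>(lborel :: (real^'n) measure))"
        have T: "ennreal T = (\<integral>\<^sup>+z. ennreal (frac_kernel s z) * indicator {z. r \<le> norm z} z \<partial>(lborel :: (real^'n) measure))"
          using frac_kernel_tail_finite[OF s r(1), where 'n='n] by (simp add: T_def less_top)
        have T0: "0 \<le> T" by (simp add: T_def)
        have bd: "a n x \<le> y n powr (2 * s) * T" for n
        proof -
          have eq: "ext s (indicator U) x (y n) - ?c * 1 = (\<integral>\<xi>. ext_kernel s (x - \<xi>) (y n) * (indicator U \<xi> - 1) \<partial>lborel)"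
            by (rule ext_minus_const(1)[OF s y(1) iU])
          have "a n x = (\<integral>\<xi>. ext_kernel s (x - \<xi>) (y n) * (1 - indicator U \<xi>) \<partial>lborel)"
          proof -
            have "(\<lambda>\<xi>. ext_kernel s (x - \<xi>) (y n) * (1 - indicator U \<xi>)) = (\<lambda>\<xi>. - (ext_kernel s (x - \<xi>) (y n) * (indicator U \<xi> - 1)))"
              by (auto simp: right_diff_distrib)
            then have "(\<integral>\<xi>. ext_kernel s (x - \<xi>) (y n) * (1 - indicator U \<xi>) \<partial>lborel) = - (\<integral>\<xi>. ext_kernel s (x - \<xi>) (y n) * (indicator U \<xi> - 1) \<partial>lborel)"
              by (simp only: Bochner_Integration.integral_minus)
            then show ?thesis using eq True by (simp add: a_def)
          qed
          also have "\<dots> = enn2real (\<integral>\<^sup>+\<xi>. ennreal (ext_kernel s (x - \<xi>) (y n) * (1 - indicator U \<xi>)) \<partial>lborel)"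
          proof (rule integral_eq_nn_integral)
            have [measurable]: "U \<in> sets borel" using U by simp
            show "(\<lambda>\<xi>. ext_kernel s (x - \<xi>) (y n) * (1 - indicator U \<xi>)) \<in> borel_measurable lborel" by measurable
          qed (auto split: split_indicator)
          also have "\<dots> \<le> y n powr (2 * s) * T"
          proof (rule enn2real_leI)
            have "(\<integral>\<^sup>+\<xi>. ennreal (ext_kernel s (x - \<xi>) (y n) * (1 - indicator U \<xi>)) \<partial>lborel)
               \<le> (\<integral>\<^sup>+\<xi>. ennreal (y n powr (2 * s)) * (ennreal (frac_kernel s (x - \<xi>)) * indicator {z. r \<le> norm z} (x - \<xi>)) \<partial>lborel)"
            proof (intro nn_integral_mono)
              fix \<xi>
              show "ennreal (ext_kernel s (x - \<xi>) (y n) * (1 - indicator U \<xi>)) \<le> ennreal (y n powr (2 * s)) * (ennreal (frac_kernel s (x - \<xi>)) * indicator {z. r \<le> norm z} (x - \<xi>))"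
              proof (cases "\<xi> \<in> U")
                case False
                then have d: "r \<le> norm (x - \<xi>)" using r by (auto simp: subset_iff dist_norm not_less[symmetric])
                then have "x - \<xi> \<noteq> 0" using r by auto
                from ext_kernel_le_frac_kernel[OF s this, of "y n"] False d show ?thesis
                  by (simp add: ennreal_leI flip: ennreal_mult)
              qed simp
            qed
            also have "\<dots> = ennreal (y n powr (2 * s)) * (\<integral>\<^sup>+\<xi>. ennreal (frac_kernel s (x - \<xi>)) * indicator {z. r \<le> norm z} (x - \<xi>) \<partial>lborel)"
              by (intro nn_integral_cmult) measurable
            also have "(\<integral>\<^sup>+\<xi>. ennreal (frac_kernel s (x - \<xi>)) * indicator {z. r \<le> norm z} (x - \<xi>) \<partial>lborel) = ennreal T"
              unfolding T by (rule nn_integral_reflect) measurable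
            finally show "(\<integral>\<^sup>+\<xi>. ennreal (ext_kernel s (x - \<xi>) (y n) * (1 - indicator U \<xi>)) \<partial>lborel) \<le> ennreal (y n powr (2 * s) * T)"
              using T0 by (simp add: ennreal_mult)
          qed (use T0 in simp)
          finally show ?thesis .
        qed
        have "(\<lambda>n. y n powr (2 * s) * T) \<longlonglongrightarrow> 0 powr (2 * s) * T"
          using s y by (intro tendsto_intros tendsto_powr') (auto simp: less_imp_le)
        then have "(\<lambda>n. y n powr (2 * s) * T) \<longlonglongrightarrow> 0" by simp
        then show ?thesis
          by (rule tendsto_sandwich[rotated 3, OF _ _ _ tendsto_const]) (use bd T0 in \<open>auto simp: max_def\<close>)
      qed
    qed
  qed simp
  then have "(\<lambda>n. 2 * (\<integral>x. max 0 (a n x) \<partial>lborel)) \<longlonglongrightarrow> 2 * 0"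
    by (intro tendsto_intros) simp
  then show ?thesis by (simp add: e)
qed

text \<open>The error is subadditive and bounded by a multiple of the L^1 norm, uniformly in the
  height, so L^1 limits inherit convergence. Outer regularity leads from open sets to Borel sets,
  and the induction for integrable functions does the rest.\<close>

lemma ext_error_tendsto_0:
  fixes f :: "real^'n \<Rightarrow> real"
  assumes s: "0 < s" and f: "integrable lborel f" and y: "\<And>n::nat. 0 < y n" "y \<longlonglongrightarrow> 0"
  shows "(\<lambda>n. ext_error s (y n) f) \<longlonglongrightarrow> 0"
proof -
  let ?c = "kernel_mass TYPE('n) s"
  have c: "0 < ?c" using kernel_mass(1)[OF s, where 'n='n] .
  have e0: "0 \<le> ext_error s (y n) f" for n and f :: "real^'n \<Rightarrow> real" unfolding ext_error_def by (intro integral_nonneg_AE) auto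
  have approx: "(\<lambda>n. ext_error s (y n) f) \<longlonglongrightarrow> 0"
    if f: "integrable lborel f" and g: "\<And>e. 0 < e \<Longrightarrow> \<exists>g. integrable lborel g \<and> (\<lambda>n. ext_error s (y n) g) \<longlonglongrightarrow> 0 \<and> (\<integral>x. \<bar>f x - g x\<bar> \<partial>lborel) < e"
    for f :: "real^'n \<Rightarrow> real"
  proof (rule LIMSEQ_I)
    fix r :: real assume r: "0 < r"
    obtain g where g: "integrable lborel g" "(\<lambda>n. ext_error s (y n) g) \<longlonglongrightarrow> 0" "(\<integral>x. \<bar>f x - g x\<bar> \<partial>lborel) < r / (4 * ?c)"
      using g[of "r / (4 * ?c)"] r c by auto
    obtain n0 where n0: "\<And>n. n \<ge> n0 \<Longrightarrow> norm (ext_error s (y n) g - 0) < r / 2" using LIMSEQ_D[OF g(2), of "r / 2"] r by auto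
    have "norm (ext_error s (y n) f - 0) < r" if "n \<ge> n0" for n
    proof -
      have fg: "integrable lborel (\<lambda>x. f x - g x)" using f g by simp
      have "ext_error s (y n) f = ext_error s (y n) (\<lambda>x. g x + (f x - g x))" by simp
      also have "\<dots> \<le> ext_error s (y n) g + ext_error s (y n) (\<lambda>x. f x - g x)"
        by (rule ext_error_add[OF s y(1) g(1) fg])
      also have "ext_error s (y n) (\<lambda>x. f x - g x) \<le> 2 * ?c * (\<integral>x. \<bar>f x - g x\<bar> \<partial>lborel)"
        by (rule ext_error_le[OF s y(1) fg])
      also have "\<dots> < 2 * ?c * (r / (4 * ?c))" using g(3) c by (intro mult_strict_left_mono) auto
      also have "\<dots> = r / 2" using c by simp
      finally show ?thesis using n0[OF that] e0[of n f] by simp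
    qed
    then show "\<exists>no. \<forall>n\<ge>no. norm (ext_error s (y n) f - 0) < r" by blast
  qed
  show ?thesis using f
  proof (induction f rule: integrable_induct)
    case (base A k)
    have A: "A \<in> sets borel" "emeasure lborel A < \<infinity>" using base by auto
    have iA: "integrable lborel (indicator A :: real^'n \<Rightarrow> real)" using A by (intro integrable_real_indicator) auto
    have "(\<lambda>n. ext_error s (y n) (indicator A)) \<longlonglongrightarrow> 0"
    proof (rule approx[OF iA])
      fix e :: real assume e: "0 < e"
      obtain U where U: "open U" "A \<subseteq> U" "emeasure lborel (U - A) < ennreal (e / 2)"
        using outer_regular_lborel[of A "e / 2"] A e by auto
      have Uf: "emeasure lborel U < \<infinity>"
      proof -
        have "emeasure lborel U \<le> emeasure lborel (A \<union> (U - A))" using U A by (intro emeasure_mono) auto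
        also have "\<dots> \<le> emeasure lborel A + emeasure lborel (U - A)" using U A by (intro emeasure_subadditive) auto
        also have "\<dots> < \<infinity>" using A(2) order.strict_trans[OF U(3) ennreal_less_top] by simp
        finally show ?thesis .
      qed
      have UA: "emeasure lborel (U - A) < \<infinity>" using U(3) by (auto elim: order_less_trans)
      have "(\<integral>x. \<bar>indicator A x - indicator U x :: real\<bar> \<partial>lborel) = (\<integral>x. indicator (U - A) x \<partial>lborel)"
        using U(2) by (intro Bochner_Integration.integral_cong) (auto simp: indicator_def)
      also have "\<dots> = measure lborel (U - A)" using UA by simp
      also have "\<dots> \<le> e / 2" unfolding measure_def using U(3) e by (intro enn2real_leI) auto
      also have "\<dots> < e" using e by simp
      finally show "\<exists>g. integrable lborel g \<and> (\<lambda>n. ext_error s (y n) g) \<longlonglongrightarrow> 0 \<and> (\<integral>x. \<bar>indicator A x - g x\<bar> \<partial>lborel) < e"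
        using ext_error_indicator_open[OF s U(1) Uf y] U(1) Uf
        by (intro exI[of _ "indicator U"]) (auto intro!: integrable_real_indicator)
    qed
    then have "(\<lambda>n. \<bar>k\<bar> * ext_error s (y n) (indicator A)) \<longlonglongrightarrow> \<bar>k\<bar> * 0" by (intro tendsto_intros)
    moreover have "ext_error s (y n) (\<lambda>x. indicator A x *\<^sub>R k) = \<bar>k\<bar> * ext_error s (y n) (indicator A)" for n
    proof -
      have "\<bar>ext s (\<lambda>x. indicator A x * k) x (y n) - ?c * (indicator A x * k)\<bar> = \<bar>k\<bar> * \<bar>ext s (indicator A) x (y n) - ?c * indicator A x\<bar>" for x
        unfolding ext_scale abs_mult[symmetric] by (simp add: algebra_simps)
      then show ?thesis by (simp add: ext_error_def)
    qed
    ultimately show ?case by simp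
  next
    case (add f g)
    have "(\<lambda>n. ext_error s (y n) f + ext_error s (y n) g) \<longlonglongrightarrow> 0 + 0" using add by (intro tendsto_intros)
    then have lim0: "(\<lambda>n. ext_error s (y n) f + ext_error s (y n) g) \<longlonglongrightarrow> 0" by simp
    show ?case
    proof (rule tendsto_sandwich[OF _ _ tendsto_const lim0])
      show "\<forall>\<^sub>F n in sequentially. 0 \<le> ext_error s (y n) (\<lambda>x. f x + g x)"
        by (intro always_eventually allI e0)
      show "\<forall>\<^sub>F n in sequentially. ext_error s (y n) (\<lambda>x. f x + g x) \<le> ext_error s (y n) f + ext_error s (y n) g"
        by (intro always_eventually allI ext_error_add s y add.hyps)
    qed
  next
    case (lim f v)
    show ?case
    proof (rule approx[OF lim.hyps(4)])
      fix e :: real assume e: "0 < e"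
      have "(\<lambda>i. \<integral>x. \<bar>f x - v i x\<bar> \<partial>lborel) \<longlonglongrightarrow> (\<integral>x. 0 \<partial>(lborel :: (real^'n) measure))"
      proof (rule integral_dominated_convergence[where w = "\<lambda>x. 3 * \<bar>f x\<bar>"])
        show "integrable lborel (\<lambda>x. 3 * \<bar>f x\<bar>)" using lim.hyps(4) by simp
        show "(\<lambda>x. \<bar>f x - v i x\<bar>) \<in> borel_measurable lborel" for i using lim.hyps(1)[of i] lim.hyps(4) by measurable
        show "AE x in lborel. norm \<bar>f x - v i x\<bar> \<le> 3 * \<bar>f x\<bar>" for i
        proof (intro AE_I2)
          fix x :: "real^'n" 
          have "\<bar>v i x\<bar> \<le> 2 * \<bar>f x\<bar>" using lim.hyps(3)[of x i] by simp
          then show "norm \<bar>f x - v i x\<bar> \<le> 3 * \<bar>f x\<bar>" using abs_triangle_ineq4[of "f x" "v i x"] by simp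
        qed
        show "AE x in lborel. (\<lambda>i. \<bar>f x - v i x\<bar>) \<longlonglongrightarrow> 0"
        proof (intro AE_I2)
          fix x :: "real^'n" 
          have "(\<lambda>i. \<bar>f x - v i x\<bar>) \<longlonglongrightarrow> \<bar>f x - f x\<bar>" using lim.hyps(2)[of x] by (intro tendsto_intros) simp
          then show "(\<lambda>i. \<bar>f x - v i x\<bar>) \<longlonglongrightarrow> 0" by simp
        qed
      qed simp
      then have "\<exists>i. norm ((\<integral>x. \<bar>f x - v i x\<bar> \<partial>lborel) - 0) < e" using LIMSEQ_D[of _ 0 e] e by fastforce
      then show "\<exists>g. integrable lborel g \<and> (\<lambda>n. ext_error s (y n) g) \<longlonglongrightarrow> 0 \<and> (\<integral>x. \<bar>f x - g x\<bar> \<partial>lborel) < e"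
        using lim.hyps(1) lim.IH by (auto simp: abs_less_iff)
    qed
  qed
qed

section \<open>Nodal components and their traces\<close>

text \<open>On a set of finite measure |u| \<le> 1 + u^2 suffices. Integrability makes
  \<open>ext\<close> a genuine integral instead of the default value 0.\<close>

lemma X0_integrable:
  fixes u :: "real^'n \<Rightarrow> real"
  assumes u: "u \<in> X0 \<Omega> s" and \<Omega>: "open \<Omega>" "bounded \<Omega>"
  shows "integrable lborel u"
proof (rule Bochner_Integration.integrable_bound[where f = "\<lambda>x. indicator \<Omega> x + (u x)^2"])
  have "emeasure lborel \<Omega> < \<infinity>" using \<Omega> by (intro emeasure_bounded_finite)
  then show "integrable lborel (\<lambda>x. indicator \<Omega> x + (u x)^2)"
    using \<Omega> Lp_pow_2(2)[OF X0_H_s[OF u]] by (intro Bochner_Integration.integrable_add integrable_real_indicator) auto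
  show "u \<in> borel_measurable lborel" using H_s_measurable[OF X0_H_s[OF u]] by simp
  have "AE x in lborel. x \<notin> \<Omega> \<longrightarrow> u x = 0" using u by (simp add: X0_def)
  then show "AE x in lborel. norm (u x) \<le> norm (indicator \<Omega> x + (u x)^2)"
  proof eventually_elim
    case (elim x)
    have "\<bar>u x\<bar> \<le> 1 + (u x)^2"
    proof (cases "\<bar>u x\<bar> \<le> 1")
      case False
      then have "\<bar>u x\<bar> * 1 \<le> \<bar>u x\<bar> * \<bar>u x\<bar>" by (intro mult_left_mono) auto
      then show ?thesis by (simp add: power2_eq_square)
    qed (simp add: add_increasing2)
    then show ?case using elim by (cases "x \<in> \<Omega>") auto
  qed
qed

text \<open>Closedness is the issue: a limit of points of \<open>D\<close> can leave
  \<open>D\<close> only through zeros of the extension of \<open>w\<close>. There the extension of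
  \<open>f\<close>, being smaller, would be at most 0, while it stays at least \<eta> in the limit.
  So the limit is a point of the nonzero set, in which the component \<open>D\<close> is relatively
  closed.\<close>

lemma ext_superlevel_compact:
  fixes f w :: "real^'n \<Rightarrow> real"
  assumes s: "0 < s" and f: "integrable lborel f" "AE \<xi> in lborel. M < norm \<xi> \<longrightarrow> f \<xi> = 0"
    and w: "integrable lborel w" "\<And>x y. 0 < y \<Longrightarrow> ext s f x y \<le> ext s w x y"
    and D: "D \<in> components {p. 0 < snd p \<and> ext s w (fst p) (snd p) \<noteq> 0}"
    and \<eta>: "0 < \<eta>" and a: "0 < a"
  shows "compact {p \<in> D. a \<le> snd p \<and> \<eta> \<le> ext s f (fst p) (snd p)}" (is "compact ?K")
proof -
  define L where "L = (\<integral>\<xi>. \<bar>f \<xi>\<bar> \<partial>lborel)"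
  have L: "0 \<le> L" by (simp add: L_def)
  define b where "b = max 1 (L / \<eta>)"
  define r where "r = b powr (2 * s) * L / \<eta> + 1"
  have b1: "1 \<le> b" by (simp add: b_def)
  have r1: "1 \<le> r" using L \<eta> by (simp add: r_def)
  define A where "A = {p::(real^'n)\<times>real. 0 < snd p \<and> ext s w (fst p) (snd p) \<noteq> 0}"
  have bd: "snd p \<le> b \<and> norm (fst p) \<le> M + r" if p: "p \<in> ?K" for p
  proof -
    have y: "0 < snd p" "\<eta> \<le> ext s f (fst p) (snd p)" using p a by auto
    have 1: "snd p \<le> b"
    proof (rule ccontr)
      assume "\<not> snd p \<le> b"
      then have big: "1 < snd p" "L / \<eta> < snd p" by (auto simp: b_def)
      have "\<eta> \<le> snd p powr - real CARD('n) * L"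
        using abs_ext_le_height[OF s y(1) f(1), of "fst p"] y(2) by (simp add: L_def)
      also have "\<dots> \<le> snd p powr - 1 * L"
      proof (intro mult_right_mono powr_mono)
        have "0 < CARD('n)" by simp
        then have "1 \<le> real CARD('n)" by linarith
        then show "- real CARD('n) \<le> - 1" by simp
      qed (use big L in auto)
      also have "\<dots> = L / snd p" using y by (simp add: powr_minus_divide)
      finally have "snd p \<le> L / \<eta>" using \<eta> y by (simp add: field_simps)
      then show False using big by simp
    qed
    have 2: "norm (fst p) \<le> M + r"
    proof (rule ccontr)
      assume "\<not> norm (fst p) \<le> M + r"
      then have "\<bar>ext s f (fst p) (snd p)\<bar> \<le> snd p powr (2 * s) * r powr - (real CARD('n) + 2 * s) * L"
        unfolding L_def using r1 by (intro abs_ext_le_far[OF s y(1) f]) auto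
      also have "\<dots> \<le> b powr (2 * s) * r powr - 1 * L"
      proof (intro mult_right_mono mult_mono powr_mono2 powr_mono)
        have "0 < CARD('n)" by simp
        then have "1 \<le> real CARD('n)" by linarith
        then show "- (real CARD('n) + 2 * s) \<le> - 1" using s by linarith
      qed (use 1 y s r1 L in auto)
      also have "\<dots> = (b powr (2 * s) * L) / r" using r1 by (simp add: powr_minus_divide)
      also have "\<dots> < \<eta>"
      proof -
        have "b powr (2 * s) * L < \<eta> * r" using \<eta> by (simp add: r_def field_simps)
        then show ?thesis using r1 by (simp add: divide_less_eq)
      qed
      finally show False using y(2) by simp
    qed
    show ?thesis using 1 2 by simp
  qed
  have "bounded ?K"
    unfolding bounded_iff
  proof (intro exI ballI)
    fix p assume p: "p \<in> ?K"
    have "norm p \<le> norm (fst p) + norm (snd p)" using norm_Pair_le[of "fst p" "snd p"] by simp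
    then show "norm p \<le> M + r + b" using bd[OF p] p a by auto
  qed
  moreover have "closed ?K"
    unfolding closed_sequential_limits
  proof (intro allI impI, elim conjE)
    fix x :: "nat \<Rightarrow> (real^'n) \<times> real" and l
    assume x: "\<forall>n. x n \<in> ?K" and lim: "x \<longlonglongrightarrow> l"
    have la: "a \<le> snd l"
      using tendsto_snd[OF lim] x by (intro LIMSEQ_le_const) auto
    then have l0: "l \<in> {p. 0 < snd p}" using a by simp
    have op: "open {p::(real^'n) \<times> real. 0 < snd p}"
      by (intro open_Collect_less continuous_intros)
    have "isCont (\<lambda>p. ext s f (fst p) (snd p)) l"
      using continuous_on_ext[OF s f(1)] l0 unfolding continuous_on_eq_continuous_at[OF op] by blast
    then have "(\<lambda>n. ext s f (fst (x n)) (snd (x n))) \<longlonglongrightarrow> ext s f (fst l) (snd l)"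
      using lim by (rule isCont_tendsto_compose)
    then have lV: "\<eta> \<le> ext s f (fst l) (snd l)" using x by (intro LIMSEQ_le_const) auto
    then have "0 < ext s w (fst l) (snd l)" using w(2)[of "snd l" "fst l"] \<eta> l0 by simp
    then have lA: "l \<in> A" using l0 by (simp add: A_def)
    have "closedin (top_of_set A) D" unfolding A_def by (rule closedin_component[OF D])
    then obtain T where T: "closed T" "D = A \<inter> T" unfolding closedin_closed by blast
    have "l \<in> T" using T x lim unfolding closed_sequential_limits by blast
    then have "l \<in> D" using T lA by blast
    then show "l \<in> ?K" using la lV by simp
  qed
  ultimately show ?thesis by (simp add: compact_eq_bounded_closed)
qed

lemma open_ne_zero_ext:
  fixes w :: "real^'n \<Rightarrow> real"
  assumes s: "0 < s" and w: "integrable lborel w"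
  shows "open {p. 0 < snd p \<and> ext s w (fst p) (snd p) \<noteq> 0}"
proof -
  have op: "open {p::(real^'n) \<times> real. 0 < snd p}"
    by (intro open_Collect_less continuous_intros)
  have "open ({p. 0 < snd p} \<inter> (\<lambda>p. ext s w (fst p) (snd p)) -` (- {0}))"
    by (rule continuous_open_preimage[OF continuous_on_ext[OF s w] op]) auto
  moreover have "{p. 0 < snd p} \<inter> (\<lambda>p. ext s w (fst p) (snd p)) -` (- {0}) = {p. 0 < snd p \<and> ext s w (fst p) (snd p) \<noteq> 0}"
    by auto
  ultimately show ?thesis by simp
qed

text \<open>Above x the extension tends to a nonzero multiple of u x, so a short vertical segment
  avoids the zero set and, being connected, cannot be shared between components.\<close>

lemma vertical_segment_in_component:
  fixes u :: "real^'n \<Rightarrow> real"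
  assumes s: "0 < s" and u: "integrable lborel u"
    and D: "D \<in> components {p. 0 < snd p \<and> ext s u (fst p) (snd p) \<noteq> 0}"
    and G: "(\<integral>\<^sup>+y. ennreal ((u x - u y)^2 * frac_kernel s (x - y)) \<partial>lborel) < \<infinity>" and ux: "u x \<noteq> 0"
  shows "\<exists>\<delta>>0. (\<forall>y. 0 < y \<and> y < \<delta> \<longrightarrow> (x, y) \<in> D) \<or> (\<forall>y. 0 < y \<and> y < \<delta> \<longrightarrow> (x, y) \<notin> D)"
proof -
  have "kernel_mass TYPE('n) s * u x \<noteq> 0" using kernel_mass(1)[OF s, where 'n='n] ux by simp
  then have "\<forall>\<^sub>F y in at_right 0. ext s u x y \<noteq> 0"
    using tendsto_imp_eventually_ne[OF ext_tendsto_trace[OF s u G]] by simp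
  then obtain \<delta> where \<delta>: "0 < \<delta>" "\<And>y. 0 < y \<Longrightarrow> y < \<delta> \<Longrightarrow> ext s u x y \<noteq> 0"
    unfolding eventually_at_right_field by auto
  define T where "T = Pair x ` {0<..<\<delta>}"
  have "connected T" unfolding T_def
    by (intro connected_continuous_image continuous_intros connected_Ioo)
  moreover have "T \<subseteq> {p. 0 < snd p \<and> ext s u (fst p) (snd p) \<noteq> 0}" using \<delta> by (auto simp: T_def)
  ultimately have "D \<inter> T \<noteq> {} \<longrightarrow> T \<subseteq> D" using components_maximal[OF D] by blast
  then show ?thesis using \<delta>(1) by (intro exI[of _ \<delta>]) (auto simp: T_def image_subset_iff)
qed

lemma AE_gagliardo_density_finite:
  fixes u :: "real^'n \<Rightarrow> real"
  assumes u: "H_s s u"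
  shows "AE x in lborel. (\<integral>\<^sup>+y. ennreal ((u x - u y)^2 * frac_kernel s (x - y)) \<partial>lborel) < \<infinity>"
proof -
  note [measurable] = H_s_measurable[OF u]
  have "(\<integral>\<^sup>+x. \<integral>\<^sup>+y. ennreal ((u x - u y)^2 * frac_kernel s (x - y)) \<partial>lborel \<partial>lborel) \<noteq> \<infinity>"
    using u by (simp add: H_s_def gagliardo_eq_kernel less_top)
  then have "AE x in lborel. (\<integral>\<^sup>+y. ennreal ((u x - u y)^2 * frac_kernel s (x - y)) \<partial>lborel) \<noteq> \<infinity>"
    by (intro nn_integral_PInf_AE) auto
  then show ?thesis by (simp add: less_top)
qed

text \<open>Only the heights \<open>1 / (n + 1)\<close> are used, to make the set visibly Borel; above almost every point with
  \<open>u \<noteq> 0\<close> a short vertical segment lies in a single component anyway.\<close>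

definition trace_set :: "((real^'n) \<times> real) set \<Rightarrow> (real^'n \<Rightarrow> real) \<Rightarrow> (real^'n) set" where
  "trace_set D u = {x. 0 < u x \<and> (\<exists>m. \<forall>n\<ge>m. (x, 1 / real (Suc n)) \<in> D)}"

definition trace_part :: "((real^'n) \<times> real) set \<Rightarrow> (real^'n \<Rightarrow> real) \<Rightarrow> real^'n \<Rightarrow> real" where
  "trace_part D u x = indicator (trace_set D u) x * u x"

lemma slice_open:
  fixes D :: "((real^'n) \<times> real) set"
  assumes "open D"
  shows "open {x. (x, y) \<in> D}"
proof -
  have "continuous_on UNIV (\<lambda>x::real^'n. (x, y))" by (intro continuous_intros)
  then show ?thesis using continuous_open_preimage[of UNIV "\<lambda>x. (x, y)" D] assms by (simp add: vimage_def)
qed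

lemma trace_part_measurable:
  fixes u :: "real^'n \<Rightarrow> real"
  assumes D: "open D" and [measurable]: "u \<in> borel_measurable borel"
  shows "trace_set D u \<in> sets borel" "trace_part D u \<in> borel_measurable borel"
proof -
  have [measurable]: "{x. (x, y) \<in> D} \<in> sets borel" for y using slice_open[OF D] by simp
  have "trace_set D u = {x. 0 < u x} \<inter> (\<Union>m. \<Inter>n\<in>{m..}. {x. (x, 1 / real (Suc n)) \<in> D})"
    by (auto simp: trace_set_def)
  also have "\<dots> \<in> sets borel"
    by (intro sets.Int sets.countable_UN sets.countable_INT'') auto
  finally show *[measurable]: "trace_set D u \<in> sets borel" .
  show "trace_part D u \<in> borel_measurable borel" unfolding trace_part_def by measurable
qed

lemma trace_part_nonneg: "0 \<le> trace_part D u x"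
  by (auto simp: trace_part_def trace_set_def indicator_def)

lemma trace_part_cases: "trace_part D u x = 0 \<or> (trace_part D u x = u x \<and> 0 < u x)"
  by (auto simp: trace_part_def trace_set_def indicator_def)

text \<open>The maximum principle is applied to the extension of \<open>u - u1\<close> above a level
  \<eta> > 0, which keeps superlevel sets compact away from height 0; at the end \<eta> tends to 0.
  On the part of the boundary seen from \<open>D\<close> the datum \<open>u - u1\<close> has no
  positive part, because what is positive there has been put into \<open>u1\<close>. Slice integrals
  at small heights therefore tend to 0.\<close>

lemma ext_le_ext_trace_part:
  fixes u :: "real^'n \<Rightarrow> real"
  assumes s: "0 < s" "s < 1" and u: "u \<in> X0 \<Omega> s" and \<Omega>: "open \<Omega>" "bounded \<Omega>"
    and D: "D \<in> components {p. 0 < snd p \<and> ext s u (fst p) (snd p) \<noteq> 0}"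
    and p: "p \<in> D"
  shows "ext s u (fst p) (snd p) \<le> ext s (trace_part D u) (fst p) (snd p)"
proof -
  let ?c = "kernel_mass TYPE('n) s"
  have c: "0 < ?c" using kernel_mass(1)[OF s(1), where 'n='n] .
  define A where "A = {p. 0 < snd p \<and> ext s u (fst p) (snd p) \<noteq> 0}"
  have H: "H_s s u" using u by (rule X0_H_s)
  have iu: "integrable lborel u" by (rule X0_integrable[OF u \<Omega>])
  note [measurable] = H_s_measurable[OF H]
  have opA: "open A" unfolding A_def by (rule open_ne_zero_ext[OF s(1) iu])
  have opD: "open D" using open_components[OF opA] D unfolding A_def by blast
  have DA: "D \<subseteq> A" using in_components_subset[OF D] unfolding A_def .
  define u1 where "u1 = trace_part D u"
  have [measurable]: "u1 \<in> borel_measurable borel" unfolding u1_def by (rule trace_part_measurable[OF opD]) measurable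
  have u1c: "u1 x = 0 \<or> (u1 x = u x \<and> 0 < u x)" for x unfolding u1_def by (rule trace_part_cases)
  have u1n: "0 \<le> u1 x" for x unfolding u1_def by (rule trace_part_nonneg)
  have iu1: "integrable lborel u1"
  proof (rule Bochner_Integration.integrable_bound[OF iu])
    have "norm (u1 x) \<le> norm (u x)" for x using u1c[of x] by auto
    then show "AE x in lborel. norm (u1 x) \<le> norm (u x)" by simp
  qed simp
  define f where "f x = u x - u1 x" for x
  have if_: "integrable lborel f" unfolding f_def using iu iu1 by simp
  obtain M where M: "\<And>x. x \<in> \<Omega> \<Longrightarrow> norm x \<le> M" using \<Omega>(2) unfolding bounded_iff by blast
  have "AE \<xi> in lborel. \<xi> \<notin> \<Omega> \<longrightarrow> u \<xi> = 0" using u by (simp add: X0_def)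
  then have fM: "AE \<xi> in lborel. M < norm \<xi> \<longrightarrow> f \<xi> = 0"
  proof eventually_elim
    case (elim x)
    then show ?case using M[of x] u1c[of x] by (auto simp: f_def)
  qed
  have fw: "ext s f x y \<le> ext s u x y" if "0 < y" for x y
    unfolding f_def using ext_diff[OF s(1) that iu iu1, of x] ext_nonneg[of u1 s x y] u1n by simp
  have main: "ext s f (fst p) (snd p) \<le> \<eta>" if \<eta>: "0 < \<eta>" and p: "p \<in> D" for \<eta> p
  proof (rule ccontr)
    assume not: "\<not> ext s f (fst p) (snd p) \<le> \<eta>"
    define q where "q x y = (if (x, y) \<in> D then max 0 (ext s f x y - \<eta>) else 0)" for x y
    obtain x0 y0 where xy: "p = (x0, y0)" by (cases p)
    have y0: "0 < y0" using DA p xy by (auto simp: A_def)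
    have K: "compact {p \<in> D. a \<le> snd p \<and> \<eta> \<le> ext s f (fst p) (snd p)}" if "0 < a" for a
      by (rule ext_superlevel_compact[OF s(1) if_ fM iu fw D \<eta> that])
    have D0: "D \<subseteq> {p. 0 < snd p}" using DA by (auto simp: A_def)
    note mp = slice_integral_maximum_principle[OF s opD D0 continuous_on_ext[OF s(1) if_] K disc_op_ext[OF s _ _ if_], folded q_def]
    define y where "y n = 1 / real (Suc n)" for n
    have y: "0 < y n" for n by (simp add: y_def)
    have ylim: "y \<longlonglongrightarrow> 0"
      using LIMSEQ_inverse_real_of_nat by (simp add: y_def[abs_def] inverse_eq_divide)
    \<comment> \<open>Exceptional points: positive for \<open>u\<close> and below a point of
      \<open>D\<close> at height \<open>y n\<close>, yet not counted in the trace set. Almost every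
      x lies in \<open>B n\<close> for only finitely many n, since a vertical segment over x is
      eventually in \<open>D\<close> or eventually outside.\<close>
    define B where "B n = {x. (x, y n) \<in> D \<and> x \<notin> trace_set D u \<and> 0 < u x}" for n
    have [measurable]: "B n \<in> sets borel" for n
    proof -
      have "B n = {x. (x, y n) \<in> D} \<inter> - trace_set D u \<inter> {x. 0 < u x}" by (auto simp: B_def)
      also have "\<dots> \<in> sets borel"
      proof (intro sets.Int)
        show "{x. (x, y n) \<in> D} \<in> sets borel" using slice_open[OF opD] by simp
        show "- trace_set D u \<in> sets borel" using trace_part_measurable(1)[OF opD, of u] by (intro borel_comp) simp
        show "{x. 0 < u x} \<in> sets borel" by measurable
      qed
      finally show ?thesis .
    qed
    have iB: "integrable lborel (\<lambda>x. ?c * (indicator (B n) x * \<bar>u x\<bar>))" for n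
    proof -
      have "integrable lborel (\<lambda>x. indicator (B n) x * \<bar>u x\<bar>)"
        by (rule Bochner_Integration.integrable_bound[OF iu]) (auto simp: indicator_def)
      then show ?thesis by simp
    qed
    define E where "E n = ext_error s (y n) u + (\<integral>x. ?c * (indicator (B n) x * \<bar>u x\<bar>) \<partial>lborel) + ext_error s (y n) u1" for n
    have "(\<lambda>n. \<integral>x. ?c * (indicator (B n) x * \<bar>u x\<bar>) \<partial>lborel) \<longlonglongrightarrow> (\<integral>x. 0 \<partial>(lborel :: (real^'n) measure))"
    proof (rule integral_dominated_convergence[where w = "\<lambda>x. ?c * \<bar>u x\<bar>"])
      show "integrable lborel (\<lambda>x. ?c * \<bar>u x\<bar>)" using iu by simp
      show "(\<lambda>x. ?c * (indicator (B n) x * \<bar>u x\<bar>)) \<in> borel_measurable lborel" for n by measurable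
      show "AE x in lborel. norm (?c * (indicator (B n) x * \<bar>u x\<bar>)) \<le> ?c * \<bar>u x\<bar>" for n
        using c by (intro AE_I2) (auto simp: indicator_def)
      show "AE x in lborel. (\<lambda>n. ?c * (indicator (B n) x * \<bar>u x\<bar>)) \<longlonglongrightarrow> 0"
        using AE_gagliardo_density_finite[OF H]
      proof eventually_elim
        case (elim x)
        show ?case
        proof (cases "0 < u x")
          case True
          then obtain d where d: "0 < d" "(\<forall>y. 0 < y \<and> y < d \<longrightarrow> (x, y) \<in> D) \<or> (\<forall>y. 0 < y \<and> y < d \<longrightarrow> (x, y) \<notin> D)"
            using vertical_segment_in_component[OF s(1) iu D elim] by auto
          obtain m where m: "\<And>n. n \<ge> m \<Longrightarrow> y n < d"
            using order_tendstoD(2)[OF ylim d(1)] unfolding eventually_sequentially by blast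
          have "x \<notin> B n" if n: "n \<ge> m" for n
          proof
            assume xB: "x \<in> B n"
            then have "(x, y n) \<in> D" by (simp add: B_def)
            then have "\<forall>y. 0 < y \<and> y < d \<longrightarrow> (x, y) \<in> D" using d(2) y[of n] m[OF n] by blast
            then have "\<forall>k\<ge>m. (x, y k) \<in> D" using m y by blast
            then have "x \<in> trace_set D u" using True unfolding trace_set_def y_def by blast
            then show False using xB by (simp add: B_def)
          qed
          then have "\<forall>\<^sub>F n in sequentially. ?c * (indicator (B n) x * \<bar>u x\<bar>) = 0"
            unfolding eventually_sequentially by (intro exI[of _ m]) auto
          then show ?thesis by (rule tendsto_eventually)
        next
          case False
          then have "x \<notin> B n" for n by (simp add: B_def)
          then show ?thesis by simp
        qed
      qed
    qed simp
    then have Elim: "E \<longlonglongrightarrow> 0 + 0 + 0" unfolding E_def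
      using ext_error_tendsto_0[OF s(1) iu y ylim] ext_error_tendsto_0[OF s(1) iu1 y ylim] by (intro tendsto_add) auto
    have qE: "(\<integral>x. q x (y n) \<partial>lborel) \<le> E n" if n: "y n < y0" for n
    proof -
      have "(\<integral>x. q x (y n) \<partial>lborel) \<le> (\<integral>x. (\<bar>ext s u x (y n) - ?c * u x\<bar> + ?c * (indicator (B n) x * \<bar>u x\<bar>)) + \<bar>ext s u1 x (y n) - ?c * u1 x\<bar> \<partial>lborel)"
      proof (rule integral_mono)
        show "integrable lborel (\<lambda>x. q x (y n))" by (rule mp(1)[OF _ _ _ y n]) auto
        show "integrable lborel (\<lambda>x. (\<bar>ext s u x (y n) - ?c * u x\<bar> + ?c * (indicator (B n) x * \<bar>u x\<bar>)) + \<bar>ext s u1 x (y n) - ?c * u1 x\<bar>)"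
          by (intro Bochner_Integration.integrable_add integrable_ext_error s(1) y iu iu1 iB)
        fix x
        have RHS: "0 \<le> (\<bar>ext s u x (y n) - ?c * u x\<bar> + ?c * (indicator (B n) x * \<bar>u x\<bar>)) + \<bar>ext s u1 x (y n) - ?c * u1 x\<bar>"
          using c by (intro add_nonneg_nonneg mult_nonneg_nonneg) auto
        have "ext s f x (y n) \<le> (\<bar>ext s u x (y n) - ?c * u x\<bar> + ?c * (indicator (B n) x * \<bar>u x\<bar>)) + \<bar>ext s u1 x (y n) - ?c * u1 x\<bar>"
          if "(x, y n) \<in> D"
        proof -
          \<comment> \<open>Below a point of \<open>D\<close>, either u x \<le> 0, or x is in the
            trace set and the difference is 0, or x is exceptional.\<close>
          have "u x - u1 x \<le> indicator (B n) x * \<bar>u x\<bar>"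
            using that by (auto simp: u1_def trace_part_def B_def indicator_def)
          then have "?c * (u x - u1 x) \<le> ?c * (indicator (B n) x * \<bar>u x\<bar>)" using c by (intro mult_left_mono) auto
          moreover have "ext s f x (y n) = ext s u x (y n) - ext s u1 x (y n)"
            unfolding f_def by (rule ext_diff[OF s(1) y iu iu1])
          moreover have "ext s u x (y n) - ext s u1 x (y n) = (ext s u x (y n) - ?c * u x) + ?c * (u x - u1 x) - (ext s u1 x (y n) - ?c * u1 x)"
            by (simp add: algebra_simps)
          ultimately show ?thesis
            using abs_ge_self[of "ext s u x (y n) - ?c * u x"] abs_ge_minus_self[of "ext s u1 x (y n) - ?c * u1 x"] by linarith
        qed
        then show "q x (y n) \<le> (\<bar>ext s u x (y n) - ?c * u x\<bar> + ?c * (indicator (B n) x * \<bar>u x\<bar>)) + \<bar>ext s u1 x (y n) - ?c * u1 x\<bar>"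
          using RHS \<eta> by (auto simp: q_def max_def)
      qed
      also have "\<dots> = E n"
        unfolding E_def ext_error_def
        by (subst Bochner_Integration.integral_add, intro Bochner_Integration.integrable_add integrable_ext_error s(1) y iu iu1 iB,
            intro integrable_ext_error s(1) y iu1, subst Bochner_Integration.integral_add, intro integrable_ext_error s(1) y iu, rule iB, rule refl)
      finally show ?thesis .
    qed
    have "(\<integral>x. q x y0 \<partial>lborel) \<le> 0"
    proof (rule LIMSEQ_le_const)
      show "E \<longlonglongrightarrow> 0" using Elim by simp
      obtain m where m: "\<And>n. n \<ge> m \<Longrightarrow> y n < y0"
        using order_tendstoD(2)[OF ylim y0] unfolding eventually_sequentially by blast
      show "\<exists>N. \<forall>n\<ge>N. (\<integral>x. q x y0 \<partial>lborel) \<le> E n"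
      proof (intro exI allI impI)
        fix n assume n: "m \<le> n"
        have "(\<integral>x. q x y0 \<partial>lborel) \<le> (\<integral>x. q x (y n) \<partial>lborel)" by (rule mp(2)[OF _ _ _ y m[OF n]]) auto
        also have "\<dots> \<le> E n" by (rule qE[OF m[OF n]])
        finally show "(\<integral>x. q x y0 \<partial>lborel) \<le> E n" .
      qed
    qed
    moreover have iq: "integrable lborel (\<lambda>x. q x y0)" by (rule mp(1)[OF _ _ _ y0, of "y0 + 1"]) auto
    moreover have q0: "0 \<le> q x y0" for x by (simp add: q_def)
    ultimately have "(\<integral>x. q x y0 \<partial>lborel) = 0" by (intro antisym integral_nonneg_AE) auto
    then have AE0: "AE x in lborel. q x y0 = 0" using integral_nonneg_eq_0_iff_AE[OF iq] q0 by auto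
    \<comment> \<open>A vanishing slice integral only gives q = 0 almost everywhere; but q is
      positive on the open set \<open>S\<close>, which contains x0 and hence a ball of positive
      measure.\<close>
    define S where "S = {x. (x, y0) \<in> D} \<inter> {x. \<eta> < ext s f x y0}"
    have "continuous_on UNIV (\<lambda>x. ext s f (fst (x, y0)) (snd (x, y0)))"
      by (rule continuous_on_compose2[OF continuous_on_ext[OF s(1) if_]]) (use y0 in \<open>auto intro!: continuous_intros\<close>)
    then have "open {x. \<eta> < ext s f x y0}" by (intro open_Collect_less) auto
    then have opS: "open S" unfolding S_def using slice_open[OF opD] by auto
    have "x0 \<in> S" using p not xy by (simp add: S_def)
    then obtain r where r: "0 < r" "ball x0 r \<subseteq> S" using opS open_contains_ball_eq by blast
    have "AE x in lborel. x \<notin> ball x0 r"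
      using AE0
    proof eventually_elim
      case (elim x)
      then show ?case using r(2) by (auto simp: S_def q_def max_def split: if_splits)
    qed
    then have "emeasure lborel (ball x0 r) = 0"
      by (subst (asm) AE_iff_measurable[where N="ball x0 r"]) auto
    moreover have "0 < emeasure lborel (ball x0 r)"
      using r unit_ball_pos[where 'a="real^'n"] by (simp add: emeasure_ball_unit)
    ultimately show False by simp
  qed
  have "ext s f (fst p) (snd p) \<le> 0"
    by (rule field_le_epsilon) (use main[OF _ p] in simp)
  moreover have "0 < snd p" using DA p by (auto simp: A_def)
  ultimately show ?thesis
    using ext_diff[OF s(1) _ iu iu1, of "snd p" "fst p"] unfolding f_def u1_def by simp
qed


text \<open>Here g is the rest of the positive part and h the negative part of \<open>u\<close>. On
  \<open>D\<close> the comparison of extensions says that the extension of g is at most that of h.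
  Divided by y^(2s) along heights tending to 0, this becomes the inequality of interactions required
  by \<open>frac_inner_piece\<close>: Fatou's lemma handles g, and the bound of the kernel by its
  limit handles h, so neither side has to be finite.\<close>

lemma trace_part_frac_inner:
  fixes u :: "real^'n \<Rightarrow> real"
  assumes s: "0 < s" "s < 1" and u: "u \<in> X0 \<Omega> s" and \<Omega>: "open \<Omega>" "bounded \<Omega>"
    and D: "D \<in> components {p. 0 < snd p \<and> ext s u (fst p) (snd p) \<noteq> 0}"
  shows "trace_part D u \<in> X0 \<Omega> s" "frac_inner s (trace_part D u) (trace_part D u) \<le> frac_inner s u (trace_part D u)"
proof -
  have H: "H_s s u" using u by (rule X0_H_s)
  have iu: "integrable lborel u" by (rule X0_integrable[OF u \<Omega>])
  note [measurable] = H_s_measurable[OF H]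
  have opD: "open D" using open_components[OF open_ne_zero_ext[OF s(1) iu]] D by blast
  define f where "f = trace_part D u"
  define g where "g x = max 0 (u x) - f x" for x
  define h where "h x = max 0 (- u x)" for x
  have [measurable]: "f \<in> borel_measurable borel" unfolding f_def by (rule trace_part_measurable[OF opD]) measurable
  have [measurable]: "g \<in> borel_measurable borel" "h \<in> borel_measurable borel" unfolding g_def h_def by measurable
  have fc: "f x = 0 \<or> (f x = u x \<and> 0 < u x)" for x unfolding f_def by (rule trace_part_cases)
  have nn: "0 \<le> f x" "0 \<le> g x" "0 \<le> h x" for x using fc[of x] by (auto simp: g_def h_def)
  have d: "f x * g x = 0" "f x * h x = 0" "g x * h x = 0" for x using fc[of x] by (auto simp: g_def h_def max_def)
  have ueq: "u x = f x + g x - h x" for x by (auto simp: g_def h_def max_def)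
  have le_u: "\<bar>f x\<bar> \<le> \<bar>u x\<bar>" "\<bar>g x\<bar> \<le> \<bar>u x\<bar>" "\<bar>h x\<bar> \<le> \<bar>u x\<bar>" for x using fc[of x] by (auto simp: g_def h_def max_def)
  have int: "integrable lborel f" "integrable lborel g" "integrable lborel h"
    by (rule Bochner_Integration.integrable_bound[OF iu]; use le_u in simp)+
  have key: "(\<integral>\<^sup>+\<xi>. ennreal (g \<xi> * frac_kernel s (x - \<xi>)) \<partial>lborel) \<le> (\<integral>\<^sup>+\<xi>. ennreal (h \<xi> * frac_kernel s (x - \<xi>)) \<partial>lborel)"
    if "f x \<noteq> 0" for x
  proof -
    from that have "x \<in> trace_set D u" by (auto simp: f_def trace_part_def indicator_def)
    then obtain m where m: "\<And>n. n \<ge> m \<Longrightarrow> (x, 1 / real (Suc n)) \<in> D" by (auto simp: trace_set_def)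
    define y where "y n = 1 / real (Suc (n + m))" for n
    have y: "0 < y n" for n by (simp add: y_def)
    have ylim: "y \<longlonglongrightarrow> 0"
      using LIMSEQ_ignore_initial_segment[OF LIMSEQ_inverse_real_of_nat, of m] by (simp add: y_def[abs_def] inverse_eq_divide)
    have yD: "(x, y n) \<in> D" for n using m[of "n + m"] by (simp add: y_def)
    have gh: "ext s g x (y n) \<le> ext s h x (y n)" for n
    proof -
      have "ext s u x (y n) \<le> ext s f x (y n)"
        using ext_le_ext_trace_part[OF s u \<Omega> D yD[of n]] by (simp add: f_def)
      moreover have "ext s u x (y n) = ext s (\<lambda>x. f x + g x) x (y n) - ext s h x (y n)"
        unfolding ueq[abs_def] using int by (intro ext_diff[OF s(1) y]) auto
      moreover have "ext s (\<lambda>x. f x + g x) x (y n) = ext s f x (y n) + ext s g x (y n)"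
        by (rule ext_add[OF s(1) y int(1,2)])
      ultimately show ?thesis by linarith
    qed
    \<comment> \<open>Poisson kernel divided by y^(2s); away from the origin it stays below
      \<open>frac_kernel\<close> and converges to it.\<close>
    define k where "k n z = 1 / ((y n)^2 + (norm z)^2) powr ((real CARD('n) + 2 * s) / 2)" for n and z :: "real^'n"
    have k0: "0 \<le> k n z" for n z by (simp add: k_def)
    have [measurable]: "k n \<in> borel_measurable borel" for n unfolding k_def by measurable
    have kP: "ext_kernel s z (y n) = y n powr (2 * s) * k n z" for n z by (simp add: ext_kernel_def k_def)
    have extk: "(\<integral>\<^sup>+\<xi>. ennreal (v \<xi> * k n (x - \<xi>)) \<partial>lborel) = ennreal (y n powr - (2 * s) * ext s v x (y n))"
      if v: "integrable lborel v" "\<And>x. 0 \<le> v x" for v n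
    proof -
      have "ext s v x (y n) = y n powr (2 * s) * (\<integral>\<xi>. v \<xi> * k n (x - \<xi>) \<partial>lborel)"
        unfolding ext_def kP by (simp add: mult_ac flip: integral_mult_right_zero)
      then have eq: "y n powr - (2 * s) * ext s v x (y n) = (\<integral>\<xi>. v \<xi> * k n (x - \<xi>) \<partial>lborel)"
        using y[of n] by (simp add: powr_minus)
      have "integrable lborel (\<lambda>\<xi>. y n powr - (2 * s) * (ext_kernel s (x - \<xi>) (y n) * v \<xi>))"
        using integrable_ext[OF s(1) y v(1)] by simp
      moreover have "(\<lambda>\<xi>. y n powr - (2 * s) * (ext_kernel s (x - \<xi>) (y n) * v \<xi>)) = (\<lambda>\<xi>. v \<xi> * k n (x - \<xi>))"
        unfolding kP using y[of n] by (auto simp: powr_minus)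
      ultimately have "integrable lborel (\<lambda>\<xi>. v \<xi> * k n (x - \<xi>))" by simp
      then show ?thesis unfolding eq using v(2) k0 by (intro nn_integral_eq_integral) auto
    qed
    have klim: "(\<lambda>n. k n z) \<longlonglongrightarrow> frac_kernel s z" if "z \<noteq> 0" for z
    proof -
      have "(\<lambda>n. 1 / ((y n)^2 + (norm z)^2) powr ((real CARD('n) + 2 * s) / 2)) \<longlonglongrightarrow> 1 / (0^2 + (norm z)^2) powr ((real CARD('n) + 2 * s) / 2)"
        using that by (intro tendsto_intros ylim) auto
      then show ?thesis unfolding k_def frac_kernel_def by (simp add: norm_sq_powr_half)
    qed
    have kle: "k n z \<le> frac_kernel s z" if "z \<noteq> 0" for n z
      using ext_kernel_le_frac_kernel[OF s(1) that, of "y n"] y[of n] unfolding kP by simp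
    have "(\<integral>\<^sup>+\<xi>. ennreal (g \<xi> * frac_kernel s (x - \<xi>)) \<partial>lborel) \<le> (\<integral>\<^sup>+\<xi>. liminf (\<lambda>n. ennreal (g \<xi> * k n (x - \<xi>))) \<partial>lborel)"
    proof (intro nn_integral_mono)
      fix \<xi>
      show "ennreal (g \<xi> * frac_kernel s (x - \<xi>)) \<le> liminf (\<lambda>n. ennreal (g \<xi> * k n (x - \<xi>)))"
      \<comment> \<open>On the diagonal the kernel is 1/0 = 0, so nothing is to be shown
        there.\<close>
      proof (cases "x = \<xi>")
        case False
        have "(\<lambda>n. ennreal (g \<xi> * k n (x - \<xi>))) \<longlonglongrightarrow> ennreal (g \<xi> * frac_kernel s (x - \<xi>))"
          using False by (intro tendsto_ennrealI tendsto_intros klim) auto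
        then show ?thesis using lim_imp_Liminf[OF sequentially_bot] by fastforce
      qed (simp add: frac_kernel_def)
    qed
    also have "\<dots> \<le> liminf (\<lambda>n. \<integral>\<^sup>+\<xi>. ennreal (g \<xi> * k n (x - \<xi>)) \<partial>lborel)"
      by (intro nn_integral_liminf) measurable
    also have "\<dots> \<le> (\<integral>\<^sup>+\<xi>. ennreal (h \<xi> * frac_kernel s (x - \<xi>)) \<partial>lborel)"
    proof (intro Liminf_le always_eventually allI sequentially_bot)
      fix n
      have "(\<integral>\<^sup>+\<xi>. ennreal (g \<xi> * k n (x - \<xi>)) \<partial>lborel) \<le> (\<integral>\<^sup>+\<xi>. ennreal (h \<xi> * k n (x - \<xi>)) \<partial>lborel)"
        unfolding extk[OF int(2) nn(2)] extk[OF int(3) nn(3)] using gh[of n] by (intro ennreal_leI mult_left_mono) auto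
      also have "\<dots> \<le> (\<integral>\<^sup>+\<xi>. ennreal (h \<xi> * frac_kernel s (x - \<xi>)) \<partial>lborel)"
        using AE_lborel_singleton[of x]
        by (intro nn_integral_mono_AE) (auto elim!: eventually_mono intro!: ennreal_leI mult_left_mono kle nn)
      finally show "(\<integral>\<^sup>+\<xi>. ennreal (g \<xi> * k n (x - \<xi>)) \<partial>lborel) \<le> (\<integral>\<^sup>+\<xi>. ennreal (h \<xi> * frac_kernel s (x - \<xi>)) \<partial>lborel)" .
    qed
    finally show ?thesis .
  qed
  have "cross_energy s f g \<le> cross_energy s f h"
    unfolding cross_energy_def
  proof (rule nn_integral_mono)
    fix x
    have pull: "(\<integral>\<^sup>+y. ennreal (f x * v y * frac_kernel s (x - y)) \<partial>lborel) = ennreal (f x) * (\<integral>\<^sup>+y. ennreal (v y * frac_kernel s (x - y)) \<partial>lborel)"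
      if [measurable]: "v \<in> borel_measurable borel" and "\<And>y. 0 \<le> v y" for v
      using that(2) nn(1)[of x] by (subst nn_integral_cmult[symmetric]) (auto simp: ennreal_mult mult.assoc intro!: nn_integral_cong)
    show "(\<integral>\<^sup>+y. ennreal (f x * g y * frac_kernel s (x - y)) \<partial>lborel) \<le> (\<integral>\<^sup>+y. ennreal (f x * h y * frac_kernel s (x - y)) \<partial>lborel)"
    proof (cases "f x = 0")
      case False
      then show ?thesis
        unfolding pull[OF \<open>g \<in> borel_measurable borel\<close> nn(2)] pull[OF \<open>h \<in> borel_measurable borel\<close> nn(3)]
        using key by (intro mult_left_mono) auto
    qed simp
  qed
  note P = frac_inner_piece[OF s H ueq _ _ _ nn d this]
  have "H_s s f" by (rule P(1)) measurable
  moreover have "AE x in lborel. x \<notin> \<Omega> \<longrightarrow> u x = 0" using u by (simp add: X0_def)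
  then have "AE x in lborel. x \<notin> \<Omega> \<longrightarrow> f x = 0"
    by eventually_elim (use le_u(1) in \<open>metis abs_le_zero_iff abs_zero\<close>)
  ultimately show "trace_part D u \<in> X0 \<Omega> s" by (simp add: X0_def f_def)
  show "frac_inner s (trace_part D u) (trace_part D u) \<le> frac_inner s u (trace_part D u)"
    unfolding f_def[symmetric] by (rule P(2)) measurable
qed

text \<open>A null trace would have extension 0, which could not dominate the positive value at
  \<open>p\<close>.\<close>

lemma trace_part_nonzero:
  fixes u :: "real^'n \<Rightarrow> real"
  assumes s: "0 < s" "s < 1" and u: "u \<in> X0 \<Omega> s" and \<Omega>: "open \<Omega>" "bounded \<Omega>"
    and D: "D \<in> components {p. 0 < snd p \<and> ext s u (fst p) (snd p) \<noteq> 0}"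
    and pos: "p \<in> D" "0 < ext s u (fst p) (snd p)"
  shows "\<not> zero_ae (trace_part D u)"
proof
  assume "zero_ae (trace_part D u)"
  then have "AE \<xi> in lborel. ext_kernel s (fst p - \<xi>) (snd p) * trace_part D u \<xi> = 0"
    unfolding zero_ae_def by eventually_elim simp
  then have "ext s (trace_part D u) (fst p) (snd p) = 0"
    unfolding ext_def by (rule integral_eq_zero_AE)
  then show False using ext_le_ext_trace_part[OF s u \<Omega> D pos(1)] pos(2) by simp
qed

text \<open>A common point of both trace sets would have a point above it, at a height with large
  enough index, in both components.\<close>

lemma trace_parts_disjoint:
  assumes "D \<in> components A" "D' \<in> components A" "D \<noteq> D'"
  shows "trace_part D u x * trace_part D' u x = 0"
proof -
  have disj: "D \<inter> D' = {}" using components_nonoverlap[OF assms(1,2)] assms(3) by blast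
  have "x \<notin> trace_set D u \<or> x \<notin> trace_set D' u"
  proof (rule ccontr)
    assume "\<not> (x \<notin> trace_set D u \<or> x \<notin> trace_set D' u)"
    then obtain m m' where "\<forall>n\<ge>m. (x, 1 / real (Suc n)) \<in> D" "\<forall>n\<ge>m'. (x, 1 / real (Suc n)) \<in> D'"
      by (auto simp: trace_set_def)
    then have "(x, 1 / real (Suc (max m m'))) \<in> D \<inter> D'" by simp
    then show False using disj by blast
  qed
  then show ?thesis by (auto simp: trace_part_def)
qed

section \<open>Upper bound on the least energy\<close>

definition sobolev_quotient :: "real \<Rightarrow> (real^'n \<Rightarrow> real) \<Rightarrow> real" where
  "sobolev_quotient s u = frac_inner s u u / Lp_pow (crit_exp CARD('n) s) u powr (2 / crit_exp CARD('n) s)"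

text \<open>Infimum over functions carried by \<Omega>, not over the whole space. The lower bound
  for pieces and the upper bound for the least energy both refer to it, so its value and its
  attainment never matter.\<close>

definition best_constant :: "(real^'n) set \<Rightarrow> real \<Rightarrow> real" where
  "best_constant \<Omega> s = (INF u \<in> {u \<in> X0 \<Omega> s. \<not> zero_ae u}. sobolev_quotient s u)"

lemma Lp_pow_eq_nn_integral:
  fixes u :: "real^'n \<Rightarrow> real"
  assumes [measurable]: "u \<in> borel_measurable borel"
  shows "Lp_pow p u = enn2real (\<integral>\<^sup>+x. ennreal (\<bar>u x\<bar> powr p) \<partial>lborel)"
  unfolding Lp_pow_def by (intro integral_eq_nn_integral) auto

lemma frac_inner_self_nonneg:
  fixes u :: "real^'n \<Rightarrow> real"
  assumes "0 < s" "s < 1" "u \<in> borel_measurable borel"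
  shows "0 \<le> frac_inner s u u"
  using C_Ns_pos[OF assms(1,2), of "CARD('n)"] by (simp add: frac_inner_self[OF assms(3)])

lemma Lp_pow_pos:
  fixes u :: "real^'n \<Rightarrow> real"
  assumes "integrable lborel (\<lambda>x. \<bar>u x\<bar> powr p)" "\<not> zero_ae u"
  shows "0 < Lp_pow p u"
proof -
  have "Lp_pow p u \<noteq> 0"
  proof
    assume "Lp_pow p u = 0"
    then have "AE x in lborel. \<bar>u x\<bar> powr p = 0"
      using integral_nonneg_eq_0_iff_AE[OF assms(1)] by (simp add: Lp_pow_def)
    then have "zero_ae u" unfolding zero_ae_def by eventually_elim simp
    then show False using assms(2) by simp
  qed
  moreover have "0 \<le> Lp_pow p u" by (simp add: Lp_pow_def)
  ultimately show ?thesis by simp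
qed

lemma best_constant:
  fixes \<Omega> :: "(real^'n) set"
  assumes s: "0 < s" "s < 1" "2 * s < real CARD('n)" and \<Omega>: "open \<Omega>" "\<Omega> \<noteq> {}"
  shows "0 < best_constant \<Omega> s"
    and "\<And>u. u \<in> X0 \<Omega> s \<Longrightarrow> \<not> zero_ae u \<Longrightarrow> best_constant \<Omega> s * Lp_pow (crit_exp CARD('n) s) u powr (2 / crit_exp CARD('n) s) \<le> frac_inner s u u"
    and "\<And>\<theta>. best_constant \<Omega> s < \<theta> \<Longrightarrow> \<exists>u\<in>X0 \<Omega> s. \<not> zero_ae u \<and> frac_inner s u u < \<theta> * Lp_pow (crit_exp CARD('n) s) u powr (2 / crit_exp CARD('n) s)"
proof -
  define p where "p = crit_exp CARD('n) s"
  define c where "c = C_Ns CARD('n) s / (2 * sobolev_const TYPE('n) s)"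
  have c: "0 < c" using C_Ns_pos[OF s(1,2), of "CARD('n)"] sobolev_const_pos[where 'n='n and s=s] by (simp add: c_def)
  let ?A = "{u \<in> X0 \<Omega> s. \<not> zero_ae u}"
  have pos: "0 < Lp_pow p u powr (2 / p)" if "u \<in> ?A" for u
    using Lp_pow_pos[of u p] sobolev(1)[OF s X0_H_s] that by (fastforce simp: p_def)
  have ge: "c \<le> sobolev_quotient s u" if u: "u \<in> ?A" for u
    using sobolev(2)[OF s X0_H_s, of u \<Omega>] pos[OF u] u unfolding sobolev_quotient_def c_def p_def
    by (simp add: pos_le_divide_eq)
  have ne: "?A \<noteq> {}" using X0_nontrivial[OF \<Omega> s(1,2)] by blast
  have "c \<le> best_constant \<Omega> s" unfolding best_constant_def using ne ge by (intro cINF_greatest)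
  then show "0 < best_constant \<Omega> s" using c by simp
  have bdd: "bdd_below (sobolev_quotient s ` ?A)" using ge by (intro bdd_belowI2)
  show "best_constant \<Omega> s * Lp_pow (crit_exp CARD('n) s) u powr (2 / crit_exp CARD('n) s) \<le> frac_inner s u u"
    if u: "u \<in> X0 \<Omega> s" "\<not> zero_ae u" for u
  proof -
    have "best_constant \<Omega> s \<le> sobolev_quotient s u" unfolding best_constant_def using u by (intro cINF_lower bdd) auto
    then show ?thesis using pos[of u] u by (simp add: sobolev_quotient_def p_def pos_le_divide_eq)
  qed
  show "\<exists>u\<in>X0 \<Omega> s. \<not> zero_ae u \<and> frac_inner s u u < \<theta> * Lp_pow (crit_exp CARD('n) s) u powr (2 / crit_exp CARD('n) s)"
    if \<theta>: "best_constant \<Omega> s < \<theta>" for \<theta>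
  proof -
    obtain u where u: "u \<in> ?A" "sobolev_quotient s u < \<theta>"
      using \<theta> unfolding best_constant_def cINF_less_iff[OF ne bdd] by blast
    then show ?thesis using pos[OF u(1)] by (auto simp: sobolev_quotient_def p_def pos_divide_less_eq)
  qed
qed

lemma lambda1_le:
  fixes \<Omega> :: "(real^'n) set"
  assumes s: "0 < s" "s < 1" and u: "u \<in> X0 \<Omega> s"
  shows "lambda1 \<Omega> s * Lp_pow 2 u \<le> frac_inner s u u"
proof (cases "zero_ae u")
  case True
  have "Lp_pow 2 u = 0" unfolding Lp_pow_def
    by (rule integral_eq_zero_AE) (use True in \<open>auto simp: zero_ae_def elim: eventually_mono\<close>)
  then show ?thesis using frac_inner_self_nonneg[OF s H_s_measurable[OF X0_H_s[OF u]]] by simp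
next
  case False
  have H: "H_s s u" using u by (rule X0_H_s)
  have pos: "0 < Lp_pow 2 u" using Lp_pow_2(2)[OF H] False by (intro Lp_pow_pos) auto
  have "lambda1 \<Omega> s \<le> frac_inner s u u / Lp_pow 2 u"
    unfolding lambda1_def
  proof (rule cINF_lower)
    show "bdd_below ((\<lambda>u. frac_inner s u u / Lp_pow 2 u) ` {u \<in> X0 \<Omega> s. \<not> zero_ae u})"
      using frac_inner_self_nonneg[OF s] H_s_measurable[OF X0_H_s]
      by (intro bdd_belowI2[of _ 0] divide_nonneg_nonneg) (auto simp: Lp_pow_def)
    show "u \<in> {u \<in> X0 \<Omega> s. \<not> zero_ae u}" using u False by simp
  qed
  then show ?thesis using pos by (simp add: pos_le_divide_eq)
qed

lemma lambda1_ge: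
  fixes \<Omega> :: "(real^'n) set"
  assumes s: "0 < s" "s < 1" and \<Omega>: "open \<Omega>" "\<Omega> \<noteq> {}"
    and c: "\<And>u. u \<in> X0 \<Omega> s \<Longrightarrow> c * Lp_pow 2 u \<le> frac_inner s u u"
  shows "c \<le> lambda1 \<Omega> s"
  unfolding lambda1_def
proof (rule cINF_greatest)
  show "{u \<in> X0 \<Omega> s. \<not> zero_ae u} \<noteq> {}" using X0_nontrivial[OF \<Omega> s] by blast
  fix u assume u: "u \<in> {u \<in> X0 \<Omega> s. \<not> zero_ae u}"
  then have "0 < Lp_pow 2 u" using Lp_pow_2(2)[OF X0_H_s] by (intro Lp_pow_pos) auto
  then show "c \<le> frac_inner s u u / Lp_pow 2 u" using c[of u] u by (simp add: pos_le_divide_eq)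
qed

lemma pos_part_X0: "u \<in> X0 \<Omega> s \<Longrightarrow> pos_part u \<in> X0 \<Omega> s"
  and neg_part_X0: "u \<in> X0 \<Omega> s \<Longrightarrow> neg_part u \<in> X0 \<Omega> s"
proof -
  assume u: "u \<in> X0 \<Omega> s"
  note [measurable] = H_s_measurable[OF X0_H_s[OF u]]
  have m: "pos_part u \<in> borel_measurable borel" "neg_part u \<in> borel_measurable borel"
    unfolding pos_part_def neg_part_def by measurable
  show "pos_part u \<in> X0 \<Omega> s" by (rule X0_contraction[OF u m(1)]) (auto simp: pos_part_def)
  show "neg_part u \<in> X0 \<Omega> s" by (rule X0_contraction[OF u m(2)]) (auto simp: neg_part_def)
qed

lemma abs_powr_minus_2_mult:
  fixes a q :: real
  shows "\<bar>a\<bar> powr (q - 2) * a * a = \<bar>a\<bar> powr q"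
proof -
  have "\<bar>a\<bar> powr (q - 2 + 2) = \<bar>a\<bar> powr (q - 2) * \<bar>a\<bar> powr 2" by (rule powr_add)
  moreover have "\<bar>a\<bar> powr 2 = a * a" by (simp add: power2_eq_square flip: abs_mult)
  ultimately show ?thesis by (simp only: diff_add_cancel mult.assoc)
qed

text \<open>The two constraints add up to I'(u)[u] = 0, which eliminates the quadratic part of the
  energy; the remaining factor 1/2 - 1/p equals s/N.\<close>

lemma nehari_energy:
  fixes u :: "real^'n \<Rightarrow> real"
  assumes s: "0 < s" "s < 1" "2 * s < real CARD('n)" and u: "u \<in> nodal_nehari \<Omega> s lam"
  shows "energy s lam u = s / real CARD('n) * Lp_pow (crit_exp CARD('n) s) u"
proof -
  define p where "p = crit_exp CARD('n) s"
  have X: "u \<in> X0 \<Omega> s" and d: "denergy s lam u (pos_part u) = 0" "denergy s lam u (neg_part u) = 0"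
    using u by (auto simp: nodal_nehari_def)
  note P = pos_part_X0[OF X] and M = neg_part_X0[OF X]
  note H = X0_H_s[OF X] and HP = X0_H_s[OF P] and HM = X0_H_s[OF M]
  note [measurable] = H_s_measurable[OF H] H_s_measurable[OF HP] H_s_measurable[OF HM]
  have split: "u x = pos_part u x + neg_part u x" for x by (auto simp: pos_part_def neg_part_def)
  have "frac_inner s u u = frac_inner s u (\<lambda>x. pos_part u x + neg_part u x)" by (simp flip: split)
  also have "\<dots> = frac_inner s u (pos_part u) + frac_inner s u (neg_part u)"
    by (rule frac_inner_add_right[OF H HP HM])
  finally have F: "frac_inner s u u = frac_inner s u (pos_part u) + frac_inner s u (neg_part u)" .
  have i2: "integrable lborel (\<lambda>x. u x * pos_part u x)" "integrable lborel (\<lambda>x. u x * neg_part u x)"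
    by (rule Bochner_Integration.integrable_bound[OF Lp_pow_2(2)[OF H]];
        auto simp: pos_part_def neg_part_def power2_eq_square abs_mult max_def min_def)+
  have "Lp_pow 2 u = (\<integral>x. u x * pos_part u x + u x * neg_part u x \<partial>lborel)"
    unfolding Lp_pow_2(3)[OF H] by (intro Bochner_Integration.integral_cong) (auto simp: power2_eq_square pos_part_def neg_part_def)
  then have L: "Lp_pow 2 u = (\<integral>x. u x * pos_part u x \<partial>lborel) + (\<integral>x. u x * neg_part u x \<partial>lborel)"
    using i2 by simp
  have ip: "integrable lborel (\<lambda>x. \<bar>u x\<bar> powr (p - 2) * u x * v x)"
    if [measurable]: "v \<in> borel_measurable borel" and v: "\<And>x. v x = 0 \<or> v x = u x" for v
  proof (rule Bochner_Integration.integrable_bound[OF sobolev(1)[OF s H]])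
    show "AE x in lborel. norm (\<bar>u x\<bar> powr (p - 2) * u x * v x) \<le> norm (\<bar>u x\<bar> powr crit_exp CARD('n) s)"
    proof (intro AE_I2)
      fix x show "norm (\<bar>u x\<bar> powr (p - 2) * u x * v x) \<le> norm (\<bar>u x\<bar> powr crit_exp CARD('n) s)"
        using v[of x] abs_powr_minus_2_mult[of "u x" p] by (auto simp: p_def)
    qed
  qed measurable
  have pc: "pos_part u x = 0 \<or> pos_part u x = u x" "neg_part u x = 0 \<or> neg_part u x = u x" for x
    by (auto simp: pos_part_def neg_part_def)
  have "Lp_pow p u = (\<integral>x. \<bar>u x\<bar> powr (p - 2) * u x * pos_part u x + \<bar>u x\<bar> powr (p - 2) * u x * neg_part u x \<partial>lborel)"
    unfolding Lp_pow_def
    by (intro Bochner_Integration.integral_cong) (auto simp: distrib_left[symmetric] split[symmetric] abs_powr_minus_2_mult)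
  also have "\<dots> = (\<integral>x. \<bar>u x\<bar> powr (p - 2) * u x * pos_part u x \<partial>lborel) + (\<integral>x. \<bar>u x\<bar> powr (p - 2) * u x * neg_part u x \<partial>lborel)"
    by (intro Bochner_Integration.integral_add ip pc) measurable
  finally have Y: "Lp_pow p u = (\<integral>x. \<bar>u x\<bar> powr (p - 2) * u x * pos_part u x \<partial>lborel) + (\<integral>x. \<bar>u x\<bar> powr (p - 2) * u x * neg_part u x \<partial>lborel)" .
  have "frac_inner s u u - lam * Lp_pow 2 u = Lp_pow p u"
    using d unfolding denergy_def F L p_def Y[unfolded p_def] by (simp add: algebra_simps)
  then have "energy s lam u = 1/2 * Lp_pow p u - 1 / p * Lp_pow p u"
    by (simp add: energy_def p_def)
  also have "\<dots> = (1 - 2 / p) / 2 * Lp_pow p u" by (simp add: algebra_simps)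
  also have "(1 - 2 / p) / 2 = s / real CARD('n)"
    using crit_exp_props(3)[OF s(1,3), folded p_def, symmetric] by simp
  finally show ?thesis by (simp add: p_def)
qed

section \<open>Scaling and near minimisers\<close>

lemma gagliardo_cong_AE:
  assumes "AE x in lborel. u x = v x"
  shows "gagliardo s u = gagliardo s v"
  unfolding gagliardo_def
proof (rule nn_integral_cong_AE)
  show "AE x in lborel. (\<integral>\<^sup>+ y. ennreal ((u x - u y)^2 / norm (x - y) powr (real CARD('a) + 2 * s)) \<partial>lborel) =
      (\<integral>\<^sup>+ y. ennreal ((v x - v y)^2 / norm (x - y) powr (real CARD('a) + 2 * s)) \<partial>lborel)"
    using assms
  proof eventually_elim
    case (elim x)
    show ?case
    proof (rule nn_integral_cong_AE)
      show "AE y in lborel. ennreal ((u x - u y)^2 / norm (x - y) powr (real CARD('a) + 2 * s)) = ennreal ((v x - v y)^2 / norm (x - y) powr (real CARD('a) + 2 * s))"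
        using assms by eventually_elim (simp add: elim)
    qed
  qed
qed

text \<open>Two changes of variables contribute e^(2N), the kernel e^(-(N+2s)). The result e^(N-2s)
  = e^(2N/p) is also the factor of the squared L^p norm at the critical exponent, so concentration
  leaves the Sobolev quotient unchanged.\<close>

lemma gagliardo_rescale:
  fixes \<phi> :: "real^'n \<Rightarrow> real"
  assumes [measurable]: "\<phi> \<in> borel_measurable borel" and e: "0 < e"
  shows "gagliardo s (\<lambda>x. \<phi> ((1 / e) *\<^sub>R (x - a))) = ennreal (e powr (real CARD('n) - 2 * s)) * gagliardo s \<phi>"
proof -
  let ?f = "\<lambda>x y. ennreal ((\<phi> ((1 / e) *\<^sub>R (x - a)) - \<phi> ((1 / e) *\<^sub>R (y - a)))^2 * frac_kernel s (x - y))"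
  have k: "frac_kernel s (e *\<^sub>R x - e *\<^sub>R y) = e powr - (real CARD('n) + 2 * s) * frac_kernel s (x - y)" for x y :: "real^'n"
    using frac_kernel_scaleR[OF e, of s "x - y"] by (simp add: scaleR_right_diff_distrib)
  have "gagliardo s (\<lambda>x. \<phi> ((1 / e) *\<^sub>R (x - a))) = (\<integral>\<^sup>+x. \<integral>\<^sup>+y. ?f x y \<partial>lborel \<partial>lborel)"
    by (simp add: gagliardo_eq_kernel)
  also have "\<dots> = ennreal (e ^ CARD('n)) * (\<integral>\<^sup>+x. \<integral>\<^sup>+y. ?f (a + e *\<^sub>R x) y \<partial>lborel \<partial>lborel)"
    by (subst nn_integral_scale[where c = e and t = a]) (use e in auto)
  also have "(\<integral>\<^sup>+x. \<integral>\<^sup>+y. ?f (a + e *\<^sub>R x) y \<partial>lborel \<partial>lborel) = (\<integral>\<^sup>+x. ennreal (e ^ CARD('n)) * (\<integral>\<^sup>+y. ?f (a + e *\<^sub>R x) (a + e *\<^sub>R y) \<partial>lborel) \<partial>lborel)"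
    by (intro nn_integral_cong, subst nn_integral_scale[where c = e and t = a]) (use e in auto)
  also have "\<dots> = (\<integral>\<^sup>+x. ennreal (e ^ CARD('n)) * (ennreal (e powr - (real CARD('n) + 2 * s)) * (\<integral>\<^sup>+y. ennreal ((\<phi> x - \<phi> y)^2 * frac_kernel s (x - y)) \<partial>lborel)) \<partial>lborel)"
  proof (intro nn_integral_cong arg_cong2[where f = "(*)"] refl)
    fix x
    have "(\<integral>\<^sup>+y. ?f (a + e *\<^sub>R x) (a + e *\<^sub>R y) \<partial>lborel) = (\<integral>\<^sup>+y. ennreal (e powr - (real CARD('n) + 2 * s)) * ennreal ((\<phi> x - \<phi> y)^2 * frac_kernel s (x - y)) \<partial>lborel)"
      using e by (intro nn_integral_cong) (simp add: k mult_ac flip: ennreal_mult)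
    also have "\<dots> = ennreal (e powr - (real CARD('n) + 2 * s)) * (\<integral>\<^sup>+y. ennreal ((\<phi> x - \<phi> y)^2 * frac_kernel s (x - y)) \<partial>lborel)"
      by (intro nn_integral_cmult) measurable
    finally show "(\<integral>\<^sup>+y. ?f (a + e *\<^sub>R x) (a + e *\<^sub>R y) \<partial>lborel) = ennreal (e powr - (real CARD('n) + 2 * s)) * (\<integral>\<^sup>+y. ennreal ((\<phi> x - \<phi> y)^2 * frac_kernel s (x - y)) \<partial>lborel)" .
  qed
  also have "\<dots> = ennreal (e ^ CARD('n)) * (ennreal (e powr - (real CARD('n) + 2 * s)) * gagliardo s \<phi>)"
    by (simp add: nn_integral_cmult gagliardo_eq_kernel)
  finally have "gagliardo s (\<lambda>x. \<phi> ((1 / e) *\<^sub>R (x - a))) = (ennreal (e ^ CARD('n)) * ennreal (e ^ CARD('n)) * ennreal (e powr - (real CARD('n) + 2 * s))) * gagliardo s \<phi>"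
    by (simp add: mult.assoc)
  also have "ennreal (e ^ CARD('n)) * ennreal (e ^ CARD('n)) * ennreal (e powr - (real CARD('n) + 2 * s)) = ennreal (e powr (real CARD('n) - 2 * s))"
  proof -
    have "e ^ CARD('n) * e ^ CARD('n) * e powr - (real CARD('n) + 2 * s) = e powr (real CARD('n) - 2 * s)"
      using e by (simp add: powr_realpow[symmetric] powr_add[symmetric])
    then show ?thesis using e by (simp flip: ennreal_mult)
  qed
  finally show ?thesis .
qed

lemma nn_integral_rescale:
  fixes F :: "real^'n \<Rightarrow> ennreal"
  assumes [measurable]: "F \<in> borel_measurable borel" and e: "0 < e"
  shows "(\<integral>\<^sup>+x. F ((1 / e) *\<^sub>R (x - a)) \<partial>lborel) = ennreal (e ^ CARD('n)) * (\<integral>\<^sup>+x. F x \<partial>lborel)"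
  by (subst nn_integral_scale[where c = e and t = a]) (use e in auto)


text \<open>Taking the absolute value does not raise the energy. The change on a null set makes the
  function vanish outside \<Omega> everywhere, because the two rescaled copies used later must be
  disjoint at every point.\<close>

lemma nonneg_near_minimiser:
  fixes \<Omega> :: "(real^'n) set"
  assumes s: "0 < s" "s < 1" "2 * s < real CARD('n)" and \<Omega>: "open \<Omega>" "\<Omega> \<noteq> {}" and \<theta>: "best_constant \<Omega> s < \<theta>"
  shows "\<exists>\<phi>\<in>X0 \<Omega> s. (\<forall>x. 0 \<le> \<phi> x) \<and> (\<forall>x. x \<notin> \<Omega> \<longrightarrow> \<phi> x = 0) \<and> 0 < Lp_pow (crit_exp CARD('n) s) \<phi> \<and>
     frac_inner s \<phi> \<phi> < \<theta> * Lp_pow (crit_exp CARD('n) s) \<phi> powr (2 / crit_exp CARD('n) s)"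
proof -
  define p where "p = crit_exp CARD('n) s"
  obtain u where u: "u \<in> X0 \<Omega> s" "\<not> zero_ae u" "frac_inner s u u < \<theta> * Lp_pow p u powr (2 / p)"
    using best_constant(3)[OF s \<Omega> \<theta>] by (auto simp: p_def)
  have H: "H_s s u" using u(1) by (rule X0_H_s)
  note [measurable] = H_s_measurable[OF H]
  have [measurable]: "\<Omega> \<in> sets borel" using \<Omega> by simp
  define \<phi> where "\<phi> x = indicator \<Omega> x * \<bar>u x\<bar>" for x
  have [measurable]: "\<phi> \<in> borel_measurable borel" unfolding \<phi>_def by measurable
  have "AE x in lborel. x \<notin> \<Omega> \<longrightarrow> u x = 0" using u(1) by (simp add: X0_def)
  then have ae: "AE x in lborel. \<phi> x = \<bar>u x\<bar>" by eventually_elim (auto simp: \<phi>_def indicator_def)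
  have absm: "(\<lambda>x. \<bar>u x\<bar>) \<in> borel_measurable borel" by measurable
  have "H_s s (\<lambda>x. \<bar>u x\<bar>)" "gagliardo s (\<lambda>x. \<bar>u x\<bar>) \<le> gagliardo s u"
    using H_s_contraction[OF H absm] by (auto simp: abs_triangle_ineq3)
  moreover have g: "gagliardo s \<phi> = gagliardo s (\<lambda>x. \<bar>u x\<bar>)" by (rule gagliardo_cong_AE[OF ae])
  moreover have "(\<integral>\<^sup>+x. ennreal ((\<phi> x)^2) \<partial>lborel) = (\<integral>\<^sup>+x. ennreal ((\<bar>u x\<bar>)^2) \<partial>lborel)"
    by (rule nn_integral_cong_AE) (use ae in \<open>eventually_elim, simp\<close>)
  ultimately have H\<phi>: "H_s s \<phi>" and gle: "gagliardo s \<phi> \<le> gagliardo s u" by (auto simp: H_s_def)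
  have Y: "Lp_pow p \<phi> = Lp_pow p u"
    unfolding Lp_pow_def
  proof (rule integral_cong_AE)
    show "AE x in lborel. \<bar>\<phi> x\<bar> powr p = \<bar>u x\<bar> powr p" using ae by eventually_elim simp
  qed measurable
  have "frac_inner s \<phi> \<phi> \<le> frac_inner s u u"
    using gle H C_Ns_pos[OF s(1,2), of "CARD('n)"] unfolding frac_inner_self[OF \<open>\<phi> \<in> borel_measurable borel\<close>] frac_inner_self[OF H_s_measurable[OF H]]
    by (intro mult_left_mono enn2real_mono) (auto simp: H_s_def)
  then have "frac_inner s \<phi> \<phi> < \<theta> * Lp_pow p \<phi> powr (2 / p)" using u(3) Y by simp
  moreover have "0 < Lp_pow p u" using sobolev(1)[OF s H] u(2) unfolding p_def by (rule Lp_pow_pos)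
  then have "0 < Lp_pow p \<phi>" by (simp only: Y)
  moreover have "\<phi> \<in> X0 \<Omega> s" using H\<phi> by (simp add: X0_def \<phi>_def)
  ultimately show ?thesis by (intro bexI[of _ \<phi>]) (auto simp: p_def \<phi>_def)
qed

text \<open>The number \<alpha> maximises a^2 B / 2 - a^p Y / p, that is, it projects onto the
  Nehari set. The exponent N/(2s) equals p / (p - 2).\<close>

lemma nehari_energy_scalar:
  fixes N s p B Y :: real
  assumes "0 < s" "2 * s < N" and p: "p = 2 * N / (N - 2 * s)" and B: "0 < B" and Y: "0 < Y"
    and \<alpha>: "\<alpha> = (B / Y) powr (1 / (p - 2))"
  shows "\<alpha> powr (p - 2) * Y = B" "\<alpha> powr p * Y = (B / Y powr (2 / p)) powr (N / (2 * s))"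
proof -
  have p2: "p - 2 = 4 * s / (N - 2 * s)" using assms(1,2) by (simp add: p field_simps)
  then have p2': "0 < p - 2" using assms(1,2) by simp
  have "\<alpha> powr (p - 2) = B / Y" using p2' B Y by (simp add: \<alpha> powr_powr)
  then show "\<alpha> powr (p - 2) * Y = B" using Y by simp
  have e: "1 / (p - 2) * p = N / (2 * s)" unfolding p2 p using assms(1,2) by (simp add: field_simps)
  have e2: "2 / p * (N / (2 * s)) = N / (2 * s) - 1" unfolding p using assms(1,2) by (simp add: field_simps)
  have "\<alpha> powr p * Y = (B / Y) powr (N / (2 * s)) * Y" by (simp only: \<alpha> powr_powr e)
  also have "\<dots> = B powr (N / (2 * s)) / (Y powr (N / (2 * s)) / Y powr 1)" using B Y by (simp add: powr_divide)
  also have "Y powr (N / (2 * s)) / Y powr 1 = Y powr (2 / p * (N / (2 * s)))" unfolding e2 by (simp only: powr_diff)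
  also have "\<dots> = (Y powr (2 / p)) powr (N / (2 * s))" by (simp only: powr_powr)
  also have "B powr (N / (2 * s)) / \<dots> = (B / Y powr (2 / p)) powr (N / (2 * s))" using B Y by (simp add: powr_divide)
  finally show "\<alpha> powr p * Y = (B / Y powr (2 / p)) powr (N / (2 * s))" .
qed

text \<open>As \<open>f\<close> and \<open>g\<close> have equal norms, a single factor projects \<open>f - g\<close> onto the nodal Nehari set.\<close>

lemma nodal_nehari_two_bumps:
  fixes f g :: "real^'n \<Rightarrow> real" and s :: real
  defines "p \<equiv> crit_exp CARD('n) s"
  assumes s: "0 < s" "s < 1" "2 * s < real CARD('n)" and f: "f \<in> X0 \<Omega> s" and g: "g \<in> X0 \<Omega> s"
    and nn: "\<And>x. 0 \<le> f x" "\<And>x. 0 \<le> g x" and d: "\<And>x. f x * g x = 0"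
    and F: "frac_inner s g g = frac_inner s f f" and L: "Lp_pow 2 g = Lp_pow 2 f" and Y: "Lp_pow p g = Lp_pow p f" "0 < Lp_pow p f"
    and B: "B = frac_inner s f f - frac_inner s f g - lam * Lp_pow 2 f" "0 < B"
  shows "\<exists>v\<in>nodal_nehari \<Omega> s lam. energy s lam v = 2 * s / real CARD('n) * (B / Lp_pow p f powr (2 / p)) powr (real CARD('n) / (2 * s))"
proof -
  define \<alpha> where "\<alpha> = (B / Lp_pow p f) powr (1 / (p - 2))"
  have \<alpha>0: "0 < \<alpha>" using B Y by (simp add: \<alpha>_def)
  note sc = nehari_energy_scalar[OF s(1,3) _ B(2) Y(2) \<alpha>_def, unfolded p_def crit_exp_def, OF refl, folded crit_exp_def p_def]
  have Hf: "H_s s f" and Hg: "H_s s g" using f g by (auto intro: X0_H_s)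
  note [measurable] = H_s_measurable[OF Hf] H_s_measurable[OF Hg]
  define v where "v x = \<alpha> * f x + (- \<alpha>) * g x" for x
  have v: "v \<in> X0 \<Omega> s" unfolding v_def by (intro X0_add X0_scale f g)
  have fg: "f x = 0 \<or> g x = 0" for x using d[of x] by simp
  have vp: "pos_part v = (\<lambda>x. \<alpha> * f x)"
  proof
    fix x show "pos_part v x = \<alpha> * f x"
      using fg[of x] nn[of x] \<alpha>0 by (auto simp: pos_part_def v_def max_def mult_less_0_iff not_le)
  qed
  have vm: "neg_part v = (\<lambda>x. (- \<alpha>) * g x)"
  proof
    fix x show "neg_part v x = (- \<alpha>) * g x"
      using fg[of x] nn[of x] \<alpha>0 by (auto simp: neg_part_def v_def min_def mult_le_0_iff)
  qed
  have nz: "\<not> zero_ae (\<lambda>x. c * h x)" if "Lp_pow p h \<noteq> 0" "c \<noteq> 0" for c and h :: "real^'n \<Rightarrow> real"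
  proof
    assume "zero_ae (\<lambda>x. c * h x)"
    then have "AE x in lborel. \<bar>h x\<bar> powr p = 0" unfolding zero_ae_def by eventually_elim (use that in simp)
    then have "Lp_pow p h = 0" unfolding Lp_pow_def by (rule integral_eq_zero_AE)
    then show False using that by simp
  qed
  have ap: "\<alpha> powr p = \<alpha> powr (p - 2) * \<alpha>^2"
    using \<alpha>0 powr_add[of \<alpha> "p - 2" 2] by simp
  \<comment> \<open>By the symmetry between the bumps, testing with either of them gives \<alpha>^2
    (B - \<alpha>^(p-2) Y), and this vanishes by the choice of \<alpha>.\<close>
  have den: "denergy s lam v (\<lambda>x. c * h x) = 0"
    if ch: "(c = \<alpha> \<and> h = f) \<or> (c = - \<alpha> \<and> h = g)" for c and h :: "real^'n \<Rightarrow> real"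
  proof -
    have Hh: "H_s s h" using ch Hf Hg by auto
    have LH: "Lp_pow 2 h = Lp_pow 2 f" and YH: "Lp_pow p h = Lp_pow p f" using ch L Y by auto
    have vh: "v x * (c * h x) = \<alpha>^2 * (h x)^2" for x
      using ch fg[of x] by (auto simp: v_def power2_eq_square)
    have vh3: "\<bar>v x\<bar> powr (p - 2) * v x * (c * h x) = \<alpha> powr p * \<bar>h x\<bar> powr p" for x
    proof (cases "h x = 0")
      case False
      then have "v x = c * h x" using ch fg[of x] by (auto simp: v_def)
      moreover have "\<bar>c * h x\<bar> powr p = \<alpha> powr p * \<bar>h x\<bar> powr p"
        using ch \<alpha>0 by (auto simp: abs_mult powr_mult)
      ultimately show ?thesis using abs_powr_minus_2_mult[of "c * h x" p] by simp
    qed simp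
    have FV: "frac_inner s v h = \<alpha> * frac_inner s f h + (- \<alpha>) * frac_inner s g h"
      unfolding v_def by (subst frac_inner_add_left[OF Hh H_s_scale[OF Hf] H_s_scale[OF Hg]]) (simp only: frac_inner_scale_left)
    have FR: "frac_inner s v (\<lambda>x. c * h x) = \<alpha>^2 * (frac_inner s f f - frac_inner s f g)"
      unfolding frac_inner_scale_right FV using ch F frac_inner_commute[of s f g] by (auto simp: power2_eq_square algebra_simps)
    have "denergy s lam v (\<lambda>x. c * h x) = \<alpha>^2 * (frac_inner s f f - frac_inner s f g) - lam * (\<alpha>^2 * Lp_pow 2 f) - \<alpha> powr p * Lp_pow p f"
      unfolding denergy_def FR vh p_def[symmetric] vh3 using LH YH
      by (simp add: Lp_pow_2(3)[OF Hh, symmetric]) (simp add: Lp_pow_def)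
    also have "\<dots> = \<alpha>^2 * (B - \<alpha> powr (p - 2) * Lp_pow p f)" unfolding B(1) ap by (simp add: algebra_simps)
    also have "\<dots> = 0" using sc(1) by simp
    finally show ?thesis .
  qed
  have vN: "v \<in> nodal_nehari \<Omega> s lam"
    unfolding nodal_nehari_def using v den[of \<alpha> f] den[of "- \<alpha>" g] nz[of f \<alpha>] nz[of g "- \<alpha>"] \<alpha>0 Y by (simp add: vp vm)
  have ip: "integrable lborel (\<lambda>x. \<bar>f x\<bar> powr p)" "integrable lborel (\<lambda>x. \<bar>g x\<bar> powr p)"
    using sobolev(1)[OF s Hf] sobolev(1)[OF s Hg] by (auto simp: p_def)
  have "Lp_pow p v = (\<integral>x. \<alpha> powr p * \<bar>f x\<bar> powr p + \<alpha> powr p * \<bar>g x\<bar> powr p \<partial>lborel)"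
    unfolding Lp_pow_def
  proof (intro Bochner_Integration.integral_cong refl)
    fix x show "\<bar>v x\<bar> powr p = \<alpha> powr p * \<bar>f x\<bar> powr p + \<alpha> powr p * \<bar>g x\<bar> powr p"
      using fg[of x] \<alpha>0 by (auto simp: v_def abs_mult powr_mult)
  qed
  also have "\<dots> = \<alpha> powr p * Lp_pow p f + \<alpha> powr p * Lp_pow p g"
    using ip by (simp add: Lp_pow_def)
  finally have Yv: "Lp_pow p v = 2 * (\<alpha> powr p * Lp_pow p f)" using Y by simp
  have "energy s lam v = s / real CARD('n) * Lp_pow p v"
    unfolding p_def by (rule nehari_energy[OF s vN])
  then show ?thesis using vN unfolding Yv sc(2) by (intro bexI[of _ v]) auto
qed


lemma rescale_properties:
  fixes \<phi> :: "real^'n \<Rightarrow> real"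
  assumes s: "0 < s" "s < 1" and \<phi>: "\<phi> \<in> X0 \<Omega> s" and e: "0 < e"
    and supp: "\<And>x. x \<notin> \<Omega> \<Longrightarrow> \<phi> x = 0" "\<And>x. x \<in> \<Omega> \<Longrightarrow> a + e *\<^sub>R x \<in> \<Omega>"
  defines "\<psi> \<equiv> \<lambda>x. \<phi> ((1 / e) *\<^sub>R (x - a))"
  shows "\<psi> \<in> X0 \<Omega> s" "frac_inner s \<psi> \<psi> = e powr (real CARD('n) - 2 * s) * frac_inner s \<phi> \<phi>"
    "\<And>q. Lp_pow q \<psi> = e ^ CARD('n) * Lp_pow q \<phi>"
    "(\<integral>\<^sup>+x. ennreal (\<psi> x) \<partial>lborel) = ennreal (e ^ CARD('n)) * (\<integral>\<^sup>+x. ennreal (\<phi> x) \<partial>lborel)"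
proof -
  have H: "H_s s \<phi>" using \<phi> by (rule X0_H_s)
  note [measurable] = H_s_measurable[OF H]
  have m[measurable]: "\<psi> \<in> borel_measurable borel" unfolding \<psi>_def by measurable
  note g = gagliardo_rescale[OF H_s_measurable[OF H] e, of s a, folded \<psi>_def]
  have "(\<integral>\<^sup>+x. ennreal ((\<psi> x)^2) \<partial>lborel) = ennreal (e ^ CARD('n)) * (\<integral>\<^sup>+x. ennreal ((\<phi> x)^2) \<partial>lborel)"
    unfolding \<psi>_def by (rule nn_integral_rescale[where F = "\<lambda>x. ennreal ((\<phi> x)^2)", OF _ e]) measurable
  then have "H_s s \<psi>" using H g by (auto simp: H_s_def ennreal_mult_less_top)
  moreover have "\<psi> x = 0" if "x \<notin> \<Omega>" for x
  proof (rule ccontr)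
    assume "\<psi> x \<noteq> 0"
    then have "(1 / e) *\<^sub>R (x - a) \<in> \<Omega>" using supp(1) by (auto simp: \<psi>_def)
    then have "a + e *\<^sub>R ((1 / e) *\<^sub>R (x - a)) \<in> \<Omega>" by (rule supp(2))
    then show False using that e by simp
  qed
  ultimately show "\<psi> \<in> X0 \<Omega> s" by (simp add: X0_def)
  show "frac_inner s \<psi> \<psi> = e powr (real CARD('n) - 2 * s) * frac_inner s \<phi> \<phi>"
    unfolding frac_inner_self[OF m] frac_inner_self[OF H_s_measurable[OF H]] g by (simp add: enn2real_mult)
  show "Lp_pow q \<psi> = e ^ CARD('n) * Lp_pow q \<phi>" for q
  proof -
    have "(\<integral>\<^sup>+x. ennreal (\<bar>\<psi> x\<bar> powr q) \<partial>lborel) = ennreal (e ^ CARD('n)) * (\<integral>\<^sup>+x. ennreal (\<bar>\<phi> x\<bar> powr q) \<partial>lborel)"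
      unfolding \<psi>_def by (rule nn_integral_rescale[where F = "\<lambda>x. ennreal (\<bar>\<phi> x\<bar> powr q)", OF _ e]) measurable
    then show ?thesis using e by (simp add: Lp_pow_eq_nn_integral[OF m] Lp_pow_eq_nn_integral[OF H_s_measurable[OF H]] enn2real_mult)
  qed
  show "(\<integral>\<^sup>+x. ennreal (\<psi> x) \<partial>lborel) = ennreal (e ^ CARD('n)) * (\<integral>\<^sup>+x. ennreal (\<phi> x) \<partial>lborel)"
    unfolding \<psi>_def by (rule nn_integral_rescale[where F = "\<lambda>x. ennreal (\<phi> x)", OF _ e]) measurable
qed

text \<open>Two far apart, strongly concentrated copies of a near minimiser hardly interact.\<close>

lemma nodal_nehari_energy_upper_bound:
  fixes \<Omega> :: "(real^'n) set"
  assumes s: "0 < s" "s < 1" "2 * s < real CARD('n)" and \<Omega>: "open \<Omega>" "\<Omega> \<noteq> {}" "bounded \<Omega>"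
    and \<theta>: "best_constant \<Omega> s < \<theta>" and lam: "0 \<le> lam" "lam < lambda1 \<Omega> s"
  shows "\<exists>v\<in>nodal_nehari \<Omega> s lam. energy s lam v \<le> 2 * s / real CARD('n) * \<theta> powr (real CARD('n) / (2 * s))"
proof -
  define p where "p = crit_exp CARD('n) s"
  define N where "N = real CARD('n)"
  have N: "1 \<le> N" 
  proof -
    have "0 < CARD('n)" by simp
    then show ?thesis unfolding N_def by linarith
  qed
  note cp = crit_exp_props[OF s(1,3), folded p_def N_def]
  obtain \<phi> where \<phi>: "\<phi> \<in> X0 \<Omega> s" "\<And>x. 0 \<le> \<phi> x" "\<And>x. x \<notin> \<Omega> \<Longrightarrow> \<phi> x = 0" "0 < Lp_pow p \<phi>"
      "frac_inner s \<phi> \<phi> < \<theta> * Lp_pow p \<phi> powr (2 / p)"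
    using nonneg_near_minimiser[OF s \<Omega>(1,2) \<theta>] by (auto simp: p_def)
  have H: "H_s s \<phi>" using \<phi>(1) by (rule X0_H_s)
  note [measurable] = H_s_measurable[OF H]
  obtain a where "a \<in> \<Omega>" using \<Omega> by auto
  then obtain R where R: "0 < R" "ball a R \<subseteq> \<Omega>" using \<Omega> open_contains_ball_eq by blast
  obtain M where M: "0 < M" "\<And>x. x \<in> \<Omega> \<Longrightarrow> norm x \<le> M" using \<Omega>(3) bounded_pos[of \<Omega>] by auto
  \<comment> \<open>Eight radii fit: the centres are 4r apart along an arbitrary axis and the copies
    have radius r. Both stay within 5r of \<open>a\<close>, inside the ball of radius 8r, and their
    distance is at least 2r.\<close>
  define r where "r = R / 8"
  have r: "0 < r" using R by (simp add: r_def)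
  obtain i :: 'n where True by simp
  define b where "b = a + axis i (4 * r)"
  have "axis i (4 * r) = (4 * r) *\<^sub>R (axis i 1 :: real^'n)" by (simp add: vec_eq_iff axis_def)
  then have nb: "norm (axis i (4 * r) :: real^'n) = 4 * r" using r by (simp add: norm_axis_1)
  have in\<Omega>: "a + x \<in> \<Omega>" "b + x \<in> \<Omega>" if "norm x \<le> r" for x
  proof -
    have "norm (- x) < R" using that r by (simp add: r_def)
    then show "a + x \<in> \<Omega>" using R(2) by (auto simp: subset_iff dist_norm)
    have "norm (axis i (4 * r) + x) \<le> 4 * r + r" using norm_triangle_ineq[of "axis i (4 * r)" x] nb that by linarith
    then have "norm (- (axis i (4 * r) + x)) < R" using r by (simp only: norm_minus_cancel r_def)
    then have "b + x \<in> ball a R" by (simp add: dist_norm b_def norm_minus_commute algebra_simps)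
    then show "b + x \<in> \<Omega>" using R(2) by blast
  qed
  define m where "m = enn2real (\<integral>\<^sup>+x. ennreal (\<phi> x) \<partial>lborel)"
  have m: "(\<integral>\<^sup>+x. ennreal (\<phi> x) \<partial>lborel) = ennreal m"
  proof -
    have "(\<integral>\<^sup>+x. ennreal (norm (\<phi> x)) \<partial>lborel) < \<infinity>"
      using X0_integrable[OF \<phi>(1) \<Omega>(1,3)] by (simp add: integrable_iff_bounded)
    then show ?thesis unfolding m_def using \<phi>(2) by (simp add: less_top)
  qed
  define C where "C = C_Ns CARD('n) s"
  have C: "0 < C" unfolding C_def by (rule C_Ns_pos[OF s(1,2)]) simp
  \<comment> \<open>Bound for the interaction of two masses \<open>m\<close> at distance 2r. Each
    rescaled copy has mass e^N m, which brings in the factor e^(2N) below.\<close>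
  define K where "K = C * ((1 / (2 * r) powr (N + 2 * s)) * m * m)"
  have K: "0 \<le> K" using C by (simp add: K_def m_def)
  define gap where "gap = \<theta> * Lp_pow p \<phi> powr (2 / p) - frac_inner s \<phi> \<phi>"
  have gap: "0 < gap" using \<phi>(5) by (simp add: gap_def)
  \<comment> \<open>The energy scales like e^(N-2s), the interaction like e^(2N). Their ratio is of
    order e^(N+2s) \<le> e, and the last bound on \<open>e\<close> keeps it below the gap between
    the near minimiser and \<theta>.\<close>
  define e where "e = min (r / M) (min 1 (gap / (K + 1)))"
  have e: "0 < e" "e \<le> 1" "e * M \<le> r" "e * (K + 1) \<le> gap"
  proof -
    show "0 < e" using r M gap K by (simp add: e_def)
    show "e \<le> 1" by (simp add: e_def)
    have "e \<le> r / M" by (simp add: e_def)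
    then show "e * M \<le> r" using M by (simp add: pos_le_divide_eq)
    have "e \<le> gap / (K + 1)" by (simp add: e_def)
    then show "e * (K + 1) \<le> gap" using K by (simp add: pos_le_divide_eq)
  qed
  have small: "norm (e *\<^sub>R x) \<le> r" if "x \<in> \<Omega>" for x
  proof -
    have "e * norm x \<le> e * M" using M(2)[OF that] e by (intro mult_left_mono) auto
    from order_trans[OF this e(3)] show ?thesis using e(1) by simp
  qed
  define f where "f x = \<phi> ((1 / e) *\<^sub>R (x - a))" for x
  define g where "g x = \<phi> ((1 / e) *\<^sub>R (x - b))" for x
  note fr = rescale_properties[OF s(1,2) \<phi>(1) e(1) \<phi>(3) in\<Omega>(1)[OF small]]
  have feq: "f = (\<lambda>x. \<phi> ((1 / e) *\<^sub>R (x - a)))" by (simp add: f_def fun_eq_iff)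
  have fp: "f \<in> X0 \<Omega> s" "frac_inner s f f = e powr (real CARD('n) - 2 * s) * frac_inner s \<phi> \<phi>"
    "\<And>q. Lp_pow q f = e ^ CARD('n) * Lp_pow q \<phi>"
    "(\<integral>\<^sup>+x. ennreal (f x) \<partial>lborel) = ennreal (e ^ CARD('n)) * (\<integral>\<^sup>+x. ennreal (\<phi> x) \<partial>lborel)"
    by (simp_all only: feq) (rule fr; assumption)+
  note gr = rescale_properties[OF s(1,2) \<phi>(1) e(1) \<phi>(3) in\<Omega>(2)[OF small]]
  have geq: "g = (\<lambda>x. \<phi> ((1 / e) *\<^sub>R (x - b)))" by (simp add: g_def fun_eq_iff)
  have gp: "g \<in> X0 \<Omega> s" "frac_inner s g g = e powr (real CARD('n) - 2 * s) * frac_inner s \<phi> \<phi>"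
    "\<And>q. Lp_pow q g = e ^ CARD('n) * Lp_pow q \<phi>"
    "(\<integral>\<^sup>+x. ennreal (g x) \<partial>lborel) = ennreal (e ^ CARD('n)) * (\<integral>\<^sup>+x. ennreal (\<phi> x) \<partial>lborel)"
    by (simp_all only: geq) (rule gr; assumption)+
  have Hf: "H_s s f" and Hg: "H_s s g" using fp(1) gp(1) by (auto intro: X0_H_s)
  note [measurable] = H_s_measurable[OF Hf] H_s_measurable[OF Hg]
  have fs: "norm (x - a) \<le> r" if "f x \<noteq> 0" for x
  proof -
    have "(1 / e) *\<^sub>R (x - a) \<in> \<Omega>" using that \<phi>(3) by (auto simp: f_def)
    from small[OF this] show ?thesis using e by simp
  qed
  have gs: "norm (x - b) \<le> r" if "g x \<noteq> 0" for x
  proof -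
    have "(1 / e) *\<^sub>R (x - b) \<in> \<Omega>" using that \<phi>(3) by (auto simp: g_def)
    from small[OF this] show ?thesis using e by simp
  qed
  have nab: "norm (b - a) = 4 * r" using nb by (simp add: b_def)
  have sep: "2 * r \<le> norm (x - y)" if "f x \<noteq> 0" "g y \<noteq> 0" for x y
  proof -
    have "norm (b - a) = norm ((x - a) + (y - x) - (y - b))" by simp
    then have "norm (b - a) \<le> norm (x - a) + norm (y - x) + norm (y - b)"
      using norm_triangle_ineq4[of "(x - a) + (y - x)" "y - b"] norm_triangle_ineq[of "x - a" "y - x"] by linarith
    then show ?thesis using fs[OF that(1)] gs[OF that(2)] nab by (simp add: norm_minus_commute)
  qed
  have nn: "0 \<le> f x" "0 \<le> g x" for x using \<phi>(2) by (simp_all add: f_def g_def)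
  have d: "f x * g x = 0" for x using sep[of x x] r by auto
  have cross: "cross_energy s f g \<le> ennreal (1 / (2 * r) powr (N + 2 * s) * (e ^ CARD('n) * m) * (e ^ CARD('n) * m))"
  proof -
    have "cross_energy s f g \<le> (\<integral>\<^sup>+x. (\<integral>\<^sup>+y. ennreal (1 / (2 * r) powr (N + 2 * s)) * ennreal (f x) * ennreal (g y) \<partial>lborel) \<partial>lborel)"
      unfolding cross_energy_def
    proof (intro nn_integral_mono)
      fix x y
      show "ennreal (f x * g y * frac_kernel s (x - y)) \<le> ennreal (1 / (2 * r) powr (N + 2 * s)) * ennreal (f x) * ennreal (g y)"
      proof (cases "f x = 0 \<or> g y = 0")
        case False
        then have sp: "2 * r \<le> norm (x - y)" using sep by blast
        then have "0 < norm (x - y)" using r by linarith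
        then have "frac_kernel s (x - y) \<le> 1 / (2 * r) powr (N + 2 * s)"
          unfolding frac_kernel_def N_def[symmetric] using sp r s N by (intro divide_left_mono powr_mono2 mult_pos_pos) auto
        then have "f x * g y * frac_kernel s (x - y) \<le> f x * g y * (1 / (2 * r) powr (N + 2 * s))"
          using nn by (intro mult_left_mono mult_nonneg_nonneg)
        then have "ennreal (f x * g y * frac_kernel s (x - y)) \<le> ennreal (1 / (2 * r) powr (N + 2 * s) * f x * g y)"
          by (intro ennreal_leI) (simp add: mult_ac)
        also have "\<dots> = ennreal (1 / (2 * r) powr (N + 2 * s)) * ennreal (f x) * ennreal (g y)"
          using nn[of x] nn[of y] by (simp only: ennreal_mult mult_nonneg_nonneg divide_nonneg_nonneg powr_ge_zero zero_le_one)
        finally show ?thesis .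
      qed auto
    qed
    also have "\<dots> = ennreal (1 / (2 * r) powr (N + 2 * s)) * (\<integral>\<^sup>+x. ennreal (f x) \<partial>lborel) * (\<integral>\<^sup>+y. ennreal (g y) \<partial>lborel)"
      by (simp add: nn_integral_cmult nn_integral_multc)
    also have "\<dots> = ennreal (1 / (2 * r) powr (N + 2 * s) * (e ^ CARD('n) * m) * (e ^ CARD('n) * m))"
    proof -
      have em: "0 \<le> e ^ CARD('n) * m" using e by (simp add: m_def)
      have "ennreal (e ^ CARD('n)) * ennreal m = ennreal (e ^ CARD('n) * m)"
        using e by (intro ennreal_mult[symmetric]) (auto simp: m_def)
      then have fi: "(\<integral>\<^sup>+x. ennreal (f x) \<partial>lborel) = ennreal (e ^ CARD('n) * m)" "(\<integral>\<^sup>+x. ennreal (g x) \<partial>lborel) = ennreal (e ^ CARD('n) * m)"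
        using fp(4) gp(4) m by simp_all
      have "0 \<le> 1 / (2 * r) powr (N + 2 * s)" by simp
      then show ?thesis unfolding fi using em by (simp only: ennreal_mult mult_nonneg_nonneg)
    qed
    finally show ?thesis .
  qed
  have fgle: "- frac_inner s f g \<le> K * (e ^ CARD('n) * e ^ CARD('n))" and fg0: "0 \<le> - frac_inner s f g"
  proof -
    have "enn2real (cross_energy s f g) \<le> 1 / (2 * r) powr (N + 2 * s) * (e ^ CARD('n) * m) * (e ^ CARD('n) * m)"
      using cross e by (intro enn2real_leI) (auto simp: m_def)
    then have "C * enn2real (cross_energy s f g) \<le> C * (1 / (2 * r) powr (N + 2 * s) * (e ^ CARD('n) * m) * (e ^ CARD('n) * m))"
      using C by (intro mult_left_mono) auto
    then show "- frac_inner s f g \<le> K * (e ^ CARD('n) * e ^ CARD('n))"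
      unfolding frac_inner_disjoint(2)[OF Hf Hg nn d] by (simp add: K_def C_def mult_ac)
    show "0 \<le> - frac_inner s f g"
      unfolding frac_inner_disjoint(2)[OF Hf Hg nn d] using C by (simp add: C_def)
  qed
  define B where "B = frac_inner s f f - frac_inner s f g - lam * Lp_pow 2 f"
  define Y where "Y = Lp_pow p f"
  have Y: "0 < Y" unfolding Y_def fp(3) using e \<phi>(4) by simp
  have L0: "0 \<le> Lp_pow 2 f" by (simp add: Lp_pow_def)
  have eN: "e ^ CARD('n) = e powr N" using e by (simp add: N_def powr_realpow)
  \<comment> \<open>Uses that \<open>lam\<close> is below the first eigenvalue; the interaction
    helps, as the inner product of the two disjoint bumps is nonpositive.\<close>
  have B0: "0 < B"
  proof -
    have "\<not> zero_ae f"
    proof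
      assume "zero_ae f"
      then have "AE x in lborel. \<bar>f x\<bar> powr p = 0" unfolding zero_ae_def by eventually_elim simp
      then have "Lp_pow p f = 0" unfolding Lp_pow_def by (rule integral_eq_zero_AE)
      then show False using Y by (simp add: Y_def)
    qed
    then have "0 < Lp_pow 2 f" using Lp_pow_2(2)[OF Hf] by (intro Lp_pow_pos) auto
    then have "lam * Lp_pow 2 f < lambda1 \<Omega> s * Lp_pow 2 f" using lam by (intro mult_strict_right_mono)
    also have "\<dots> \<le> frac_inner s f f" by (rule lambda1_le[OF s(1,2) fp(1)])
    finally show ?thesis using fg0 by (simp add: B_def)
  qed
  have "B < \<theta> * Y powr (2 / p)"
  proof -
    have "0 \<le> lam * Lp_pow 2 f" using lam L0 by simp
    then have "B \<le> e powr (N - 2 * s) * frac_inner s \<phi> \<phi> + K * (e powr N * e powr N)"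
      using fgle unfolding B_def fp(2) eN N_def[symmetric] by linarith
    also have "e powr N * e powr N = e powr (N - 2 * s) * e powr (N + 2 * s)"
      by (simp flip: powr_add)
    also have "e powr (N - 2 * s) * frac_inner s \<phi> \<phi> + K * (e powr (N - 2 * s) * e powr (N + 2 * s))
        = e powr (N - 2 * s) * (frac_inner s \<phi> \<phi> + K * e powr (N + 2 * s))" by (simp add: algebra_simps)
    also have "\<dots> < e powr (N - 2 * s) * (\<theta> * Lp_pow p \<phi> powr (2 / p))"
    proof -
      have "e powr (N + 2 * s) \<le> e powr 1" using e N s by (intro powr_mono') auto
      then have "K * e powr (N + 2 * s) \<le> K * e" using K e by (intro mult_left_mono) auto
      also have "\<dots> < e * (K + 1)" using e by (simp add: algebra_simps)
      also have "\<dots> \<le> gap" by (rule e(4))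
      finally show ?thesis using e by (intro mult_strict_left_mono) (auto simp: gap_def)
    qed
    also have "\<dots> = \<theta> * Y powr (2 / p)"
    proof -
      have "(e powr N) powr (2 / p) = e powr (N - 2 * s)"
      proof -
        have "N * (2 / p) = N - 2 * s" unfolding cp(3)[symmetric] using N by (simp add: field_simps)
        then show ?thesis by (simp only: powr_powr)
      qed
      then show ?thesis unfolding Y_def fp(3) eN using e \<phi>(4) by (simp add: powr_mult)
    qed
    finally show ?thesis .
  qed
  then have BY: "B / Y powr (2 / p) \<le> \<theta>" using Y by (simp add: pos_divide_le_eq)
  obtain v where v: "v \<in> nodal_nehari \<Omega> s lam" "energy s lam v = 2 * s / real CARD('n) * (B / Y powr (2 / p)) powr (real CARD('n) / (2 * s))"
    using nodal_nehari_two_bumps[OF s fp(1) gp(1) nn d _ _ _ _ B_def B0, folded p_def] Y fp(2,3) gp(2,3)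
    by (auto simp: Y_def)
  have "(B / Y powr (2 / p)) powr (real CARD('n) / (2 * s)) \<le> \<theta> powr (real CARD('n) / (2 * s))"
    using BY B0 Y s by (intro powr_mono2) auto
  then have "energy s lam v \<le> 2 * s / real CARD('n) * \<theta> powr (real CARD('n) / (2 * s))"
    unfolding v(2) using s by (intro mult_left_mono) auto
  then show ?thesis using v(1) by blast
qed

section \<open>Two nodal regions\<close>

text \<open>Lets every statement about positive components be applied to negative ones.\<close>

lemma weak_solution_uminus:
  assumes "weak_solution \<Omega> s lam u"
  shows "weak_solution \<Omega> s lam (\<lambda>x. - u x)"
  unfolding weak_solution_def
proof (intro conjI ballI)
  show "(\<lambda>x. - u x) \<in> X0 \<Omega> s"
    using X0_scale[of u \<Omega> s "- 1"] assms by (simp add: weak_solution_def)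
  fix \<phi> assume "\<phi> \<in> X0 \<Omega> s"
  then have "frac_inner s u \<phi> = (\<integral>x. (lam * u x + \<bar>u x\<bar> powr (crit_exp CARD('a) s - 2) * u x) * \<phi> x \<partial>lborel)"
    using assms by (simp add: weak_solution_def)
  moreover have "frac_inner s (\<lambda>x. - u x) \<phi> = - frac_inner s u \<phi>"
    using frac_inner_scale_left[of s "- 1" u \<phi>] by simp
  moreover have "(lam * - u x + \<bar>- u x\<bar> powr (crit_exp CARD('a) s - 2) * - u x) * \<phi> x
      = - ((lam * u x + \<bar>u x\<bar> powr (crit_exp CARD('a) s - 2) * u x) * \<phi> x)" for x
    by (simp add: algebra_simps)
  ultimately show "frac_inner s (\<lambda>x. - u x) \<phi> = (\<integral>x. (lam * - u x + \<bar>- u x\<bar> powr (crit_exp CARD('a) s - 2) * - u x) * \<phi> x \<partial>lborel)"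
    by simp
qed

text \<open>Testing the equation with \<open>v\<close> bounds its energy F by lam |v|^2 + Y, with Y
  its L^p mass. The first term is absorbed through \<open>lambda1\<close>, which leaves t F \<le> Y
  with t = 1 - lam / \<open>lambda1\<close>. Together with S Y^(2/p) \<le> F this gives t S \<le>
  Y^(1-2/p) = Y^(2s/N).\<close>

lemma piece_mass_lower_bound:
  fixes u v :: "real^'n \<Rightarrow> real" and s :: real
  defines "p \<equiv> crit_exp CARD('n) s"
  assumes s: "0 < s" "s < 1" "2 * s < real CARD('n)" and \<Omega>: "open \<Omega>" "\<Omega> \<noteq> {}"
    and u: "weak_solution \<Omega> s lam u" and v: "v \<in> X0 \<Omega> s" "\<not> zero_ae v" "\<And>x. v x = 0 \<or> v x = u x"
    and le: "frac_inner s v v \<le> frac_inner s u v" and lam: "0 \<le> lam" "lam < lambda1 \<Omega> s"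
  shows "((1 - lam / lambda1 \<Omega> s) * best_constant \<Omega> s) powr (real CARD('n) / (2 * s)) \<le> Lp_pow p v"
proof -
  define S where "S = best_constant \<Omega> s"
  define t where "t = 1 - lam / lambda1 \<Omega> s"
  define F where "F = frac_inner s v v"
  define Y where "Y = Lp_pow p v"
  have S: "0 < S" unfolding S_def by (rule best_constant(1)[OF s \<Omega>])
  have l1: "0 < lambda1 \<Omega> s" using lam by simp
  have t: "0 < t" using lam l1 by (simp add: t_def)
  note cp = crit_exp_props[OF s(1,3), folded p_def]
  have H: "H_s s v" using v(1) by (rule X0_H_s)
  have ip: "integrable lborel (\<lambda>x. \<bar>v x\<bar> powr p)" unfolding p_def by (rule sobolev(1)[OF s H])
  have Y: "0 < Y" unfolding Y_def by (rule Lp_pow_pos[OF ip v(2)])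
  have "frac_inner s u v = (\<integral>x. (lam * u x + \<bar>u x\<bar> powr (p - 2) * u x) * v x \<partial>lborel)"
    using u v(1) by (simp add: weak_solution_def p_def)
  also have "\<dots> = (\<integral>x. lam * (v x)^2 + \<bar>v x\<bar> powr p \<partial>lborel)"
  proof (intro Bochner_Integration.integral_cong refl)
    fix x show "(lam * u x + \<bar>u x\<bar> powr (p - 2) * u x) * v x = lam * (v x)^2 + \<bar>v x\<bar> powr p"
      using v(3)[of x] abs_powr_minus_2_mult[of "v x" p] by (auto simp: distrib_right power2_eq_square)
  qed
  also have "\<dots> = lam * Lp_pow 2 v + Y"
    using Lp_pow_2(2)[OF H] ip by (simp add: Lp_pow_2(3)[OF H] Y_def) (simp add: Lp_pow_def)
  finally have F1: "F \<le> lam * Lp_pow 2 v + Y" using le by (simp add: F_def)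
  have "lambda1 \<Omega> s * Lp_pow 2 v \<le> F" unfolding F_def by (rule lambda1_le[OF s(1,2) v(1)])
  then have "lam / lambda1 \<Omega> s * (lambda1 \<Omega> s * Lp_pow 2 v) \<le> lam / lambda1 \<Omega> s * F"
    using lam l1 by (intro mult_left_mono) auto
  then have "lam * Lp_pow 2 v \<le> lam / lambda1 \<Omega> s * F" using l1 by simp
  with F1 have "t * F \<le> Y" by (simp add: t_def left_diff_distrib)
  moreover have "S * Y powr (2 / p) \<le> F" unfolding S_def Y_def F_def p_def by (rule best_constant(2)[OF s \<Omega> v(1,2)])
  then have "t * (S * Y powr (2 / p)) \<le> t * F" using t by (intro mult_left_mono) auto
  ultimately have "t * S * Y powr (2 / p) \<le> Y powr 1" using Y by simp
  then have "t * S \<le> Y powr 1 / Y powr (2 / p)" using Y by (simp add: pos_le_divide_eq)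
  also have "\<dots> = Y powr (1 - 2 / p)" by (simp only: powr_diff)
  also have "1 - 2 / p = 2 * s / real CARD('n)" using cp(3) by simp
  finally have "(t * S) powr (real CARD('n) / (2 * s)) \<le> (Y powr (2 * s / real CARD('n))) powr (real CARD('n) / (2 * s))"
    using s t S by (intro powr_mono2) auto
  also have "\<dots> = Y" using s Y by (simp add: powr_powr)
  finally show ?thesis by (simp add: t_def S_def Y_def)
qed

text \<open>The negative part as a whole is also a piece, with nothing of its own sign left to repel
  it; no decomposition into components is involved.\<close>

lemma negative_part_piece:
  fixes u :: "real^'n \<Rightarrow> real"
  assumes s: "0 < s" "s < 1" and u: "u \<in> X0 \<Omega> s"
  shows "(\<lambda>x. max 0 (- u x)) \<in> X0 \<Omega> s"
    "frac_inner s (\<lambda>x. max 0 (- u x)) (\<lambda>x. max 0 (- u x)) \<le> frac_inner s (\<lambda>x. - u x) (\<lambda>x. max 0 (- u x))"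
proof -
  have H: "H_s s u" using u by (rule X0_H_s)
  note [measurable] = H_s_measurable[OF H]
  have m: "(\<lambda>x. max 0 (- u x)) \<in> borel_measurable borel" "(\<lambda>x. max 0 (u x)) \<in> borel_measurable borel" by measurable
  show "(\<lambda>x. max 0 (- u x)) \<in> X0 \<Omega> s" by (rule X0_contraction[OF u m(1)]) auto
  have Hm: "H_s s (\<lambda>x. - u x)" using H_s_scale[OF H, of "- 1"] by simp
  show "frac_inner s (\<lambda>x. max 0 (- u x)) (\<lambda>x. max 0 (- u x)) \<le> frac_inner s (\<lambda>x. - u x) (\<lambda>x. max 0 (- u x))"
    by (rule frac_inner_piece(2)[OF s Hm, where g = "\<lambda>_. 0" and h = "\<lambda>x. max 0 (u x)"])
       (auto simp: cross_energy_def max_def)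
qed

text \<open>Two positive components contribute one piece each, and the undivided negative part
  serves as the third. The pieces are disjoint at every point, so their masses add up to at most
  that of \<open>u\<close>.\<close>

lemma positive_component_unique:
  fixes u :: "real^'n \<Rightarrow> real" and s :: real
  assumes s: "0 < s" "s < 1" "2 * s < real CARD('n)" and \<Omega>: "open \<Omega>" "\<Omega> \<noteq> {}" "bounded \<Omega>"
    and u: "weak_solution \<Omega> s lam u" and neg: "\<not> zero_ae (\<lambda>x. max 0 (- u x))" and lam: "0 \<le> lam" "lam < lambda1 \<Omega> s"
    and mass: "Lp_pow (crit_exp CARD('n) s) u < 3 * ((1 - lam / lambda1 \<Omega> s) * best_constant \<Omega> s) powr (real CARD('n) / (2 * s))"
    and D: "D \<in> components {p. 0 < snd p \<and> ext s u (fst p) (snd p) \<noteq> 0}" "D' \<in> components {p. 0 < snd p \<and> ext s u (fst p) (snd p) \<noteq> 0}"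
    and pos: "p \<in> D" "0 < ext s u (fst p) (snd p)" "p' \<in> D'" "0 < ext s u (fst p') (snd p')"
  shows "D = D'"
proof (rule ccontr)
  assume ne: "D \<noteq> D'"
  define q where "q = crit_exp CARD('n) s"
  define c where "c = ((1 - lam / lambda1 \<Omega> s) * best_constant \<Omega> s) powr (real CARD('n) / (2 * s))"
  have X: "u \<in> X0 \<Omega> s" using u by (simp add: weak_solution_def)
  note um = weak_solution_uminus[OF u]
  note d1 = trace_part_frac_inner[OF s(1,2) X \<Omega>(1,3) D(1)] and d2 = trace_part_frac_inner[OF s(1,2) X \<Omega>(1,3) D(2)]
  note n3 = negative_part_piece[OF s(1,2) X]
  have z1: "\<not> zero_ae (trace_part D u)" by (rule trace_part_nonzero[OF s(1,2) X \<Omega>(1,3) D(1) pos(1,2)])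
  have z2: "\<not> zero_ae (trace_part D' u)" by (rule trace_part_nonzero[OF s(1,2) X \<Omega>(1,3) D(2) pos(3,4)])
  have p1: "trace_part D u x = 0 \<or> trace_part D u x = u x" "trace_part D' u x = 0 \<or> trace_part D' u x = u x" for x
    using trace_part_cases[of D u x] trace_part_cases[of D' u x] by auto
  have p3: "max 0 (- u x) = 0 \<or> max 0 (- u x) = - u x" for x by (auto simp: max_def)
  have c1: "c \<le> Lp_pow q (trace_part D u)"
    unfolding c_def q_def by (rule piece_mass_lower_bound[OF s \<Omega>(1,2) u d1(1) z1 p1(1) d1(2) lam])
  have c2: "c \<le> Lp_pow q (trace_part D' u)"
    unfolding c_def q_def by (rule piece_mass_lower_bound[OF s \<Omega>(1,2) u d2(1) z2 p1(2) d2(2) lam])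
  have c3: "c \<le> Lp_pow q (\<lambda>x. max 0 (- u x))"
    unfolding c_def q_def by (rule piece_mass_lower_bound[OF s \<Omega>(1,2) um n3(1) neg p3 n3(2) lam])
  have i: "integrable lborel (\<lambda>x. \<bar>u x\<bar> powr q)" "integrable lborel (\<lambda>x. \<bar>trace_part D u x\<bar> powr q)"
      "integrable lborel (\<lambda>x. \<bar>trace_part D' u x\<bar> powr q)" "integrable lborel (\<lambda>x. \<bar>max 0 (- u x)\<bar> powr q)"
    using sobolev(1)[OF s X0_H_s[OF X]] sobolev(1)[OF s X0_H_s[OF d1(1)]] sobolev(1)[OF s X0_H_s[OF d2(1)]] sobolev(1)[OF s X0_H_s[OF n3(1)]]
    by (simp_all add: q_def)
  have "Lp_pow q (trace_part D u) + Lp_pow q (trace_part D' u) + Lp_pow q (\<lambda>x. max 0 (- u x))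
     = (\<integral>x. \<bar>trace_part D u x\<bar> powr q + \<bar>trace_part D' u x\<bar> powr q + \<bar>max 0 (- u x)\<bar> powr q \<partial>lborel)"
    using i by (simp add: Lp_pow_def)
  also have "\<dots> \<le> Lp_pow q u"
    unfolding Lp_pow_def
  proof (rule integral_mono)
    fix x
    show "\<bar>trace_part D u x\<bar> powr q + \<bar>trace_part D' u x\<bar> powr q + \<bar>max 0 (- u x)\<bar> powr q \<le> \<bar>u x\<bar> powr q"
      using trace_part_cases[of D u x] trace_part_cases[of D' u x] trace_parts_disjoint[OF D ne, of u x] by (auto simp: max_def)
  qed (use i in auto)
  finally show False using c1 c2 c3 mass unfolding c_def[symmetric] q_def[symmetric] by linarith
qed

section \<open>Signs and number of the components\<close>

lemma connected_constant_sign: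
  fixes f :: "'a::topological_space \<Rightarrow> real"
  assumes "connected C" "continuous_on C f" "\<And>x. x \<in> C \<Longrightarrow> f x \<noteq> 0" "a \<in> C" "b \<in> C" "0 < f a"
  shows "0 < f b"
proof (rule ccontr)
  assume "\<not> 0 < f b"
  then have "f b < 0" using assms(3)[OF assms(5)] by simp
  moreover have "connected (f ` C)" by (rule connected_continuous_image[OF assms(2,1)])
  ultimately have "0 \<in> f ` C"
    using assms(4-6) by (intro connectedD_interval[of "f ` C" "f b" "f a" 0]) auto
  then show False using assms(3) by auto
qed

text \<open>Above a point with u > 0 and finite Gagliardo density the extension is positive at small
  heights, by convergence to the trace.\<close>

lemma positive_component_exists:
  fixes u :: "real^'n \<Rightarrow> real"
  assumes s: "0 < s" and u: "u \<in> X0 \<Omega> s" and \<Omega>: "open \<Omega>" "bounded \<Omega>" and pos: "\<not> zero_ae (\<lambda>x. max 0 (u x))"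
  shows "\<exists>D\<in>components {p. 0 < snd p \<and> ext s u (fst p) (snd p) \<noteq> 0}. \<exists>p\<in>D. 0 < ext s u (fst p) (snd p)"
proof -
  have H: "H_s s u" using u by (rule X0_H_s)
  have iu: "integrable lborel u" by (rule X0_integrable[OF u \<Omega>])
  have "\<exists>x. 0 < u x \<and> (\<integral>\<^sup>+y. ennreal ((u x - u y)^2 * frac_kernel s (x - y)) \<partial>lborel) < \<infinity>"
  proof (rule ccontr)
    assume no: "\<not> ?thesis"
    have "zero_ae (\<lambda>x. max 0 (u x))"
      unfolding zero_ae_def using AE_gagliardo_density_finite[OF H]
    proof eventually_elim
      case (elim x)
      then have "\<not> 0 < u x" using no by blast
      then show ?case by simp
    qed
    then show False using pos by simp
  qed
  then obtain x where x: "0 < u x" "(\<integral>\<^sup>+y. ennreal ((u x - u y)^2 * frac_kernel s (x - y)) \<partial>lborel) < \<infinity>" by blast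
  have "0 < kernel_mass TYPE('n) s * u x" using x kernel_mass(1)[OF s, where 'n='n] by simp
  then have "\<forall>\<^sub>F y in at_right 0. 0 < ext s u x y"
    using order_tendstoD(1)[OF ext_tendsto_trace[OF s iu x(2)]] by simp
  then obtain d where d: "0 < d" "\<And>y. 0 < y \<Longrightarrow> y < d \<Longrightarrow> 0 < ext s u x y"
    unfolding eventually_at_right_field by auto
  have e: "0 < ext s u x (d / 2)" using d by simp
  then have "(x, d / 2) \<in> {p. 0 < snd p \<and> ext s u (fst p) (snd p) \<noteq> 0}" using d(1) by simp
  then obtain D where "D \<in> components {p. 0 < snd p \<and> ext s u (fst p) (snd p) \<noteq> 0}" "(x, d / 2) \<in> D"
    by (metis (no_types, lifting) Union_components UnionE)
  then show ?thesis using e by force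
qed

text \<open>One component of each sign exists and is unique; the negative half is the positive half
  applied to -u, whose extension has the same zero set and whose mass is the same.\<close>

lemma two_nodal_regions:
  fixes u :: "real^'n \<Rightarrow> real" and s :: real
  assumes s: "0 < s" "s < 1" "2 * s < real CARD('n)" and \<Omega>: "open \<Omega>" "\<Omega> \<noteq> {}" "bounded \<Omega>"
    and u: "weak_solution \<Omega> s lam u" and sign: "\<not> zero_ae (pos_part u)" "\<not> zero_ae (neg_part u)" and lam: "0 \<le> lam" "lam < lambda1 \<Omega> s"
    and mass: "Lp_pow (crit_exp CARD('n) s) u < 3 * ((1 - lam / lambda1 \<Omega> s) * best_constant \<Omega> s) powr (real CARD('n) / (2 * s))"
  shows "card (nodal_regions (extension s u)) = 2"
proof -
  define A where "A = {p. 0 < snd p \<and> ext s u (fst p) (snd p) \<noteq> 0}"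
  have X: "u \<in> X0 \<Omega> s" using u by (simp add: weak_solution_def)
  have iu: "integrable lborel u" by (rule X0_integrable[OF X \<Omega>(1,3)])
  note um = weak_solution_uminus[OF u]
  have Xm: "(\<lambda>x. - u x) \<in> X0 \<Omega> s" using um by (simp add: weak_solution_def)
  have z1: "\<not> zero_ae (\<lambda>x. max 0 (u x))"
    using sign(1) by (simp add: pos_part_def max.commute)
  have z2: "\<not> zero_ae (\<lambda>x. max 0 (- u x))"
  proof -
    have "max 0 (- u x) = - neg_part u x" for x by (auto simp: neg_part_def max_def min_def)
    then show ?thesis using sign(2) by (simp add: zero_ae_def)
  qed
  have Am: "{p. 0 < snd p \<and> ext s (\<lambda>x. - u x) (fst p) (snd p) \<noteq> 0} = A"
    by (auto simp: A_def ext_uminus)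
  have massm: "Lp_pow (crit_exp CARD('n) s) (\<lambda>x. - u x) < 3 * ((1 - lam / lambda1 \<Omega> s) * best_constant \<Omega> s) powr (real CARD('n) / (2 * s))"
    using mass by (simp add: Lp_pow_def)
  have "0 < poisson_const CARD('n) s"
    using s by (auto simp: poisson_const_def intro!: divide_pos_pos mult_pos_pos Gamma_real_pos)
  then have "{p. 0 < snd p \<and> extension s u p \<noteq> 0} = A"
    unfolding A_def by (auto simp: extension_eq_ext)
  then have nr: "nodal_regions (extension s u) = components A" by (simp add: nodal_regions_def)
  obtain D p where D: "D \<in> components A" "p \<in> D" "0 < ext s u (fst p) (snd p)"
    using positive_component_exists[OF s(1) X \<Omega>(1,3) z1] unfolding A_def[symmetric] by blast
  obtain D' p' where D': "D' \<in> components A" "p' \<in> D'" "ext s u (fst p') (snd p') < 0"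
  proof -
    have "\<exists>D\<in>components A. \<exists>p\<in>D. 0 < ext s (\<lambda>x. - u x) (fst p) (snd p)"
      using positive_component_exists[OF s(1) Xm \<Omega>(1,3) z2] unfolding Am .
    then show ?thesis using that by (auto simp: ext_uminus)
  qed
  have cont: "continuous_on C (\<lambda>p. ext s u (fst p) (snd p))" if "C \<in> components A" for C
    using continuous_on_ext[OF s(1) iu] in_components_subset[OF that] by (elim continuous_on_subset) (auto simp: A_def)
  have nz: "ext s u (fst p) (snd p) \<noteq> 0" if "C \<in> components A" "p \<in> C" for C p
    using in_components_subset[OF that(1)] that(2) by (auto simp: A_def)
  have DD': "D \<noteq> D'"
  proof
    assume "D = D'"
    then have "0 < ext s u (fst p') (snd p')"
      using connected_constant_sign[OF in_components_connected[OF D(1)] cont[OF D(1)] nz[OF D(1)] D(2) _ D(3), of p'] D'(2) by simp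
    then show False using D'(3) by simp
  qed
  have "C = D \<or> C = D'" if C: "C \<in> components A" for C
  proof -
    obtain r where r: "r \<in> C" using in_components_nonempty[OF C] by blast
    show ?thesis
    proof (cases "0 < ext s u (fst r) (snd r)")
      case True
      have "C = D"
        by (rule positive_component_unique[OF s \<Omega> u z2 lam mass _ _ r True D(2,3)]) (use C D(1) in \<open>simp_all add: A_def\<close>)
      then show ?thesis ..
    next
      case False
      then have "ext s u (fst r) (snd r) < 0" using nz[OF C r] by simp
      then have "0 < ext s (\<lambda>x. - u x) (fst r) (snd r)" "0 < ext s (\<lambda>x. - u x) (fst p') (snd p')" using D'(3) by (simp_all add: ext_uminus)
      moreover have "\<not> zero_ae (\<lambda>x. max 0 (- (- u x)))" using z1 by simp
      ultimately have "C = D'"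
        using positive_component_unique[OF s \<Omega> um _ lam massm, unfolded Am, OF _ C D'(1) r _ D'(2)] by blast
      then show ?thesis ..
    qed
  qed
  then have "components A = {D, D'}" using D(1) D'(1) by blast
  then show ?thesis using DD' by (simp add: nr)
qed

lemma two_nodal_regions_uniform:
  fixes \<Omega> :: "(real^'n) set"
  assumes \<Omega>: "open \<Omega>" "\<Omega> \<noteq> {}" "bounded \<Omega>" and s0: "0 < s0" "s0 < 1"
  shows "\<exists>lhat>0. \<forall>s. s0 \<le> s \<and> s < 1 \<and> real CARD('n) \<ge> 6 * s \<longrightarrow> lhat \<le> lambda1 \<Omega> s \<and>
     (\<forall>lam u. 0 < lam \<and> lam < lhat \<and> least_energy_nodal_solution \<Omega> s lam u \<longrightarrow> card (nodal_regions (extension s u)) = 2)"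
proof -
  obtain c where c: "0 < c" "\<And>s u. s0 \<le> s \<Longrightarrow> s < 1 \<Longrightarrow> u \<in> X0 \<Omega> s \<Longrightarrow> c * Lp_pow 2 u \<le> frac_inner s u u"
    using poincare_uniform[OF \<Omega>(1,3) s0(1)] by blast
  define N where "N = real CARD('n)"
  have N: "0 < N" by (simp add: N_def)
  \<comment> \<open>The numbers 5/6 here and 5/4 in \<theta> are matched by 3 * 5/6 = 2 * 5/4,
    halfway between 2 and 3.\<close>
  define \<kappa> where "\<kappa> = (5 / 6 :: real) powr (2 * s0 / N)"
  have "(5 / 6 :: real) powr (2 * s0 / N) < 1 powr (2 * s0 / N)" using s0 N by (intro powr_less_mono2) auto
  then have \<kappa>: "0 < \<kappa>" "\<kappa> < 1" by (auto simp: \<kappa>_def)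
  \<comment> \<open>For \<open>lam\<close> below this value lam / \<open>lambda1\<close> \<le> lam /
    c < 1 - \<kappa>, so the factor 1 - lam / \<open>lambda1\<close> exceeds \<kappa>.\<close>
  define lhat where "lhat = c * (1 - \<kappa>)"
  have lhat: "0 < lhat" "lhat \<le> c" using c \<kappa> by (auto simp: lhat_def mult_le_cancel_left1)
  have "lhat \<le> lambda1 \<Omega> s \<and> (\<forall>lam u. 0 < lam \<and> lam < lhat \<and> least_energy_nodal_solution \<Omega> s lam u \<longrightarrow> card (nodal_regions (extension s u)) = 2)"
    if s: "s0 \<le> s" "s < 1" "6 * s \<le> real CARD('n)" for s
  proof -
    have s1: "0 < s" "s < 1" "2 * s < real CARD('n)" using s s0 by auto
    have cl: "c \<le> lambda1 \<Omega> s" by (rule lambda1_ge[OF s1(1,2) \<Omega>(1,2) c(2)[OF s(1,2)]])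
    have "card (nodal_regions (extension s u)) = 2"
      if lam: "0 < lam" "lam < lhat" and u: "least_energy_nodal_solution \<Omega> s lam u" for lam u
    proof -
      define S where "S = best_constant \<Omega> s"
      have S: "0 < S" unfolding S_def by (rule best_constant(1)[OF s1 \<Omega>(1,2)])
      \<comment> \<open>The exponent 2s/N is undone by the power N/(2s) in the energy bound, so that
        the least energy solution has mass at most 2 * 5/4 times S^(N/(2s)).\<close>
      define \<theta> where "\<theta> = S * (5 / 4) powr (2 * s / N)"
      have e: "2 * s / N * (N / (2 * s)) = 1" using s1 N by simp
      have l1: "lam < lambda1 \<Omega> s" using lam lhat cl by linarith
      have "1 < (5 / 4 :: real) powr (2 * s / N)" using s1 N by (intro gr_one_powr) auto
      then have \<theta>: "best_constant \<Omega> s < \<theta>" using S by (simp add: \<theta>_def S_def)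
      have w: "weak_solution \<Omega> s lam u" and nn: "u \<in> nodal_nehari \<Omega> s lam"
        and E: "energy s lam u = (INF v \<in> nodal_nehari \<Omega> s lam. energy s lam v)"
        using u by (auto simp: least_energy_nodal_solution_def)
      obtain v where v: "v \<in> nodal_nehari \<Omega> s lam" "energy s lam v \<le> 2 * s / N * \<theta> powr (N / (2 * s))"
        using nodal_nehari_energy_upper_bound[OF s1 \<Omega> \<theta> less_imp_le[OF lam(1)] l1] unfolding N_def by blast
      have "energy s lam u \<le> energy s lam v"
        unfolding E
      \<comment> \<open>The infimum is a genuine one: on the Nehari set the energy is s/N times an
        L^p mass, hence bounded below by 0.\<close>
      proof (rule cINF_lower[OF _ v(1)])
        show "bdd_below (energy s lam ` nodal_nehari \<Omega> s lam)"
          using nehari_energy[OF s1] s1 by (intro bdd_belowI2[of _ 0]) (auto simp: Lp_pow_def)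
      qed
      from order_trans[OF this v(2)]
      have "s / N * Lp_pow (crit_exp CARD('n) s) u \<le> s / N * (2 * \<theta> powr (N / (2 * s)))"
        unfolding nehari_energy[OF s1 nn] N_def by (simp add: mult_ac)
      then have le: "Lp_pow (crit_exp CARD('n) s) u \<le> 2 * \<theta> powr (N / (2 * s))"
        by (rule mult_left_le_imp_le) (use s1 N in simp)
      have "\<theta> powr (N / (2 * s)) = S powr (N / (2 * s)) * ((5 / 4) powr (2 * s / N)) powr (N / (2 * s))"
        unfolding \<theta>_def by (rule powr_mult)
      also have "((5 / 4 :: real) powr (2 * s / N)) powr (N / (2 * s)) = 5 / 4" unfolding powr_powr e by simp
      finally have th: "\<theta> powr (N / (2 * s)) = S powr (N / (2 * s)) * (5 / 4)" .
      define t where "t = 1 - lam / lambda1 \<Omega> s"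
      have "lam / lambda1 \<Omega> s \<le> lam / c" using lam c cl by (intro divide_left_mono mult_pos_pos) auto
      also have "\<dots> < 1 - \<kappa>" using lam(2) c by (simp add: lhat_def pos_divide_less_eq mult.commute)
      finally have tk: "\<kappa> < t" by (simp add: t_def)
      have "5 / 6 = ((5 / 6 :: real) powr (2 * s / N)) powr (N / (2 * s))" unfolding powr_powr e by simp
      \<comment> \<open>The exponent s0 in \<kappa> instead of s makes \<kappa> larger, as the base
        is below 1; here s0 \<le> s enters.\<close>
      also have "\<dots> \<le> \<kappa> powr (N / (2 * s))"
        unfolding \<kappa>_def using s s1 N by (intro powr_mono2 powr_mono' divide_right_mono) auto
      also have "\<dots> < t powr (N / (2 * s))" using tk \<kappa> s1 N by (intro powr_less_mono2) auto
      finally have t56: "5 / 6 < t powr (N / (2 * s))" .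
      have "2 * \<theta> powr (N / (2 * s)) = 3 * (5 / 6 * S powr (N / (2 * s)))" unfolding th by simp
      also have "\<dots> < 3 * (t powr (N / (2 * s)) * S powr (N / (2 * s)))"
        using t56 S by simp
      also have "t powr (N / (2 * s)) * S powr (N / (2 * s)) = (t * S) powr (N / (2 * s))"
        using tk \<kappa> S by (simp add: powr_mult)
      finally have mass: "Lp_pow (crit_exp CARD('n) s) u < 3 * ((1 - lam / lambda1 \<Omega> s) * best_constant \<Omega> s) powr (real CARD('n) / (2 * s))"
        using le by (simp add: t_def S_def N_def)
      show ?thesis
        using nn by (intro two_nodal_regions[OF s1 \<Omega> w _ _ less_imp_le[OF lam(1)] l1 mass]) (auto simp: nodal_nehari_def)
    qed
    then show ?thesis using lhat cl by auto
  qed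
  then show ?thesis using lhat(1) by blast
qed

theorem theorem2p5p1:
  fixes \<Omega> :: "(real^'n) set"
  assumes "smooth_bounded_domain \<Omega>"
  shows "(\<forall>s. 0 < s \<and> s < 1 \<and> real CARD('n) \<ge> 6 * s \<longrightarrow>
            (\<exists>lhat. 0 < lhat \<and> lhat \<le> lambda1 \<Omega> s \<and>
               (\<forall>lam u. 0 < lam \<and> lam < lhat \<and> least_energy_nodal_solution \<Omega> s lam u \<longrightarrow>
                  card (nodal_regions (extension s u)) = 2)))
       \<and> (\<forall>s0. 0 < s0 \<and> s0 < 1 \<longrightarrow>
            (\<exists>lhat. 0 < lhat \<and>
               (\<forall>s lam u. s0 \<le> s \<and> s < 1 \<and> real CARD('n) \<ge> 6 * s \<and> 0 < lam \<and> lam < lhat \<and>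
                   least_energy_nodal_solution \<Omega> s lam u \<longrightarrow>
                  card (nodal_regions (extension s u)) = 2)))"
proof -
  have \<Omega>: "open \<Omega>" "\<Omega> \<noteq> {}" "bounded \<Omega>" using assms by (auto simp: smooth_bounded_domain_def)
  show ?thesis
  proof (intro conjI allI impI; elim conjE)
    \<comment> \<open>The uniform statement with s0 = s, which also contains the comparison with
      \<open>lambda1\<close>.\<close>
    fix s :: real assume s: "0 < s" "s < 1" "6 * s \<le> real CARD('n)"
    then show "\<exists>lhat. 0 < lhat \<and> lhat \<le> lambda1 \<Omega> s \<and>
               (\<forall>lam u. 0 < lam \<and> lam < lhat \<and> least_energy_nodal_solution \<Omega> s lam u \<longrightarrow>
                  card (nodal_regions (extension s u)) = 2)"
      using two_nodal_regions_uniform[OF \<Omega> s(1,2)] by blast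
  next
    fix s0 :: real assume s0: "0 < s0" "s0 < 1"
    then show "\<exists>lhat. 0 < lhat \<and>
               (\<forall>s lam u. s0 \<le> s \<and> s < 1 \<and> real CARD('n) \<ge> 6 * s \<and> 0 < lam \<and> lam < lhat \<and>
                   least_energy_nodal_solution \<Omega> s lam u \<longrightarrow>
                  card (nodal_regions (extension s u)) = 2)"
      using two_nodal_regions_uniform[OF \<Omega> s0] by blast
  qed
qed

end
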